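(* Let $\mathcal{X}$ be a determinantal point process on $\Lambda$ with a trace-class kernel $K$, where $K(x,y)=\sum_{k}\kappa_k\psi_k(x)\overline{\psi_k(y)}$ with $\psi_k$ normalized eigenfunctions of $K$ with eigenvalues $\kappa_k\in[0,1]$ (finitely or infinitely many terms are allowed). Let $D_i\subset\Lambda$, $1\le i\le r$, be mutually disjoint and simultaneously observable. Let $\mathbf{e}_i$ be the standard basis vectors in $\mathbb{R}^r$. Denote by $\phi_k$ the common eigenfunctions of $K$ on the $D_i$'s and by $\lambda_{k,i}$ the corresponding eigenvalues. Write $\lambda_k=\sum_i\lambda_{k,i}$; then $\lambda_k\le 1$. Moreover, $$(\mathcal{X}(D_1),\dots,\mathcal{X}(D_r))\stackrel{d}{=}\sum_k(\xi_{k,1},\dots,\xi_{k,r}),$$ where the vectors $\vec{\xi}_k=(\xi_{k,1},\dots,\xi_{k,r})$ are independent for different values of $k$, with $\mathbf{P}(\vec{\xi}_k=\mathbf{e}_i)=\lambda_{k,i}$ for $1\le i\le r$ and $\mathbf{P}(\vec{\xi}_k=\mathbf{0})=1-\lambda_k$. In words, $(\mathcal{X}(D_1),\dots,\mathcal{X}(D_r))$ has the same distribution as the vector of counts in $r$ cells, if we pick $n$ balls (one for each index $k$; $n=\infty$ is allowed) and assign the $k$-th ball to the $i$-th cell with probability $\lambda_{k,i}$ (there may be a positive probability of not assigning it to any of the cells).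
   Context: $\Lambda$ is a locally compact Polish space with a Radon reference measure $\mu$. A point process on $\Lambda$ is a random integer-valued positive Radon measure $\mathcal{X}$ on $\Lambda$; it is simple if almost surely it assigns measure at most $1$ to singletons. The joint intensities of $\mathcal{X}$ with respect to $\mu$ are functions $\rho_k:\Lambda^k\to[0,\infty)$, $k\ge1$, such that for every family of mutually disjoint subsets $B_1,\dots,B_k$ of $\Lambda$, $\mathbf{E}\big[\prod_{i=1}^k\mathcal{X}(B_i)\big]=\int_{B_1\times\cdots\times B_k}\rho_k(x_1,\dots,x_k)\,d\mu(x_1)\cdots d\mu(x_k)$. A point process is determinantal with kernel $K$ if it is simple and $\rho_k(x_1,\dots,x_k)=\det(K(x_i,x_j))_{1\le i,j\le k}$ for every $k\ge1$ and $x_1,\dots,x_k\in\Lambda$. The kernel $K$ defines an integral operator on $L^2(\Lambda,\mu)$, assumed self-adjoint and non-negative; eigenfunctions and eigenvalues of $K$ are those of this operator. For $A\subset\Lambda$, the restricted kernel $K|_{A\times A}$ acts as an integral operator on $L^2(A)$. Given an integral kernel $K$ acting on $L^2(\Lambda)$, the subsets $D_1,\dots,D_r$ of $\Lambda$, with $D=\bigcup_i D_i$, are called simultaneously observable if the eigenfunctions of the restricted kernel $K|_{D\times D}$ are also eigenfunctions of $K|_{D_i\times D_i}$ acting on $L^2(D_i)$ for every $1\le i\le r$. These are the common eigenfunctions $\phi_k$, and $\lambda_{k,i}$ is the eigenvalue of $K|_{D_i\times D_i}$ corresponding to $\phi_k$.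
   Formalization: Simultaneously observable is taken to mean that the common eigenfunctions φ_k are also pairwise orthogonal and diagonalizing on each D_i (λ_{k,i}=0 if φ_k vanishes on D_i); without orthogonality on the D_i the claim fails, e.g. for two singletons in a two-point space. *)

theory Defs
  imports "HOL-Probability.Probability" "Jordan_Normal_Form.Determinant"
begin

section \<open>Point processes and joint intensities\<close>

definition radon_measure :: "'a::t2_space measure \<Rightarrow> bool" where
  "radon_measure \<mu> \<longleftrightarrow>
     sets \<mu> = sets borel \<and>
     (\<forall>C. compact C \<longrightarrow> emeasure \<mu> C < \<infinity>) \<and>
     (\<forall>B\<in>sets borel. emeasure \<mu> B = (SUP C\<in>{C. compact C \<and> C \<subseteq> B}. emeasure \<mu> C))"

text \<open>A random measure is measurable when all its evaluations on Borel sets are. An integer-valued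
  Radon measure is still allowed to give infinite mass to sets that are not relatively compact.\<close>

definition point_process :: "'w measure \<Rightarrow> ('w \<Rightarrow> 'a::t2_space measure) \<Rightarrow> bool" where
  "point_process M X \<longleftrightarrow>
     (\<forall>\<omega>\<in>space M. radon_measure (X \<omega>) \<and>
        (\<forall>B\<in>sets borel. emeasure (X \<omega>) B \<in> range of_nat \<union> {\<infinity>})) \<and>
     (\<forall>B\<in>sets borel. (\<lambda>\<omega>. emeasure (X \<omega>) B) \<in> borel_measurable M)"

definition simple_process :: "'w measure \<Rightarrow> ('w \<Rightarrow> 'a::t2_space measure) \<Rightarrow> bool" where
  "simple_process M X \<longleftrightarrow> (AE \<omega> in M. \<forall>x. emeasure (X \<omega>) {x} \<le> 1)"

text \<open>Points of the \<open>k\<close>-fold product are extensional functions on \<open>{..<k}\<close>. Both sides of the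
  defining identity are taken in \<open>[0,\<infinity>]\<close>.\<close>

definition joint_intensities ::
  "'w measure \<Rightarrow> ('w \<Rightarrow> 'a::t2_space measure) \<Rightarrow> 'a measure \<Rightarrow> (nat \<Rightarrow> (nat \<Rightarrow> 'a) \<Rightarrow> real) \<Rightarrow> bool" where
  "joint_intensities M X \<mu> \<rho> \<longleftrightarrow>
     (\<forall>k\<ge>1.
        \<rho> k \<in> borel_measurable (\<Pi>\<^sub>M i\<in>{..<k}. \<mu>) \<and>
        (\<forall>x\<in>(\<Pi>\<^sub>E i\<in>{..<k}. UNIV). 0 \<le> \<rho> k x) \<and>
        (\<forall>B. (\<forall>i<k. B i \<in> sets borel) \<and> disjoint_family_on B {..<k} \<longrightarrow>
           (\<integral>\<^sup>+\<omega>. (\<Prod>i<k. emeasure (X \<omega>) (B i)) \<partial>M) =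
           (\<integral>\<^sup>+x\<in>(\<Pi>\<^sub>E i\<in>{..<k}. B i). ennreal (\<rho> k x) \<partial>(\<Pi>\<^sub>M i\<in>{..<k}. \<mu>))))"

definition determinantal_process ::
  "'w measure \<Rightarrow> ('w \<Rightarrow> 'a::t2_space measure) \<Rightarrow> 'a measure \<Rightarrow> ('a \<Rightarrow> 'a \<Rightarrow> complex) \<Rightarrow> bool" where
  "determinantal_process M X \<mu> K \<longleftrightarrow>
     point_process M X \<and> simple_process M X \<and>
     (\<exists>\<rho>. joint_intensities M X \<mu> \<rho> \<and>
        (\<forall>k\<ge>1. \<forall>x\<in>(\<Pi>\<^sub>E i\<in>{..<k}. UNIV).
           complex_of_real (\<rho> k x) = Determinant.det (Matrix.mat k k (\<lambda>(i, j). K (x i) (x j)))))"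

section \<open>Integral operators on \<open>L\<^sup>2\<close>\<close>

text \<open>Elements of \<open>L\<^sup>2(A)\<close> are represented by functions on the whole space of which only the
  values on \<open>A\<close>, up to null sets, matter.\<close>

definition L2_on :: "'a measure \<Rightarrow> 'a set \<Rightarrow> ('a \<Rightarrow> complex) \<Rightarrow> bool" where
  "L2_on \<mu> A f \<longleftrightarrow> set_borel_measurable \<mu> A f \<and> set_integrable \<mu> A (\<lambda>x. (cmod (f x))\<^sup>2)"

definition L2_inner :: "'a measure \<Rightarrow> 'a set \<Rightarrow> ('a \<Rightarrow> complex) \<Rightarrow> ('a \<Rightarrow> complex) \<Rightarrow> complex" where
  "L2_inner \<mu> A f g = (LINT x:A|\<mu>. f x * cnj (g x))"

definition orthogonal_on :: "'a measure \<Rightarrow> 'a set \<Rightarrow> nat set \<Rightarrow> (nat \<Rightarrow> 'a \<Rightarrow> complex) \<Rightarrow> bool" where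
  "orthogonal_on \<mu> A I \<phi> \<longleftrightarrow>
     (\<forall>k\<in>I. L2_on \<mu> A (\<phi> k)) \<and> (\<forall>k\<in>I. \<forall>l\<in>I. k \<noteq> l \<longrightarrow> L2_inner \<mu> A (\<phi> k) (\<phi> l) = 0)"

definition orthonormal_on :: "'a measure \<Rightarrow> 'a set \<Rightarrow> nat set \<Rightarrow> (nat \<Rightarrow> 'a \<Rightarrow> complex) \<Rightarrow> bool" where
  "orthonormal_on \<mu> A I \<phi> \<longleftrightarrow>
     orthogonal_on \<mu> A I \<phi> \<and> (\<forall>k\<in>I. L2_inner \<mu> A (\<phi> k) (\<phi> k) = 1)"

text \<open>The operator with kernel \<open>K\<close> restricted to \<open>A \<times> A\<close>.\<close>

definition integral_op ::
  "'a measure \<Rightarrow> ('a \<Rightarrow> 'a \<Rightarrow> complex) \<Rightarrow> 'a set \<Rightarrow> ('a \<Rightarrow> complex) \<Rightarrow> 'a \<Rightarrow> complex" where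
  "integral_op \<mu> K A f x = (LINT y:A|\<mu>. K x y * f y)"

definition nonneg_selfadjoint_kernel :: "'a measure \<Rightarrow> ('a \<Rightarrow> 'a \<Rightarrow> complex) \<Rightarrow> bool" where
  "nonneg_selfadjoint_kernel \<mu> K \<longleftrightarrow>
     case_prod K \<in> borel_measurable (\<mu> \<Otimes>\<^sub>M \<mu>) \<and>
     (\<forall>f. L2_on \<mu> UNIV f \<longrightarrow>
        (AE x in \<mu>. integrable \<mu> (\<lambda>y. K x y * f y)) \<and> L2_on \<mu> UNIV (integral_op \<mu> K UNIV f)) \<and>
     (\<forall>f g. L2_on \<mu> UNIV f \<and> L2_on \<mu> UNIV g \<longrightarrow>
        L2_inner \<mu> UNIV (integral_op \<mu> K UNIV f) g = L2_inner \<mu> UNIV f (integral_op \<mu> K UNIV g)) \<and>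
     (\<forall>f. L2_on \<mu> UNIV f \<longrightarrow> 0 \<le> Re (L2_inner \<mu> UNIV (integral_op \<mu> K UNIV f) f))"

text \<open>Trace class: \<open>\<Sum>\<^sub>n |\<langle>K e\<^sub>n, e\<^sub>n\<rangle>| < \<infinity>\<close> for every orthonormal system \<open>e\<close>. Countable systems
  suffice since \<open>L\<^sup>2\<close> of a Radon measure on a Polish space is separable.\<close>

definition trace_class_kernel :: "'a measure \<Rightarrow> ('a \<Rightarrow> 'a \<Rightarrow> complex) \<Rightarrow> bool" where
  "trace_class_kernel \<mu> K \<longleftrightarrow>
     (\<forall>J e. orthonormal_on \<mu> UNIV J e \<longrightarrow>
        (\<lambda>n. cmod (L2_inner \<mu> UNIV (integral_op \<mu> K UNIV (e n)) (e n))) summable_on J)"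

definition eigenfunction ::
  "'a measure \<Rightarrow> ('a \<Rightarrow> 'a \<Rightarrow> complex) \<Rightarrow> 'a set \<Rightarrow> ('a \<Rightarrow> complex) \<Rightarrow> real \<Rightarrow> bool" where
  "eigenfunction \<mu> K A f c \<longleftrightarrow>
     L2_on \<mu> A f \<and> \<not> (AE x\<in>A in \<mu>. f x = 0) \<and>
     (AE x\<in>A in \<mu>. integral_op \<mu> K A f x = complex_of_real c * f x)"

text \<open>An orthogonal family of eigenfunctions that diagonalizes the operator on \<open>L\<^sup>2(A)\<close>: the operator
  vanishes on the orthogonal complement of the family. Hence every eigenfunction with non-zero
  eigenvalue lies in the closed span; a basis of the null space need not be included.\<close>

definition eigensystem ::
  "'a measure \<Rightarrow> ('a \<Rightarrow> 'a \<Rightarrow> complex) \<Rightarrow> 'a set \<Rightarrow> nat set \<Rightarrow> (nat \<Rightarrow> 'a \<Rightarrow> complex) \<Rightarrow> (nat \<Rightarrow> real) \<Rightarrow> bool" where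
  "eigensystem \<mu> K A I \<phi> c \<longleftrightarrow>
     (\<forall>k\<in>I. eigenfunction \<mu> K A (\<phi> k) (c k)) \<and>
     orthogonal_on \<mu> A I \<phi> \<and>
     (\<forall>f. L2_on \<mu> A f \<and> (\<forall>k\<in>I. L2_inner \<mu> A f (\<phi> k) = 0) \<longrightarrow>
        (AE x\<in>A in \<mu>. integral_op \<mu> K A f x = 0))"

section \<open>Simultaneous observability\<close>

text \<open>``The eigenfunctions'' of an operator are read as an \<^emph>\<open>eigensystem\<close>, both on \<open>D\<close> and on each
  \<open>D i\<close>. Orthogonality on the pieces is essential: on a two-point space with \<open>D\<^sub>1\<close>, \<open>D\<^sub>2\<close> the two
  singletons, both eigenvectors of any Hermitian \<open>2 \<times> 2\<close> matrix restrict to eigenvectors (or 0) of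
  each diagonal entry, so \<open>D\<^sub>1\<close> would receive two independent balls, although a simple process
  has at most one point there.
  A \<open>\<phi> k\<close> may vanish on some \<open>D i\<close>; it is then not an eigenfunction there and
  the corresponding \<open>lam k i\<close> is 0.\<close>

definition common_eigenfunctions ::
  "'a measure \<Rightarrow> ('a \<Rightarrow> 'a \<Rightarrow> complex) \<Rightarrow> ('r::finite \<Rightarrow> 'a set) \<Rightarrow> nat set \<Rightarrow>
   (nat \<Rightarrow> 'a \<Rightarrow> complex) \<Rightarrow> (nat \<Rightarrow> 'r \<Rightarrow> real) \<Rightarrow> bool" where
  "common_eigenfunctions \<mu> K D I \<phi> lam \<longleftrightarrow>
     (\<exists>c. eigensystem \<mu> K (\<Union>i. D i) I \<phi> c) \<and>
     (\<forall>i. eigensystem \<mu> K (D i) {k\<in>I. \<not> (AE x\<in>D i in \<mu>. \<phi> k x = 0)} \<phi> (\<lambda>k. lam k i) \<and>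
          (\<forall>k\<in>I. (AE x\<in>D i in \<mu>. \<phi> k x = 0) \<longrightarrow> lam k i = 0))"

definition simultaneously_observable ::
  "'a measure \<Rightarrow> ('a \<Rightarrow> 'a \<Rightarrow> complex) \<Rightarrow> ('r::finite \<Rightarrow> 'a set) \<Rightarrow> bool" where
  "simultaneously_observable \<mu> K D \<longleftrightarrow> (\<exists>I \<phi> lam. common_eigenfunctions \<mu> K D I \<phi> lam)"

end

theory Submission
  imports Defs
begin

text \<open>
  The vector of counts and the vector of balls in cells are compared through their joint factorial
  moments. Fix cells \<open>f 0, \<dots>, f (n - 1)\<close>. The expected number of \<open>n\<close>-tuples of distinct points of the
  process, the \<open>j\<close>-th one in \<open>D (f j)\<close>, is the integral of \<open>det (K (x i) (x j))\<close> over the product of the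
  sets \<open>D (f j)\<close>. On the union of the pieces the kernel is \<open>\<Sum>k. c k * e k x * cnj (e k y)\<close>, where the
  \<open>e k\<close> are the normalized common eigenfunctions. Expanding the determinant and integrating out each
  point, orthogonality of the \<open>e k\<close> on the piece \<open>D (f j)\<close> leaves a sum over \<open>k 0, \<dots>, k (n - 1)\<close> of
  \<open>\<Prod>j. c (k j) * q (k j) (f j)\<close> times the determinant of the matrix with entries 1 where \<open>k i = k j\<close> and
  0 elsewhere, \<open>q k i\<close> being the squared norm of \<open>e k\<close> on \<open>D i\<close>. That determinant is 1 for
  injective \<open>k\<close> and 0 otherwise, and \<open>c k * q k i\<close> is the eigenvalue \<open>lam k i\<close>
  (\<open>piecewise_spectral_data\<close>). So the moment is the sum of \<open>\<Prod>j. lam (k j) (f j)\<close> over injective \<open>k\<close>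
  (\<open>nn_integral_det_limit\<close>). This is also the expected number of \<open>n\<close>-tuples of distinct balls, the
  \<open>j\<close>-th one in cell \<open>f j\<close> (\<open>falling_moment_cell_count\<close>). All factorial moments agree, and since
  the balls have exponential moments, so do the laws (\<open>distr_eqI_falling_moments\<close>).

  Two points need care. The diagonal of the kernel enters the determinant although it may be a null
  set of pairs; \<open>eigen_expansion\<close> therefore shows that the eigenfunction expansion holds at all pairs of points
  outside a null set of points. And joint intensities describe products of masses of disjoint sets
  only; \<open>falling_moment_joint_intensity\<close> extends this to tuples of distinct points in sets that may
  coincide, by refining partitions. This is where simplicity of the process is used.
\<close>

section \<open>Square-integrable functions\<close>

text \<open>The pieces \<open>D i\<close> are handled by multiplying with indicator functions instead of changing
  the measure space; hence the following notions carry no set argument, and the same lemmas serve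
  for \<open>L\<^sup>2(\<mu>)\<close> and for \<open>\<ell>\<^sup>2\<close>, the case of a counting measure.\<close>

definition sq_int :: "'a measure \<Rightarrow> ('a \<Rightarrow> complex) \<Rightarrow> bool" where
  "sq_int M f \<longleftrightarrow> f \<in> borel_measurable M \<and> integrable M (\<lambda>x. (cmod (f x))\<^sup>2)"

definition ip :: "'a measure \<Rightarrow> ('a \<Rightarrow> complex) \<Rightarrow> ('a \<Rightarrow> complex) \<Rightarrow> complex" where
  "ip M f g = (\<integral>x. f x * cnj (g x) \<partial>M)"

definition sqnorm :: "'a measure \<Rightarrow> ('a \<Rightarrow> complex) \<Rightarrow> real" where
  "sqnorm M f = (\<integral>x. (cmod (f x))\<^sup>2 \<partial>M)"

lemma sq_int_measurable [measurable_dest]: "sq_int M f \<Longrightarrow> f \<in> borel_measurable M"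
  by (simp add: sq_int_def)

lemma sq_int_integrable_norm_mult:
  assumes "sq_int M f" "sq_int M g"
  shows "integrable M (\<lambda>x. cmod (f x) * cmod (g x))"
proof (rule Bochner_Integration.integrable_bound)
  show "integrable M (\<lambda>x. (cmod (f x))\<^sup>2 + (cmod (g x))\<^sup>2)"
    using assms by (simp add: sq_int_def)
  note assms[THEN sq_int_measurable, measurable]
  show "(\<lambda>x. cmod (f x) * cmod (g x)) \<in> borel_measurable M"
    by measurable
  have "\<And>a b::real. 0 \<le> a \<Longrightarrow> 0 \<le> b \<Longrightarrow> a * b \<le> a\<^sup>2 + b\<^sup>2"
  proof -
    fix a b :: real assume "0 \<le> a" "0 \<le> b"
    then show "a * b \<le> a\<^sup>2 + b\<^sup>2"
      using sum_squares_bound[of a b] mult_nonneg_nonneg[of a b] by linarith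
  qed
  then show "AE x in M. norm (cmod (f x) * cmod (g x)) \<le> norm ((cmod (f x))\<^sup>2 + (cmod (g x))\<^sup>2)"
    by (auto simp: abs_mult)
qed

lemma sq_int_integrable_mult:
  assumes "sq_int M f" "sq_int M g"
  shows "integrable M (\<lambda>x. f x * cnj (g x))"
proof -
  note assms[THEN sq_int_measurable, measurable]
  have [measurable]: "cnj \<in> borel_measurable borel"
    by (intro borel_measurable_continuous_onI continuous_intros)
  have "(\<lambda>x. f x * cnj (g x)) \<in> borel_measurable M"
    by measurable
  then show ?thesis
    by (rule Bochner_Integration.integrable_bound[OF sq_int_integrable_norm_mult[OF assms]])
       (auto simp: norm_mult)
qed

lemma sq_int_zero [simp]: "sq_int M (\<lambda>_. 0)"
  by (simp add: sq_int_def)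

lemma sq_int_scale: "sq_int M f \<Longrightarrow> sq_int M (\<lambda>x. c * f x)"
  by (auto simp: sq_int_def norm_mult power_mult_distrib)

lemma sq_int_add:
  assumes "sq_int M f" "sq_int M g"
  shows "sq_int M (\<lambda>x. f x + g x)"
  unfolding sq_int_def
proof
  note assms[THEN sq_int_measurable, measurable]
  show "(\<lambda>x. f x + g x) \<in> borel_measurable M" by measurable
  show "integrable M (\<lambda>x. (cmod (f x + g x))\<^sup>2)"
  proof (rule Bochner_Integration.integrable_bound)
    show "integrable M (\<lambda>x. 2 * (cmod (f x))\<^sup>2 + 2 * (cmod (g x))\<^sup>2)"
      using assms by (simp add: sq_int_def)
    show "(\<lambda>x. (cmod (f x + g x))\<^sup>2) \<in> borel_measurable M"
      by measurable
    have "(cmod (a + b))\<^sup>2 \<le> 2 * (cmod a)\<^sup>2 + 2 * (cmod b)\<^sup>2" for a b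
    proof -
      have "(cmod (a + b))\<^sup>2 \<le> (cmod a + cmod b)\<^sup>2"
        by (intro power_mono norm_triangle_ineq) auto
      also have "\<dots> \<le> 2 * (cmod a)\<^sup>2 + 2 * (cmod b)\<^sup>2"
        using sum_squares_bound[of "cmod a" "cmod b"] by (simp add: power2_sum)
      finally show ?thesis .
    qed
    then show "AE x in M. norm ((cmod (f x + g x))\<^sup>2) \<le> norm (2 * (cmod (f x))\<^sup>2 + 2 * (cmod (g x))\<^sup>2)"
      by auto
  qed
qed

lemma sq_int_diff:
  assumes "sq_int M f" "sq_int M g"
  shows "sq_int M (\<lambda>x. f x - g x)"
  using sq_int_add[OF assms(1) sq_int_scale[OF assms(2), of "-1"]] by simp

lemma sq_int_sum:
  assumes "\<And>k. k \<in> F \<Longrightarrow> sq_int M (f k)"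
  shows "sq_int M (\<lambda>x. \<Sum>k\<in>F. f k x)"
  using assms by (induction F rule: infinite_finite_induct) (auto intro: sq_int_add)

lemma sq_int_indicator:
  assumes "sq_int M f" "A \<in> sets M"
  shows "sq_int M (\<lambda>x. indicator A x * f x)"
  unfolding sq_int_def
proof
  note [measurable] = sq_int_measurable[OF assms(1)] assms(2)
  show m: "(\<lambda>x. indicator A x * f x) \<in> borel_measurable M" by measurable
  show "integrable M (\<lambda>x. (cmod (indicator A x * f x))\<^sup>2)"
    by (rule Bochner_Integration.integrable_bound[of M "\<lambda>x. (cmod (f x))\<^sup>2"])
       (use assms m in \<open>auto simp: sq_int_def indicator_def\<close>)
qed

lemma ip_add_left:
  assumes "sq_int M f" "sq_int M g" "sq_int M h"
  shows "ip M (\<lambda>x. f x + g x) h = ip M f h + ip M g h"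
  using sq_int_integrable_mult[OF assms(1,3)] sq_int_integrable_mult[OF assms(2,3)]
  by (simp add: ip_def distrib_right)

lemma ip_diff_left:
  assumes "sq_int M f" "sq_int M g" "sq_int M h"
  shows "ip M (\<lambda>x. f x - g x) h = ip M f h - ip M g h"
  using sq_int_integrable_mult[OF assms(1,3)] sq_int_integrable_mult[OF assms(2,3)]
  by (simp add: ip_def left_diff_distrib)

lemma ip_scale_left: "ip M (\<lambda>x. c * f x) h = c * ip M f h"
  by (simp add: ip_def mult.assoc)

lemma ip_cnj: "cnj (ip M f g) = ip M g f"
proof -
  have "cnj (ip M f g) = (\<integral>x. cnj (f x * cnj (g x)) \<partial>M)"
    unfolding ip_def by (rule Bochner_Integration.integral_cnj[symmetric])
  then show ?thesis by (simp add: ip_def mult.commute)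
qed

lemma ip_diff_right:
  assumes "sq_int M f" "sq_int M g" "sq_int M h"
  shows "ip M h (\<lambda>x. f x - g x) = ip M h f - ip M h g"
  using arg_cong[OF ip_diff_left[OF assms], of cnj] by (simp add: ip_cnj)

lemma ip_scale_right: "ip M h (\<lambda>x. c * f x) = cnj c * ip M h f"
  using arg_cong[OF ip_scale_left[of M c f h], of cnj] by (simp only: ip_cnj complex_cnj_mult)

lemma ip_sum_left:
  assumes "\<And>k. k \<in> F \<Longrightarrow> sq_int M (f k)" "sq_int M h"
  shows "ip M (\<lambda>x. \<Sum>k\<in>F. f k x) h = (\<Sum>k\<in>F. ip M (f k) h)"
  using assms by (induction F rule: infinite_finite_induct)
    (auto simp: ip_add_left sq_int_sum, auto simp: ip_def)

lemma ip_sum_right: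
  assumes "\<And>k. k \<in> F \<Longrightarrow> sq_int M (f k)" "sq_int M h"
  shows "ip M h (\<lambda>x. \<Sum>k\<in>F. f k x) = (\<Sum>k\<in>F. ip M h (f k))"
  using arg_cong[OF ip_sum_left[OF assms], where f=cnj] by (simp add: ip_cnj cnj_sum)

lemma ip_zero_left [simp]: "ip M (\<lambda>_. 0) h = 0" by (simp add: ip_def)

lemma ip_self: "ip M f f = of_real (sqnorm M f)"
  unfolding ip_def sqnorm_def by (simp add: complex_norm_square[symmetric] flip: integral_complex_of_real)

lemma sqnorm_nonneg [simp]: "0 \<le> sqnorm M f"
  by (simp add: sqnorm_def)

lemma sqnorm_eq_0_AE:
  assumes "sq_int M f"
  shows "sqnorm M f = 0 \<longleftrightarrow> (AE x in M. f x = 0)"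
  using assms unfolding sqnorm_def sq_int_def
  by (subst integral_nonneg_eq_0_iff_AE) auto

lemma nn_integral_weighted_squares:
  assumes "\<And>n. 0 \<le> a n" "\<And>n. sq_int M (u n)"
  shows "(\<integral>\<^sup>+x. (\<Sum>n. ennreal (a n * (cmod (u n x))\<^sup>2)) \<partial>M) = (\<Sum>n. ennreal (a n * sqnorm M (u n)))"
proof -
  note [measurable] = sq_int_measurable[OF assms(2)]
  have "(\<integral>\<^sup>+x. (\<Sum>n. ennreal (a n * (cmod (u n x))\<^sup>2)) \<partial>M) = (\<Sum>n. \<integral>\<^sup>+x. ennreal (a n * (cmod (u n x))\<^sup>2) \<partial>M)"
    by (rule nn_integral_suminf) measurable
  moreover have "(\<integral>\<^sup>+x. ennreal (a n * (cmod (u n x))\<^sup>2) \<partial>M) = ennreal (a n * sqnorm M (u n))" for n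
    using assms(1)[of n] assms(2)[of n] unfolding sqnorm_def sq_int_def
    by (subst nn_integral_eq_integral) auto
  ultimately show ?thesis by simp
qed

definition orthonormal :: "'a measure \<Rightarrow> 'i set \<Rightarrow> ('i \<Rightarrow> 'a \<Rightarrow> complex) \<Rightarrow> bool" where
  "orthonormal M I e \<longleftrightarrow> (\<forall>k\<in>I. sq_int M (e k)) \<and>
     (\<forall>k\<in>I. \<forall>l\<in>I. ip M (e k) (e l) = (if k = l then 1 else 0))"

text \<open>The polarized form of the Bessel identity. Taking \<open>f = g\<close> gives Bessel's inequality; with two
  different functions it expresses what is left of a Gram kernel after finitely many eigenfunctions
  have been split off.\<close>

lemma ip_projection_remainders:
  assumes "orthonormal M I e" "finite F" "F \<subseteq> I" "sq_int M f" "sq_int M g"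
  shows "ip M (\<lambda>x. f x - (\<Sum>k\<in>F. ip M f (e k) * e k x)) (\<lambda>x. g x - (\<Sum>k\<in>F. ip M g (e k) * e k x)) =
         ip M f g - (\<Sum>k\<in>F. ip M f (e k) * ip M (e k) g)"
proof -
  have e: "\<And>k. k \<in> F \<Longrightarrow> sq_int M (e k)"
    using assms by (auto simp: orthonormal_def)
  have on: "\<And>k l. k \<in> F \<Longrightarrow> l \<in> F \<Longrightarrow> ip M (e k) (e l) = (if k = l then 1 else 0)"
    using assms unfolding orthonormal_def by (meson subsetD)
  define P where "P h x = (\<Sum>k\<in>F. ip M h (e k) * e k x)" for h x
  have sP: "sq_int M (P h)" for h
    unfolding P_def by (intro sq_int_sum sq_int_scale e)
  have A: "ip M (P f) h = (\<Sum>k\<in>F. ip M f (e k) * ip M (e k) h)" if "sq_int M h" for h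
    unfolding P_def using e that by (subst ip_sum_left) (auto simp: ip_scale_left intro: sq_int_scale)
  have B: "ip M h (P g) = (\<Sum>k\<in>F. ip M h (e k) * ip M (e k) g)" if "sq_int M h" for h
    unfolding P_def using e that
    by (subst ip_sum_right) (auto simp: ip_scale_right ip_cnj intro: sq_int_scale intro!: sum.cong)
  have C: "ip M (e k) (P g) = ip M (e k) g" if "k \<in> F" for k
    using that assms(2) by (simp add: B e on if_distrib[of "\<lambda>x. x * _"] sum.delta cong: if_cong)
  have "ip M (\<lambda>x. f x - P f x) (\<lambda>x. g x - P g x) =
    ip M f g - ip M f (P g) - (ip M (P f) g - ip M (P f) (P g))"
    using assms sP by (simp add: ip_diff_left ip_diff_right sq_int_diff)
  also have "\<dots> = ip M f g - (\<Sum>k\<in>F. ip M f (e k) * ip M (e k) g)"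
    unfolding A[OF assms(5)] A[OF sP] B[OF assms(4)] by (simp add: C)
  finally show ?thesis by (simp add: P_def)
qed

lemma Bessel_remainder:
  assumes "orthonormal M I e" "finite F" "F \<subseteq> I" "sq_int M f"
  shows "sqnorm M (\<lambda>x. f x - (\<Sum>k\<in>F. ip M f (e k) * e k x)) =
         sqnorm M f - (\<Sum>k\<in>F. (cmod (ip M f (e k)))\<^sup>2)"
proof -
  have *: "ip M f (e k) * ip M (e k) f = of_real ((cmod (ip M f (e k)))\<^sup>2)" for k
    unfolding complex_norm_square ip_cnj ..
  show ?thesis
    using ip_projection_remainders[OF assms assms(4)]
    unfolding ip_self * of_real_sum[symmetric] of_real_diff[symmetric] of_real_eq_iff .
qed

lemma Bessel:
  assumes "orthonormal M I e" "finite F" "F \<subseteq> I" "sq_int M f"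
  shows "(\<Sum>k\<in>F. (cmod (ip M f (e k)))\<^sup>2) \<le> sqnorm M f"
proof -
  have "0 \<le> sqnorm M f - (\<Sum>k\<in>F. (cmod (ip M f (e k)))\<^sup>2)"
    unfolding Bessel_remainder[OF assms, symmetric] by (rule sqnorm_nonneg)
  then show ?thesis by simp
qed

lemma Cauchy_Schwarz:
  assumes "sq_int M f" "sq_int M g"
  shows "(cmod (ip M f g))\<^sup>2 \<le> sqnorm M f * sqnorm M g"
proof (cases "sqnorm M g = 0")
  case True
  then have "AE x in M. g x = 0" using sqnorm_eq_0_AE assms by blast
  then have "AE x in M. f x * cnj (g x) = 0" by eventually_elim simp
  then have "ip M f g = 0" unfolding ip_def by (rule integral_eq_zero_AE)
  then show ?thesis using True by simp
next
  case False
  define s where "s = sqrt (sqnorm M g)"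
  have s: "s > 0" "s\<^sup>2 = sqnorm M g" using False sqnorm_nonneg[of M g] by (auto simp: s_def less_le)
  define e where "e = (\<lambda>(_::unit) x. complex_of_real (1 / s) * g x)"
  have "ip M (e ()) (e ()) = of_real ((1 / s) * ((1 / s) * s\<^sup>2))"
    unfolding e_def ip_scale_left ip_scale_right ip_self s(2)
    by (simp only: complex_cnj_complex_of_real of_real_mult)
  also have "\<dots> = 1" using s(1) by (simp add: power2_eq_square)
  finally have "orthonormal M UNIV e"
    using sq_int_scale[OF assms(2)] unfolding orthonormal_def e_def
    by (simp del: of_real_divide)
  from Bessel[OF this, of UNIV f] assms have "(cmod (ip M f (e ())))\<^sup>2 \<le> sqnorm M f"
    by (simp add: UNIV_unit)
  moreover have "ip M f (e ()) = ip M f g / of_real s"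
    unfolding e_def ip_scale_right by simp
  ultimately have "(cmod (ip M f g))\<^sup>2 / s\<^sup>2 \<le> sqnorm M f"
    by (simp add: norm_divide power_divide)
  then have "(cmod (ip M f g))\<^sup>2 \<le> sqnorm M f * s\<^sup>2"
    using s(1) by (simp add: pos_divide_le_eq)
  then show ?thesis unfolding s(2) .
qed

lemma sqnorm_orthonormal_sum:
  assumes "orthonormal M I e" "finite F" "F \<subseteq> I"
  shows "sqnorm M (\<lambda>x. \<Sum>k\<in>F. a k * e k x) = (\<Sum>k\<in>F. (cmod (a k))\<^sup>2)"
proof -
  have e: "\<And>k. k \<in> F \<Longrightarrow> sq_int M (e k)"
    using assms by (auto simp: orthonormal_def)
  have on: "\<And>k l. k \<in> F \<Longrightarrow> l \<in> F \<Longrightarrow> ip M (e k) (e l) = (if k = l then 1 else 0)"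
    using assms unfolding orthonormal_def by (meson subsetD)
  have "ip M (\<lambda>x. \<Sum>k\<in>F. a k * e k x) (\<lambda>x. \<Sum>k\<in>F. a k * e k x) = (\<Sum>k\<in>F. \<Sum>l\<in>F. a k * cnj (a l) * ip M (e k) (e l))"
    using e by (simp add: ip_sum_left ip_sum_right ip_scale_left ip_scale_right sq_int_sum sq_int_scale mult.assoc sum_distrib_left)
  also have "\<dots> = (\<Sum>k\<in>F. \<Sum>l\<in>F. (if k = l then a k * cnj (a l) else 0))"
    by (intro sum.cong refl) (simp add: on)
  also have "\<dots> = of_real (\<Sum>k\<in>F. (cmod (a k))\<^sup>2)"
    using assms(2) by (simp add: complex_norm_square[symmetric])
  finally show ?thesis unfolding ip_self by (simp only: of_real_eq_iff)
qed


text \<open>The only use of completeness of \<open>L\<^sup>2\<close>: orthogonal projection onto the span of infinitely many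
  functions. A subsequence of the partial sums converges almost everywhere, and Fatou's lemma turns
  this into convergence in norm.\<close>

lemma Riesz_Fischer:
  fixes I :: "nat set"
  assumes on: "orthonormal M I e" and a: "summable (\<lambda>k. if k \<in> I then (cmod (a k))\<^sup>2 else 0)"
  obtains g where "sq_int M g"
    "(\<lambda>n. sqnorm M (\<lambda>x. g x - (\<Sum>k\<in>I \<inter> {..<n}. a k * e k x))) \<longlonglongrightarrow> 0"
proof -
  define b where "b k = (if k \<in> I then (cmod (a k))\<^sup>2 else 0)" for k
  define s where "s n x = (\<Sum>k\<in>I \<inter> {..<n}. a k * e k x)" for n x
  have b0: "b k \<ge> 0" for k by (simp add: b_def)
  have sb: "summable b" using a by (simp add: b_def[abs_def])
  have e: "sq_int M (e k)" if "k \<in> I" for k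
    using on that by (simp add: orthonormal_def)
  have ss: "sq_int M (s n)" for n
    unfolding s_def by (intro sq_int_sum sq_int_scale e) auto
  have sd: "sqnorm M (\<lambda>x. s m x - s n x) = sum b {n..<m}" if "n \<le> m" for m n
  proof -
    have *: "s m x - s n x = (\<Sum>k\<in>I \<inter> {n..<m}. a k * e k x)" for x
    proof -
      have split: "I \<inter> {..<m} = (I \<inter> {..<n}) \<union> (I \<inter> {n..<m})" using that by auto
      have "s m x = s n x + (\<Sum>k\<in>I \<inter> {n..<m}. a k * e k x)"
        unfolding s_def split by (rule sum.union_disjoint) auto
      then show ?thesis by simp
    qed
    have "sqnorm M (\<lambda>x. s m x - s n x) = (\<Sum>k\<in>I \<inter> {n..<m}. (cmod (a k))\<^sup>2)"
      unfolding * by (rule sqnorm_orthonormal_sum[OF on]) auto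
    also have "\<dots> = sum b {n..<m}"
      unfolding b_def Int_commute[of I] by (rule sum.inter_restrict) simp
    finally show ?thesis .
  qed
  \<comment> \<open>Along indices \<open>r i\<close> beyond which the tails are at most \<open>(1/4) ^ i\<close>, the increments \<open>d i\<close> are summable almost
    everywhere: the weights \<open>2 ^ i\<close> leave a convergent series of norms, and
    \<open>2 |d| \<le> (1/2) ^ i + 2 ^ i |d|\<^sup>2\<close>.\<close>
  have "\<exists>q. \<forall>m\<ge>q. \<forall>n. norm (sum b {m..<n}) < (1/4) ^ i" for i :: nat
    using sb[unfolded summable_Cauchy, rule_format, of "(1/4) ^ i"] by auto
  then obtain q where q: "\<And>i m n. m \<ge> q i \<Longrightarrow> norm (sum b {m..<n}) < (1/4) ^ i"
    by metis
  define r where "r i = (\<Sum>j\<le>i. q j + 1)" for i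
  have rq: "q i \<le> r i" for i
    unfolding r_def using member_le_sum[of i "{..i}" "\<lambda>j. q j + 1"] by simp
  have ri: "i \<le> r i" for i by (induction i) (auto simp: r_def)
  have rS: "r i \<le> r (Suc i)" for i by (simp add: r_def)
  define d where "d i x = s (r (Suc i)) x - s (r i) x" for i x
  have sqd: "sq_int M (d i)" for i unfolding d_def by (intro sq_int_diff ss)
  have nd: "sqnorm M (d i) \<le> (1/4) ^ i" for i
    using sd[OF rS[of i]] q[OF rq[of i], of "r (Suc i)"] b0
    unfolding d_def by (simp add: sum_nonneg)
  note [measurable] = sq_int_measurable[OF sqd] sq_int_measurable[OF ss]
  have "(\<integral>\<^sup>+x. (\<Sum>i. ennreal (2^i * (cmod (d i x))\<^sup>2)) \<partial>M) = (\<Sum>i. \<integral>\<^sup>+x. ennreal (2^i * (cmod (d i x))\<^sup>2) \<partial>M)"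
    by (rule nn_integral_suminf) measurable
  also have "\<dots> \<le> (\<Sum>i. ennreal ((1/2)^i))"
  proof (rule suminf_le)
    fix i
    have "(\<integral>\<^sup>+x. ennreal (2^i * (cmod (d i x))\<^sup>2) \<partial>M) = ennreal (2 ^ i * sqnorm M (d i))"
      using sqd[of i] unfolding sqnorm_def sq_int_def
      by (subst nn_integral_eq_integral) auto
    also have "\<dots> \<le> ennreal (2 ^ i * (1/4) ^ i)"
      using nd[of i] by (intro ennreal_leI mult_left_mono) auto
    also have "\<dots> = ennreal ((1/2)^i)" by (simp flip: power_mult_distrib)
    finally show "(\<integral>\<^sup>+x. ennreal (2^i * (cmod (d i x))\<^sup>2) \<partial>M) \<le> ennreal ((1/2)^i)" .
  qed auto
  also have "\<dots> = ennreal (\<Sum>i. (1/2)^i)"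
    by (rule suminf_ennreal2) (auto intro: summable_geometric)
  also have "\<dots> < \<infinity>" by simp
  finally have "(\<integral>\<^sup>+x. (\<Sum>i. ennreal (2^i * (cmod (d i x))\<^sup>2)) \<partial>M) \<noteq> \<infinity>" by simp
  then have "AE x in M. (\<Sum>i. ennreal (2^i * (cmod (d i x))\<^sup>2)) \<noteq> \<infinity>"
    by (intro nn_integral_PInf_AE) auto
  then have conv: "AE x in M. convergent (\<lambda>i. s (r i) x)"
  proof eventually_elim
    case (elim x)
    then have 1: "summable (\<lambda>i. 2^i * (cmod (d i x))\<^sup>2)"
      by (intro summable_suminf_not_top) auto
    have 2: "summable (\<lambda>i. (1/2::real)^i + 2^i * (cmod (d i x))\<^sup>2)"
      by (intro summable_add 1 summable_geometric) auto
    have "summable (\<lambda>i. d i x)"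
    proof (rule summable_comparison_test'[OF 2])
      fix i :: nat
      define p where "p = sqrt (2 ^ i)"
      have p: "p > 0" "p\<^sup>2 = 2 ^ i" by (simp_all add: p_def)
      have "2 * (1 / p) * (p * cmod (d i x)) \<le> (1 / p)\<^sup>2 + (p * cmod (d i x))\<^sup>2"
        by (rule sum_squares_bound)
      then have "2 * cmod (d i x) \<le> (1/2)^i + 2^i * (cmod (d i x))\<^sup>2"
        using p(1) by (simp add: power_mult_distrib power_divide p(2))
      then show "norm (d i x) \<le> (1/2)^i + 2^i * (cmod (d i x))\<^sup>2"
        using norm_ge_zero[of "d i x"] by linarith
    qed
    then have "convergent (\<lambda>n. \<Sum>i<n. d i x)" by (simp add: summable_iff_convergent)
    moreover have "(\<Sum>i<n. d i x) = s (r n) x - s (r 0) x" for n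
      unfolding d_def by (rule sum_lessThan_telescope)
    ultimately have "convergent (\<lambda>n. s (r n) x - s (r 0) x)" by simp
    then show "convergent (\<lambda>i. s (r i) x)" by (simp add: convergent_diff_const_right_iff)
  qed
  define g where "g x = lim (\<lambda>i. s (r i) x)" for x
  have [measurable]: "g \<in> borel_measurable M" unfolding g_def by measurable
  have fatou: "(\<integral>\<^sup>+x. ennreal ((cmod (g x - s n x))\<^sup>2) \<partial>M) \<le> ennreal (\<Sum>k. b (k + n))" for n
  proof -
    have "(\<integral>\<^sup>+x. ennreal ((cmod (g x - s n x))\<^sup>2) \<partial>M) = (\<integral>\<^sup>+x. liminf (\<lambda>i. ennreal ((cmod (s (r i) x - s n x))\<^sup>2)) \<partial>M)"
    proof (rule nn_integral_cong_AE, use conv in eventually_elim)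
      case (elim x)
      then have "(\<lambda>i. s (r i) x) \<longlonglongrightarrow> g x" by (simp add: g_def convergent_LIMSEQ_iff)
      then have "(\<lambda>i. ennreal ((cmod (s (r i) x - s n x))\<^sup>2)) \<longlonglongrightarrow> ennreal ((cmod (g x - s n x))\<^sup>2)"
        by (intro tendsto_intros)
      from lim_imp_Liminf[OF _ this] show ?case by simp
    qed
    also have "\<dots> \<le> liminf (\<lambda>i. \<integral>\<^sup>+x. ennreal ((cmod (s (r i) x - s n x))\<^sup>2) \<partial>M)"
      by (rule nn_integral_liminf) measurable
    also have "\<dots> \<le> limsup (\<lambda>i. \<integral>\<^sup>+x. ennreal ((cmod (s (r i) x - s n x))\<^sup>2) \<partial>M)"
      by (rule Liminf_le_Limsup) simp
    also have "\<dots> \<le> ennreal (\<Sum>k. b (k + n))"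
    proof (rule Limsup_bounded, rule eventually_sequentiallyI[of n])
      fix i assume "n \<le> i"
      then have ni: "n \<le> r i" using ri[of i] by simp
      have "(\<integral>\<^sup>+x. ennreal ((cmod (s (r i) x - s n x))\<^sup>2) \<partial>M) = ennreal (sqnorm M (\<lambda>x. s (r i) x - s n x))"
        using sq_int_diff[OF ss ss, of "r i" n] unfolding sqnorm_def sq_int_def
        by (subst nn_integral_eq_integral) auto
      also have "\<dots> = ennreal (sum b {n..<r i})" by (simp add: sd[OF ni])
      also have "sum b {n..<r i} = (\<Sum>k<r i - n. b (k + n))"
        using ni sum.shift_bounds_nat_ivl[of b 0 n "r i - n"] by (simp add: lessThan_atLeast0)
      also have "ennreal \<dots> \<le> ennreal (\<Sum>k. b (k + n))"
        by (intro ennreal_leI sum_le_suminf) (use sb b0 in \<open>auto simp: summable_iff_shift\<close>)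
      finally show "(\<integral>\<^sup>+x. ennreal ((cmod (s (r i) x - s n x))\<^sup>2) \<partial>M) \<le> ennreal (\<Sum>k. b (k + n))" .
    qed
    finally show ?thesis .
  qed
  have gs: "sq_int M (\<lambda>x. g x - s n x)" for n
    unfolding sq_int_def
    using fatou[of n] by (auto simp: integrable_iff_bounded intro: le_less_trans)
  have g: "sq_int M g"
    using sq_int_add[OF gs[of 0] ss[of 0]] by simp
  have "sqnorm M (\<lambda>x. g x - s n x) \<le> (\<Sum>k. b (k + n))" for n
  proof -
    have "ennreal (sqnorm M (\<lambda>x. g x - s n x)) \<le> ennreal (\<Sum>k. b (k + n))"
      using fatou[of n] gs[of n] unfolding sqnorm_def sq_int_def
      by (subst nn_integral_eq_integral[symmetric]) auto
    then show ?thesis using b0 sb by (subst (asm) ennreal_le_iff) (auto intro!: suminf_nonneg simp: summable_iff_shift)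
  qed
  moreover have "(\<lambda>n. \<Sum>k. b (k + n)) \<longlonglongrightarrow> 0"
    by (rule suminf_exist_split2[OF sb])
  ultimately have "(\<lambda>n. sqnorm M (\<lambda>x. g x - s n x)) \<longlonglongrightarrow> 0"
    by (intro Lim_null_comparison[of "\<lambda>n. sqnorm M (\<lambda>x. g x - s n x)" "\<lambda>n. \<Sum>k. b (k + n)"]) auto
  then show thesis using g that unfolding s_def by blast
qed

lemma tendsto_ip_left:
  assumes "\<And>n. sq_int M (s n)" "sq_int M g" "sq_int M h" "(\<lambda>n. sqnorm M (\<lambda>x. g x - s n x)) \<longlonglongrightarrow> 0"
  shows "(\<lambda>n. ip M (s n) h) \<longlonglongrightarrow> ip M g h"
proof -
  have "cmod (ip M g h - ip M (s n) h) \<le> sqrt (sqnorm M (\<lambda>x. g x - s n x) * sqnorm M h)" for n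
    using Cauchy_Schwarz[OF sq_int_diff[OF assms(2) assms(1)[of n]] assms(3)] assms
    by (intro real_le_rsqrt) (simp add: ip_diff_left)
  moreover have "(\<lambda>n. sqrt (sqnorm M (\<lambda>x. g x - s n x) * sqnorm M h)) \<longlonglongrightarrow> sqrt (0 * sqnorm M h)"
    by (intro tendsto_intros assms)
  ultimately have "(\<lambda>n. ip M g h - ip M (s n) h) \<longlonglongrightarrow> 0"
    by (intro Lim_null_comparison[of "\<lambda>n. ip M g h - ip M (s n) h" "\<lambda>n. sqrt (sqnorm M (\<lambda>x. g x - s n x) * sqnorm M h)"]) auto
  from tendsto_diff[OF tendsto_const this, of "ip M g h"] show ?thesis by simp
qed

section \<open>Pointwise diagonalization of a non-negative kernel\<close>

text \<open>A kernel given pointwise, off a null set, by an expansion of trace class. The functions \<open>u n\<close>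
  need not be orthogonal: restricting the spectral expansion of \<open>K\<close> to a subset destroys
  orthogonality but stays within this setting.\<close>

locale kernel_expansion =
  fixes M :: "'a measure" and G :: "'a \<Rightarrow> 'a \<Rightarrow> complex" and a :: "nat \<Rightarrow> real"
    and u :: "nat \<Rightarrow> 'a \<Rightarrow> complex" and N :: "'a set"
  assumes a_nonneg: "0 \<le> a n" and a_summable: "summable a"
    and u_sq_int: "sq_int M (u n)" and u_le: "sqnorm M (u n) \<le> 1"
    and N: "N \<in> null_sets M"
    and G_meas: "x \<in> space M \<Longrightarrow> G x \<in> borel_measurable M"
    and G_sums: "x \<in> space M - N \<Longrightarrow> y \<in> space M - N \<Longrightarrow>
      (\<lambda>n. complex_of_real (a n) * u n x * cnj (u n y)) sums G x y"
begin

definition op :: "('a \<Rightarrow> complex) \<Rightarrow> 'a \<Rightarrow> complex" where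
  "op f x = (\<integral>y. G x y * f y \<partial>M)"

lemma AE_N: "AE x in M. x \<in> space M - N"
  using AE_not_in[OF N] AE_space by eventually_elim auto

lemma diag_sums:
  assumes "x \<in> space M - N"
  shows "(\<lambda>n. a n * (cmod (u n x))\<^sup>2) sums Re (G x x)"
proof -
  have "(\<lambda>n. Re (complex_of_real (a n) * u n x * cnj (u n x))) sums Re (G x x)"
    by (rule sums_Re[OF G_sums[OF assms assms]])
  moreover have "Re (complex_of_real (a n) * u n x * cnj (u n x)) = a n * (cmod (u n x))\<^sup>2" for n
    by (simp add: mult.assoc complex_norm_square[symmetric] del: of_real_power)
  ultimately show ?thesis by simp
qed

lemma norm_ip_le: "sq_int M f \<Longrightarrow> (\<integral>x. cmod (u n x) * cmod (f x) \<partial>M) \<le> 1 + sqnorm M f"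
proof -
  assume f: "sq_int M f"
  have "(\<integral>x. cmod (u n x) * cmod (f x) \<partial>M) \<le> (\<integral>x. (cmod (u n x))\<^sup>2 + (cmod (f x))\<^sup>2 \<partial>M)"
  proof (rule integral_mono)
    show "integrable M (\<lambda>x. cmod (u n x) * cmod (f x))"
      by (rule sq_int_integrable_norm_mult[OF u_sq_int f])
    show "integrable M (\<lambda>x. (cmod (u n x))\<^sup>2 + (cmod (f x))\<^sup>2)"
      using u_sq_int[of n] f by (simp add: sq_int_def)
    show "cmod (u n x) * cmod (f x) \<le> (cmod (u n x))\<^sup>2 + (cmod (f x))\<^sup>2" for x
      using sum_squares_bound[of "cmod (u n x)" "cmod (f x)"] mult_nonneg_nonneg[of "cmod (u n x)" "cmod (f x)"]
        norm_ge_zero[of "u n x"] norm_ge_zero[of "f x"] by linarith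
  qed
  also have "\<dots> = sqnorm M (u n) + sqnorm M f"
    using u_sq_int[of n] f by (simp add: sq_int_def sqnorm_def)
  finally show ?thesis using u_le[of n] by simp
qed

lemma summable_norm_u:
  assumes "x \<in> space M - N"
  shows "summable (\<lambda>n. a n * cmod (u n x))"
proof (rule summable_comparison_test')
  show "summable (\<lambda>n. a n + a n * (cmod (u n x))\<^sup>2)"
    using diag_sums[OF assms] a_summable by (intro summable_add) (auto simp: sums_iff)
  fix n
  have "cmod (u n x) \<le> 1 + (cmod (u n x))\<^sup>2"
    using sum_squares_bound[of 1 "cmod (u n x)"] norm_ge_zero[of "u n x"]
    by (simp only: one_power2 mult_1_right)
  from mult_left_mono[OF this a_nonneg[of n]]
  show "norm (a n * cmod (u n x)) \<le> a n + a n * (cmod (u n x))\<^sup>2"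
    using a_nonneg[of n] by (simp add: distrib_left)
qed

text \<open>The exchange of series and integral behind both of the next lemmas: for the operator at a point \<open>x\<close>
  the coefficients are \<open>a n * u n x\<close>, for its quadratic form they are \<open>a n * cnj (ip M f (u n))\<close>.\<close>

lemma coefficient_sums:
  assumes f: "sq_int M f" and b: "summable (\<lambda>n. cmod (b n))"
    and ae: "AE y in M. summable (\<lambda>n. cmod (b n) * cmod (u n y))"
  shows "(\<lambda>n. b n * ip M f (u n)) sums (\<integral>y. (\<Sum>n. b n * cnj (u n y)) * f y \<partial>M)"
proof -
  let ?F = "\<lambda>n y. b n * (f y * cnj (u n y))"
  have int: "integrable M (?F n)" for n
    using sq_int_integrable_mult[OF f u_sq_int[of n]] by simp
  have ae': "AE y in M. summable (\<lambda>n. norm (?F n y))"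
    using ae
  proof eventually_elim
    case (elim y)
    from summable_mult[OF this, of "cmod (f y)"] show ?case by (simp add: norm_mult mult_ac)
  qed
  have "summable (\<lambda>n. \<integral>y. norm (?F n y) \<partial>M)"
  proof (rule summable_comparison_test')
    show "summable (\<lambda>n. cmod (b n) * (1 + sqnorm M f))" by (intro summable_mult2 b)
    fix n
    have "(\<integral>y. norm (?F n y) \<partial>M) = cmod (b n) * (\<integral>y. cmod (u n y) * cmod (f y) \<partial>M)"
      by (simp add: norm_mult mult.commute)
    also have "\<dots> \<le> cmod (b n) * (1 + sqnorm M f)"
      using norm_ip_le[OF f] by (intro mult_left_mono) auto
    finally show "norm (\<integral>y. norm (?F n y) \<partial>M) \<le> cmod (b n) * (1 + sqnorm M f)" by simp
  qed
  from sums_integral[OF int ae' this] have "(\<lambda>n. b n * ip M f (u n)) sums (\<integral>y. (\<Sum>n. ?F n y) \<partial>M)"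
    by (simp add: ip_def)
  moreover have "(\<integral>y. (\<Sum>n. ?F n y) \<partial>M) = (\<integral>y. (\<Sum>n. b n * cnj (u n y)) * f y \<partial>M)"
  proof (rule integral_cong_AE)
    note [measurable] = sq_int_measurable[OF f] sq_int_measurable[OF u_sq_int]
    have [measurable]: "cnj \<in> borel_measurable borel"
      by (intro borel_measurable_continuous_onI continuous_intros)
    show "(\<lambda>y. \<Sum>n. ?F n y) \<in> borel_measurable M" "(\<lambda>y. (\<Sum>n. b n * cnj (u n y)) * f y) \<in> borel_measurable M"
      by measurable
    show "AE y in M. (\<Sum>n. ?F n y) = (\<Sum>n. b n * cnj (u n y)) * f y"
      using ae
    proof eventually_elim
      case (elim y)
      then have "summable (\<lambda>n. b n * cnj (u n y))" 
        by (simp add: norm_mult summable_norm_cancel[of "\<lambda>n. b n * cnj (u n y)"])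
      from suminf_mult2[OF this, of "f y"] show ?case by (simp add: mult_ac)
    qed
  qed
  ultimately show ?thesis by simp
qed

text \<open>By \<open>|st| \<le> s\<^sup>2 + t\<^sup>2\<close> the absolute series at a pair of points is dominated by the two diagonal
  series, both of which converge off the null set.\<close>

lemma op_sums:
  assumes x: "x \<in> space M - N" and f: "sq_int M f"
  shows "(\<lambda>n. complex_of_real (a n) * u n x * ip M f (u n)) sums op f x"
proof -
  have 1: "summable (\<lambda>n. cmod (complex_of_real (a n) * u n x))"
    using summable_norm_u[OF x] a_nonneg by (simp add: norm_mult)
  have 2: "AE y in M. summable (\<lambda>n. cmod (complex_of_real (a n) * u n x) * cmod (u n y))"
    using AE_N
  proof eventually_elim
    case (elim y)
    have s: "summable (\<lambda>n. a n * (cmod (u n x))\<^sup>2 + a n * (cmod (u n y))\<^sup>2)"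
      using diag_sums[OF x] diag_sums[OF elim] by (intro summable_add) (auto simp: sums_iff)
    show ?case
    proof (rule summable_comparison_test'[OF s])
      fix n
      have "cmod (u n x) * cmod (u n y) \<le> (cmod (u n x))\<^sup>2 + (cmod (u n y))\<^sup>2"
        using sum_squares_bound[of "cmod (u n x)" "cmod (u n y)"] mult_nonneg_nonneg[of "cmod (u n x)" "cmod (u n y)"]
          norm_ge_zero[of "u n x"] norm_ge_zero[of "u n y"] by linarith
      from mult_left_mono[OF this a_nonneg[of n]]
      show "norm (cmod (complex_of_real (a n) * u n x) * cmod (u n y)) \<le> a n * (cmod (u n x))\<^sup>2 + a n * (cmod (u n y))\<^sup>2"
        using a_nonneg[of n] by (simp add: norm_mult algebra_simps)
    qed
  qed
  have "op f x = (\<integral>y. (\<Sum>n. complex_of_real (a n) * u n x * cnj (u n y)) * f y \<partial>M)"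
    unfolding op_def
  proof (rule integral_cong_AE)
    note [measurable] = sq_int_measurable[OF f] sq_int_measurable[OF u_sq_int]
    have [measurable]: "G x \<in> borel_measurable M" "cnj \<in> borel_measurable borel"
      using x G_meas by (auto intro: borel_measurable_continuous_onI continuous_intros)
    show "(\<lambda>y. G x y * f y) \<in> borel_measurable M"
      "(\<lambda>y. (\<Sum>n. complex_of_real (a n) * u n x * cnj (u n y)) * f y) \<in> borel_measurable M"
      by measurable
    show "AE y in M. G x y * f y = (\<Sum>n. complex_of_real (a n) * u n x * cnj (u n y)) * f y"
      using AE_N by eventually_elim (use G_sums[OF x] in \<open>simp add: sums_iff\<close>)
  qed
  then show ?thesis using coefficient_sums[OF f 1 2] by simp
qed

text \<open>The quadratic form of the operator. Nothing ensures that \<open>op f\<close> itself is measurable, so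
  a measurable version \<open>h\<close> takes its place.\<close>

lemma form_sums:
  assumes f: "sq_int M f" and g: "sq_int M g"
    and h: "h \<in> borel_measurable M" "AE x in M. op f x = h x"
  shows "(\<lambda>n. complex_of_real (a n) * ip M f (u n) * ip M (u n) g) sums ip M h g"
proof -
  define b where "b n = complex_of_real (a n) * cnj (ip M f (u n))" for n
  have b: "cmod (b n) \<le> a n * (1 + sqnorm M f)" for n
  proof -
    have "cmod (ip M f (u n)) \<le> (\<integral>x. norm (f x * cnj (u n x)) \<partial>M)"
      unfolding ip_def by (rule integral_norm_bound)
    also have "\<dots> = (\<integral>x. cmod (u n x) * cmod (f x) \<partial>M)" by (simp add: norm_mult mult.commute)
    finally show ?thesis
      using norm_ip_le[OF f, of n] a_nonneg[of n] by (simp add: b_def norm_mult mult_left_mono)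
  qed
  have 1: "summable (\<lambda>n. cmod (b n))"
    by (rule summable_comparison_test'[OF summable_mult2[OF a_summable, of "1 + sqnorm M f"]]) (use b in simp)
  have 2: "AE x in M. summable (\<lambda>n. cmod (b n) * cmod (u n x))"
    using AE_N
  proof eventually_elim
    case (elim x)
    show ?case
      by (rule summable_comparison_test'[OF summable_mult2[OF summable_norm_u[OF elim], of "1 + sqnorm M f"]])
         (use mult_right_mono[OF b norm_ge_zero, of _ "u _ x"] in \<open>simp add: mult_ac\<close>)
  qed
  have "(\<integral>x. (\<Sum>n. b n * cnj (u n x)) * g x \<partial>M) = (\<integral>x. g x * cnj (h x) \<partial>M)"
  proof (rule integral_cong_AE)
    note [measurable] = h(1) sq_int_measurable[OF g] sq_int_measurable[OF u_sq_int]
    have [measurable]: "cnj \<in> borel_measurable borel"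
      by (intro borel_measurable_continuous_onI continuous_intros)
    show "(\<lambda>x. (\<Sum>n. b n * cnj (u n x)) * g x) \<in> borel_measurable M" "(\<lambda>x. g x * cnj (h x)) \<in> borel_measurable M"
      by measurable
    show "AE x in M. (\<Sum>n. b n * cnj (u n x)) * g x = g x * cnj (h x)"
      using AE_N h(2)
    proof eventually_elim
      case (elim x)
      have "(\<lambda>n. b n * cnj (u n x)) sums cnj (h x)"
        using op_sums[OF elim(1) f, THEN sums_cnj[THEN iffD2]] elim(2) by (simp add: b_def mult_ac)
      then show ?case by (simp add: sums_iff)
    qed
  qed
  then have "(\<lambda>n. b n * ip M g (u n)) sums ip M g h"
    using coefficient_sums[OF g 1 2] by (simp add: ip_def)
  then have "(\<lambda>n. cnj (b n * ip M g (u n))) sums cnj (ip M g h)" by (simp only: sums_cnj)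
  then show ?thesis by (simp add: b_def ip_cnj)
qed

lemma diag_nn_integral:
  "(\<integral>\<^sup>+x. ennreal (Re (G x x)) \<partial>M) = (\<Sum>n. ennreal (a n * sqnorm M (u n)))"
proof -
  have "(\<integral>\<^sup>+x. ennreal (Re (G x x)) \<partial>M) = (\<integral>\<^sup>+x. (\<Sum>n. ennreal (a n * (cmod (u n x))\<^sup>2)) \<partial>M)"
    by (rule nn_integral_cong_AE, use AE_N in eventually_elim)
       (use a_nonneg diag_sums in \<open>auto simp: sums_iff suminf_ennreal2\<close>)
  then show ?thesis unfolding nn_integral_weighted_squares[OF a_nonneg u_sq_int] .
qed

lemma summable_trace: "summable (\<lambda>n. a n * sqnorm M (u n))"
  by (rule summable_comparison_test'[OF a_summable])
     (use a_nonneg u_le in \<open>auto simp: mult_left_le\<close>)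


lemma suminf_ennreal_swap: "(\<Sum>i. \<Sum>j. f i j :: ennreal) = (\<Sum>j. \<Sum>i. f i j)"
  using nn_integral_suminf[of "\<lambda>j i. f i j" "count_space UNIV"]
  by (simp add: nn_integral_count_space_nat)

text \<open>A version of Mercer's theorem without continuity. If \<open>e\<close> is an orthonormal system of
  eigenfunctions and the operator vanishes on its orthogonal complement, then the kernel equals its
  eigenfunction expansion off a null set \<^emph>\<open>of points\<close>. Equality for almost every pair would not be
  enough for determinants, which involve the diagonal.

  Two facts are combined. The kernel is a Gram matrix, of the vectors
  \<open>z x = (sqrt (a n) * u n x)\<^sub>n\<close> in \<open>\<ell>\<^sup>2\<close>, and the eigenfunctions with positive eigenvalue have
  orthogonal images there, normalized to \<open>v k\<close>; so Bessel's inequality bounds the eigenfunction expansion on the diagonal by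
  \<open>G x x\<close>. On the other hand both diagonals have the same integral, the trace: each \<open>u n\<close> with
  \<open>a n > 0\<close> lies in the closed span of \<open>e\<close>, because its component orthogonal to \<open>e\<close> is annihilated by the
  operator. Hence the diagonals agree almost everywhere, and the Cauchy-Schwarz inequality for the
  remainders extends this to all pairs of good points.\<close>

theorem eigen_expansion:
  fixes e :: "nat \<Rightarrow> 'a \<Rightarrow> complex" and c :: "nat \<Rightarrow> real"
  assumes on: "orthonormal M I e"
    and eig: "\<And>k. k \<in> I \<Longrightarrow> AE x in M. op (e k) x = complex_of_real (c k) * e k x"
    and compl: "\<And>f. sq_int M f \<Longrightarrow> (\<And>k. k \<in> I \<Longrightarrow> ip M f (e k) = 0) \<Longrightarrow> AE x in M. op f x = 0"
  shows "\<And>k. k \<in> I \<Longrightarrow> 0 \<le> c k"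
    and "summable (\<lambda>k. if k \<in> I then c k else 0)"
    and "\<exists>N'\<in>null_sets M. \<forall>x\<in>space M - N'. \<forall>y\<in>space M - N'.
      (\<lambda>k. if k \<in> I then complex_of_real (c k) * e k x * cnj (e k y) else 0) sums G x y"
proof -
  have es: "sq_int M (e k)" if "k \<in> I" for k
    using on that by (simp add: orthonormal_def)
  have form: "(\<lambda>n. complex_of_real (a n) * ip M (e k) (u n) * ip M (u n) (e l)) sums (if k = l then complex_of_real (c k) else 0)"
    if "k \<in> I" "l \<in> I" for k l
  proof -
    have "(\<lambda>x. complex_of_real (c k) * e k x) \<in> borel_measurable M"
      by (rule sq_int_measurable[OF sq_int_scale[OF es[OF that(1)]]])
    have "ip M (\<lambda>x. complex_of_real (c k) * e k x) (e l) = (if k = l then complex_of_real (c k) else 0)"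
    proof -
      have "ip M (e k) (e l) = (if k = l then 1 else 0)"
        using on that unfolding orthonormal_def by blast
      then show ?thesis by (simp add: ip_scale_left)
    qed
    with form_sums[OF es[OF that(1)] es[OF that(2)] \<open>_ \<in> borel_measurable M\<close> eig[OF that(1)]]
    show ?thesis by simp
  qed
  have ip2: "complex_of_real (a n) * ip M f (u n) * ip M (u n) f = complex_of_real (a n * (cmod (ip M f (u n)))\<^sup>2)" for f n
    unfolding of_real_mult complex_norm_square ip_cnj by (simp add: mult.assoc)
  have csum: "(\<lambda>n. a n * (cmod (ip M (e k) (u n)))\<^sup>2) sums c k" if "k \<in> I" for k
    using form[OF that that] unfolding ip2 by (simp only: simp_thms if_True sums_of_real_iff)
  show c0: "0 \<le> c k" if "k \<in> I" for k
    unfolding sums_unique[OF csum[OF that]]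
    by (rule suminf_nonneg[OF sums_summable[OF csum[OF that]]]) (simp add: a_nonneg)

  \<comment> \<open>If \<open>h\<close> is the component of \<open>u j\<close> orthogonal to all eigenfunctions, the form vanishes at \<open>h\<close>,
    so \<open>h\<close> is orthogonal to every \<open>u n\<close> with positive weight, in particular to \<open>u j\<close>.\<close>
  have parseval: "(\<lambda>k. if k \<in> I then (cmod (ip M (e k) (u j)))\<^sup>2 else 0) sums sqnorm M (u j)" if "a j > 0" for j
  proof -
    define b where "b k = ip M (u j) (e k)" for k
    have part: "(\<Sum>k<n. if k \<in> I then (cmod (b k))\<^sup>2 else 0) = (\<Sum>k\<in>I \<inter> {..<n}. (cmod (b k))\<^sup>2)" for n
      unfolding Int_commute[of I] by (rule sum.inter_restrict[symmetric]) simp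
    have "summable (\<lambda>k. if k \<in> I then (cmod (b k))\<^sup>2 else 0)"
    proof (rule summableI_nonneg_bounded)
      show "(\<Sum>k<n. if k \<in> I then (cmod (b k))\<^sup>2 else 0) \<le> sqnorm M (u j)" for n
        unfolding part unfolding b_def by (rule Bessel[OF on _ _ u_sq_int]) auto
    qed auto
    from Riesz_Fischer[OF on this] obtain g where g: "sq_int M g"
      "(\<lambda>n. sqnorm M (\<lambda>x. g x - (\<Sum>k\<in>I \<inter> {..<n}. b k * e k x))) \<longlonglongrightarrow> 0" .
    have ss: "sq_int M (\<lambda>x. \<Sum>k\<in>I \<inter> {..<n}. b k * e k x)" for n
      by (intro sq_int_sum sq_int_scale es) auto
    have lim: "(\<lambda>n. \<Sum>k\<in>I \<inter> {..<n}. b k * ip M (e k) h) \<longlonglongrightarrow> ip M g h" if "sq_int M h" for h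
    proof -
      have *: "ip M (\<lambda>x. \<Sum>k\<in>I \<inter> {..<n}. b k * e k x) h = (\<Sum>k\<in>I \<inter> {..<n}. b k * ip M (e k) h)" for n
        using es that by (subst ip_sum_left) (auto intro: sq_int_scale simp: ip_scale_left)
      show ?thesis using tendsto_ip_left[OF ss g(1) that g(2)] unfolding * .
    qed
    have ge: "ip M g (e l) = b l" if "l \<in> I" for l
    proof -
      have "eventually (\<lambda>n. (\<Sum>k\<in>I \<inter> {..<n}. b k * ip M (e k) (e l)) = b l) sequentially"
      proof (rule eventually_sequentiallyI)
        fix n assume "Suc l \<le> n"
        have "(\<Sum>k\<in>I \<inter> {..<n}. b k * ip M (e k) (e l)) = (\<Sum>k\<in>I \<inter> {..<n}. if k = l then b l else 0)"
          by (rule sum.cong) (use on that in \<open>auto simp: orthonormal_def\<close>)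
        also have "\<dots> = b l" using \<open>Suc l \<le> n\<close> that by simp
        finally show "(\<Sum>k\<in>I \<inter> {..<n}. b k * ip M (e k) (e l)) = b l" .
      qed
      from LIMSEQ_unique[OF lim[OF es[OF that]] tendsto_eventually[OF this]] show ?thesis .
    qed
    define h where "h x = u j x - g x" for x
    have hs: "sq_int M h" unfolding h_def by (intro sq_int_diff u_sq_int g)
    have "ip M h (e l) = 0" if "l \<in> I" for l
      unfolding h_def using ge[OF that] es[OF that] u_sq_int g by (subst ip_diff_left) (auto simp: b_def)
    from compl[OF hs this] have "AE x in M. op h x = 0" .
    from form_sums[OF hs hs borel_measurable_const this]
    have "(\<lambda>n. complex_of_real (a n * (cmod (ip M h (u n)))\<^sup>2)) sums complex_of_real 0"
      unfolding ip2 ip_zero_left of_real_0 .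
    then have "(\<lambda>n. a n * (cmod (ip M h (u n)))\<^sup>2) sums 0"
      unfolding sums_of_real_iff .
    then have "\<forall>n. a n * (cmod (ip M h (u n)))\<^sup>2 = 0"
      using suminf_eq_zero_iff[of "\<lambda>n. a n * (cmod (ip M h (u n)))\<^sup>2"] a_nonneg
      by (simp add: sums_iff)
    then have "ip M h (u j) = 0" using that by (metis less_irrefl mult_eq_0_iff norm_eq_zero zero_eq_power2)
    then have gu: "ip M g (u j) = of_real (sqnorm M (u j))"
      unfolding h_def by (subst (asm) ip_diff_left) (use u_sq_int g in \<open>auto simp: ip_self\<close>)
    have "(\<lambda>n. complex_of_real (\<Sum>k<n. if k \<in> I then (cmod (b k))\<^sup>2 else 0)) \<longlonglongrightarrow> of_real (sqnorm M (u j))"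
    proof -
      have "b k * ip M (e k) (u j) = of_real ((cmod (b k))\<^sup>2)" for k
        unfolding b_def complex_norm_square ip_cnj ..
      then show ?thesis using lim[OF u_sq_int[of j]] unfolding part gu by simp
    qed
    then have "(\<lambda>k. if k \<in> I then (cmod (b k))\<^sup>2 else 0) sums sqnorm M (u j)"
      unfolding sums_def tendsto_of_real_iff .
    moreover have "cmod (b k) = cmod (ip M (e k) (u j))" for k
      unfolding b_def ip_cnj[of M "e k", symmetric] by simp
    ultimately show ?thesis by (simp cong: if_cong)
  qed

  \<comment> \<open>Both sums are the double sum of \<open>a n * (cmod (ip M (e k) (u n)))\<^sup>2\<close>.\<close>
  have trace: "(\<Sum>k. ennreal (if k \<in> I then c k else 0)) = (\<Sum>n. ennreal (a n * sqnorm M (u n)))"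
  proof -
    have "(\<Sum>k. ennreal (if k \<in> I then c k else 0)) = (\<Sum>k. \<Sum>n. ennreal (if k \<in> I then a n * (cmod (ip M (e k) (u n)))\<^sup>2 else 0))"
      using csum a_nonneg c0 by (intro suminf_cong) (auto simp: sums_iff suminf_ennreal2)
    also have "\<dots> = (\<Sum>n. \<Sum>k. ennreal (if k \<in> I then a n * (cmod (ip M (e k) (u n)))\<^sup>2 else 0))"
      by (rule suminf_ennreal_swap)
    also have "\<dots> = (\<Sum>n. ennreal (a n * sqnorm M (u n)))"
    proof (rule suminf_cong)
      fix n
      show "(\<Sum>k. ennreal (if k \<in> I then a n * (cmod (ip M (e k) (u n)))\<^sup>2 else 0)) = ennreal (a n * sqnorm M (u n))"
      proof (cases "a n > 0")
        case True
        have "(\<lambda>k. if k \<in> I then a n * (cmod (ip M (e k) (u n)))\<^sup>2 else 0) sums (a n * sqnorm M (u n))"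
          using sums_mult[OF parseval[OF True], of "a n"] by (simp add: if_distrib cong: if_cong)
        then show ?thesis using True by (subst suminf_ennreal2) (auto simp: sums_iff)
      next
        case False
        then have "a n = 0" using a_nonneg[of n] by simp
        then show ?thesis by (simp add: if_distrib cong: if_cong)
      qed
    qed
    finally show ?thesis .
  qed
  have tfin: "(\<Sum>n. ennreal (a n * sqnorm M (u n))) < \<infinity>"
    using a_nonneg summable_trace by (subst suminf_ennreal2) auto
  show c_summable: "summable (\<lambda>k. if k \<in> I then c k else 0)"
    using trace tfin c0 by (intro summable_suminf_not_top) auto

  \<comment> \<open>Eigenfunctions with eigenvalue 0 have image 0 in \<open>\<ell>\<^sup>2\<close> and are left out in \<open>I'\<close>.\<close>
  define L where "L = count_space (UNIV :: nat set)"
  define z where "z x n = complex_of_real (sqrt (a n)) * u n x" for x n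
  define I' where "I' = {k \<in> I. c k > 0}"
  define v where "v k n = complex_of_real (sqrt (a n)) / complex_of_real (sqrt (c k)) * ip M (u n) (e k)" for k n
  have sqa: "complex_of_real (sqrt (a n)) * complex_of_real (sqrt (a n)) = complex_of_real (a n)" for n
    unfolding of_real_mult[symmetric] using a_nonneg[of n] by simp
  have zs: "sq_int L (z x)" if "x \<in> space M - N" for x
  proof -
    have "(cmod (z x n))\<^sup>2 = a n * (cmod (u n x))\<^sup>2" for n
      using a_nonneg[of n] by (simp add: z_def norm_mult power_mult_distrib)
    then show ?thesis
      using diag_sums[OF that] a_nonneg unfolding sq_int_def L_def integrable_count_space_nat_iff
      by (auto simp: sums_iff)
  qed
  have Lsum: "ip L f g = s" if "sq_int L f" "sq_int L g" "(\<lambda>n. f n * cnj (g n)) sums s" for f g s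
    using sums_integral_count_space_nat[OF sq_int_integrable_mult[OF that(1,2), unfolded L_def]] that(3)
    unfolding ip_def L_def by (rule sums_unique2)
  have zz: "ip L (z x) (z y) = G x y" if "x \<in> space M - N" "y \<in> space M - N" for x y
  proof (rule Lsum[OF zs[OF that(1)] zs[OF that(2)]])
    have "z x n * cnj (z y n) = complex_of_real (a n) * u n x * cnj (u n y)" for n
      unfolding z_def sqa[symmetric] by simp
    then show "(\<lambda>n. z x n * cnj (z y n)) sums G x y" using G_sums[OF that] by simp
  qed
  have vv: "(\<lambda>n. v k n * cnj (v l n)) sums (if k = l then 1 else 0)" if "k \<in> I'" "l \<in> I'" for k l
  proof -
    have kl: "k \<in> I" "l \<in> I" "c k > 0" "c l > 0" using that by (auto simp: I'_def)
    have "v k n * cnj (v l n) = complex_of_real (a n) * ip M (e l) (u n) * ip M (u n) (e k) / (complex_of_real (sqrt (c k)) * complex_of_real (sqrt (c l)))" for n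
      unfolding v_def sqa[symmetric] by (simp add: ip_cnj mult_ac)
    moreover have "(if l = k then complex_of_real (c l) else 0) / (complex_of_real (sqrt (c k)) * complex_of_real (sqrt (c l))) = (if k = l then 1 else 0)"
      using kl by (auto simp flip: of_real_mult)
    ultimately show ?thesis
      using sums_divide[OF form[OF kl(2,1)], of "complex_of_real (sqrt (c k)) * complex_of_real (sqrt (c l))"] by simp
  qed
  have vs: "sq_int L (v k)" if "k \<in> I'" for k
  proof -
    have "(\<lambda>n. Re (v k n * cnj (v k n))) sums Re 1"
      using sums_Re[OF vv[OF that that]] by simp
    moreover have "Re (v k n * cnj (v k n)) = (cmod (v k n))\<^sup>2" for n
      unfolding complex_norm_square[symmetric] by simp
    ultimately show ?thesis unfolding sq_int_def L_def integrable_count_space_nat_iff by (auto simp: sums_iff)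
  qed
  have von: "orthonormal L I' v"
    unfolding orthonormal_def using vs Lsum[OF vs vs vv] by auto
  have zv: "ip L (z x) (v k) = complex_of_real (sqrt (c k)) * e k x"
    if x: "x \<in> space M - N" and k: "k \<in> I'" and eq: "op (e k) x = complex_of_real (c k) * e k x" for x k
  proof (rule Lsum[OF zs[OF x] vs[OF k]])
    have kI: "k \<in> I" "c k > 0" using k by (auto simp: I'_def)
    have "z x n * cnj (v k n) = complex_of_real (a n) * u n x * ip M (e k) (u n) / complex_of_real (sqrt (c k))" for n
      unfolding v_def z_def sqa[symmetric] by (simp add: ip_cnj mult_ac)
    moreover have "op (e k) x / complex_of_real (sqrt (c k)) = complex_of_real (sqrt (c k)) * e k x"
      using kI unfolding eq by (simp add: field_simps flip: of_real_mult)
    ultimately show "(\<lambda>n. z x n * cnj (v k n)) sums (complex_of_real (sqrt (c k)) * e k x)"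
      using sums_divide[OF op_sums[OF x es[OF kI(1)]], of "complex_of_real (sqrt (c k))"] by simp
  qed
  have "AE x in M. \<forall>k\<in>I. op (e k) x = complex_of_real (c k) * e k x"
    using eig by (intro AE_ball_countable[THEN iffD2]) auto
  with AE_N have "AE x in M. x \<in> space M - N \<and> (\<forall>k\<in>I. op (e k) x = complex_of_real (c k) * e k x)"
    by eventually_elim auto
  then obtain N1 where N1: "N1 \<in> null_sets M"
    "\<And>x. x \<in> space M - N1 \<Longrightarrow> x \<in> space M - N"
    "\<And>x k. x \<in> space M - N1 \<Longrightarrow> k \<in> I \<Longrightarrow> op (e k) x = complex_of_real (c k) * e k x"
    unfolding eventually_ae_filter by auto
  define rest where "rest n x = (\<lambda>m. z x m - (\<Sum>k\<in>I' \<inter> {..<n}. ip L (z x) (v k) * v k m))" for n x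
  have rests: "sq_int L (rest n x)" if "x \<in> space M - N1" for n x
    unfolding rest_def using N1(2)[OF that] by (intro sq_int_diff sq_int_sum sq_int_scale zs vs) auto
  define E where "E x y k = (if k \<in> I then complex_of_real (c k) * e k x * cnj (e k y) else 0)" for x y k
  have part: "(\<Sum>k<n. E x y k)
       = (\<Sum>k\<in>I' \<inter> {..<n}. complex_of_real (c k) * e k x * cnj (e k y))" for n x y
  proof -
    have "(\<Sum>k\<in>I' \<inter> {..<n}. complex_of_real (c k) * e k x * cnj (e k y)) =
      (\<Sum>k<n. if k \<in> I' then complex_of_real (c k) * e k x * cnj (e k y) else 0)"
      unfolding Int_commute[of I'] by (rule sum.inter_restrict) simp
    also have "\<dots> = (\<Sum>k<n. E x y k)"
      using c0 by (intro sum.cong) (auto simp: I'_def E_def less_le)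
    finally show ?thesis ..
  qed
  have rr: "ip L (rest n x) (rest n y) = G x y - (\<Sum>k<n. E x y k)"
    if "x \<in> space M - N1" "y \<in> space M - N1" for n x y
  proof -
    have "ip L (z x) (v k) * ip L (v k) (z y) = complex_of_real (c k) * e k x * cnj (e k y)" if k: "k \<in> I'" for k
    proof -
      have kI: "k \<in> I" using k by (simp add: I'_def)
      have "ip L (v k) (z y) = cnj (complex_of_real (sqrt (c k)) * e k y)"
        unfolding ip_cnj[of L "z y", symmetric] using N1 kI \<open>y \<in> _\<close> by (subst zv[OF _ k]) auto
      moreover have "ip L (z x) (v k) = complex_of_real (sqrt (c k)) * e k x"
        using N1 kI \<open>x \<in> _\<close> by (intro zv[OF _ k]) auto
      moreover have "complex_of_real (sqrt (c k)) * complex_of_real (sqrt (c k)) = complex_of_real (c k)"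
        unfolding of_real_mult[symmetric] using c0[OF kI] by simp
      ultimately show ?thesis by (metis (no_types, lifting) complex_cnj_complex_of_real complex_cnj_mult mult.assoc mult.left_commute)
    qed
    then show ?thesis
      unfolding part rest_def using N1 that
      by (subst ip_projection_remainders[OF von]) (auto simp: zz intro!: zs)
  qed
  \<comment> \<open>The two diagonals are \<open>suminf (p x)\<close> and \<open>d x\<close>.\<close>
  define p where "p x k = (if k \<in> I then c k * (cmod (e k x))\<^sup>2 else 0)" for x k
  have p0: "0 \<le> p x k" for x k using c0 by (simp add: p_def)
  have pp: "(\<Sum>k<n. E x x k) = of_real (\<Sum>k<n. p x k)" for x n
    unfolding of_real_sum p_def E_def
    by (rule sum.cong) (auto simp: mult.assoc complex_norm_square[symmetric] simp del: of_real_power)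
  have rest_diag: "sqnorm L (rest n x) = Re (G x x) - (\<Sum>k<n. p x k)" if "x \<in> space M - N1" for n x
    using arg_cong[OF rr[OF that that, of n], of Re] unfolding ip_self pp by simp
  have ps: "summable (p x)" and ple: "suminf (p x) \<le> Re (G x x)" if "x \<in> space M - N1" for x
  proof -
    have le: "(\<Sum>k<n. p x k) \<le> Re (G x x)" for n
      using rest_diag[OF that, of n] sqnorm_nonneg[of L "rest n x"] by linarith
    show s: "summable (p x)"
      by (rule summableI_nonneg_bounded[OF p0 le])
    show "suminf (p x) \<le> Re (G x x)"
      by (rule suminf_le_const[OF s le])
  qed
  have AE1: "AE x in M. x \<in> space M - N1"
    using AE_not_in[OF N1(1)] AE_space by eventually_elim auto
  note [measurable] = sq_int_measurable[OF u_sq_int]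
  have [measurable]: "(\<lambda>x. p x k) \<in> borel_measurable M" for k
  proof (cases "k \<in> I")
    case True
    note [measurable] = sq_int_measurable[OF es[OF True]]
    show ?thesis using True unfolding p_def by simp
  qed (simp add: p_def)
  define d where "d x = (\<Sum>n. a n * (cmod (u n x))\<^sup>2)" for x
  have [measurable]: "d \<in> borel_measurable M" unfolding d_def by measurable
  have dG: "d x = Re (G x x)" if "x \<in> space M - N1" for x
    using diag_sums[OF N1(2)[OF that]] by (simp add: d_def sums_iff)
  define c' where "c' k = (if k \<in> I then c k else 0)" for k
  define e' where "e' k = (if k \<in> I then e k else (\<lambda>_. 0))" for k
  have int_p: "(\<integral>\<^sup>+x. ennreal (suminf (p x)) \<partial>M) = (\<Sum>n. ennreal (a n * sqnorm M (u n)))"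
  proof -
    have "(\<integral>\<^sup>+x. ennreal (suminf (p x)) \<partial>M) = (\<integral>\<^sup>+x. (\<Sum>k. ennreal (p x k)) \<partial>M)"
      by (rule nn_integral_cong_AE, use AE1 in eventually_elim) (use p0 ps in \<open>simp add: suminf_ennreal2\<close>)
    also have "\<dots> = (\<integral>\<^sup>+x. (\<Sum>k. ennreal (c' k * (cmod (e' k x))\<^sup>2)) \<partial>M)"
      by (intro nn_integral_cong suminf_cong) (simp add: p_def c'_def e'_def)
    also have "\<dots> = (\<Sum>k. ennreal (c' k * sqnorm M (e' k)))"
      by (rule nn_integral_weighted_squares) (use c0 es in \<open>auto simp: c'_def e'_def\<close>)
    also have "\<dots> = (\<Sum>k. ennreal (c' k))"
    proof -
      have "sqnorm M (e k) = 1" if "k \<in> I" for k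
        using on that ip_self[of M "e k"] by (simp add: orthonormal_def)
      then show ?thesis by (intro suminf_cong) (simp add: c'_def e'_def)
    qed
    finally show ?thesis unfolding c'_def trace .
  qed
  have int_d: "(\<integral>\<^sup>+x. ennreal (d x) \<partial>M) = (\<Sum>n. ennreal (a n * sqnorm M (u n)))"
    unfolding diag_nn_integral[symmetric]
    by (rule nn_integral_cong_AE, use AE1 in eventually_elim) (simp add: dG)
  have "AE x in M. ennreal (suminf (p x)) \<le> ennreal (d x)"
    using AE1 by eventually_elim (use ple dG in \<open>simp add: ennreal_leI\<close>)
  then have "(\<integral>\<^sup>+x. ennreal (d x) - ennreal (suminf (p x)) \<partial>M) = 0"
    by (subst nn_integral_diff) (use int_p int_d tfin in auto)
  then have "AE x in M. ennreal (d x) - ennreal (suminf (p x)) = 0"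
    by (subst (asm) nn_integral_0_iff_AE) auto
  with AE1 have "AE x in M. x \<in> space M - N1 \<and> Re (G x x) \<le> suminf (p x)"
  proof eventually_elim
    case (elim x)
    then have "ennreal (d x) \<le> ennreal (suminf (p x))"
      by (simp add: diff_eq_0_iff_ennreal)
    moreover have "0 \<le> suminf (p x)" using ps elim p0 by (intro suminf_nonneg) auto
    ultimately show ?case using elim dG by simp
  qed
  then obtain N2 where N2: "N2 \<in> null_sets M"
    "\<And>x. x \<in> space M - N2 \<Longrightarrow> x \<in> space M - N1"
    "\<And>x. x \<in> space M - N2 \<Longrightarrow> Re (G x x) \<le> suminf (p x)"
    unfolding eventually_ae_filter by auto
  show "\<exists>N'\<in>null_sets M. \<forall>x\<in>space M - N'. \<forall>y\<in>space M - N'.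
      (\<lambda>k. if k \<in> I then complex_of_real (c k) * e k x * cnj (e k y) else 0) sums G x y"
    unfolding E_def[symmetric]
  proof (intro bexI[OF _ N2(1)] ballI)
    fix x y assume xy: "x \<in> space M - N2" "y \<in> space M - N2"
    have to0: "(\<lambda>n. sqnorm L (rest n x)) \<longlonglongrightarrow> 0" if "x \<in> space M - N2" for x
    proof -
      have "suminf (p x) = Re (G x x)" using N2(3)[OF that] ple[OF N2(2)[OF that]] by simp
      then have "(\<lambda>n. \<Sum>k<n. p x k) \<longlonglongrightarrow> Re (G x x)"
        using summable_LIMSEQ[OF ps[OF N2(2)[OF that]]] by simp
      from tendsto_diff[OF tendsto_const this, of "Re (G x x)"] show ?thesis
        using rest_diag[OF N2(2)[OF that]] by simp
    qed
    have "(\<lambda>n. sqrt (sqnorm L (rest n x) * sqnorm L (rest n y))) \<longlonglongrightarrow> sqrt (0 * 0)"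
      by (intro tendsto_intros to0 xy)
    moreover have "norm (ip L (rest n x) (rest n y)) \<le> sqrt (sqnorm L (rest n x) * sqnorm L (rest n y))" for n
      by (intro real_le_rsqrt Cauchy_Schwarz rests N2(2) xy)
    ultimately have "(\<lambda>n. ip L (rest n x) (rest n y)) \<longlonglongrightarrow> 0"
      by (intro Lim_null_comparison[of "\<lambda>n. ip L (rest n x) (rest n y)" "\<lambda>n. sqrt (sqnorm L (rest n x) * sqnorm L (rest n y))"])
         auto
    from tendsto_diff[OF tendsto_const this, of "G x y"]
    show "(\<lambda>k. E x y k) sums G x y"
      unfolding rr[OF N2(2)[OF xy(1)] N2(2)[OF xy(2)]] sums_def by simp
  qed
qed

end

section \<open>Integrating the determinant of a diagonalized kernel\<close>

text \<open>This is what remains of the determinant after integrating out the points: the matrix is the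
  identity if \<open>k\<close> is injective and has two equal rows otherwise.\<close>

lemma det_equality_pattern:
  fixes k :: "nat \<Rightarrow> 'b"
  shows "Determinant.det (Matrix.mat n n (\<lambda>(i, j). if k i = k j then 1 else 0)) =
    (if inj_on k {..<n} then 1 else (0::'c::idom))"
proof (cases "inj_on k {..<n}")
  case True
  then have "Matrix.mat n n (\<lambda>(i, j). if k i = k j then 1 else 0) = (1\<^sub>m n :: 'c mat)"
    by (intro eq_matI) (auto simp: inj_on_def)
  then show ?thesis using True by simp
next
  case False
  then obtain i j where ij: "i < n" "j < n" "i \<noteq> j" "k i = k j" by (auto simp: inj_on_def)
  have "row (Matrix.mat n n (\<lambda>(i, j). if k i = k j then 1 else (0::'c))) i = row (Matrix.mat n n (\<lambda>(i, j). if k i = k j then 1 else 0)) j"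
    using ij by (intro eq_vecI) auto
  from Determinant.det_identical_rows[OF mat_carrier ij(3,1,2) this] show ?thesis using False by simp
qed

lemma det_finite_rank:
  fixes c :: "nat \<Rightarrow> complex" and e e' :: "nat \<Rightarrow> 'a \<Rightarrow> complex"
  assumes "finite F"
  shows "Determinant.det (Matrix.mat n n (\<lambda>(i, j). \<Sum>k\<in>F. c k * e k (x i) * e' k (x j))) =
    (\<Sum>p | p permutes {..<n}. signof p * (\<Sum>k\<in>{..<n} \<rightarrow>\<^sub>E F. \<Prod>j<n. c (k j) * (e (k (Hilbert_Choice.inv p j)) (x j) * e' (k j) (x j))))" (is "_ = ?R")
proof -
  let ?A = "Matrix.mat n n (\<lambda>(i, j). \<Sum>k\<in>F. c k * e k (x i) * e' k (x j))"
  have "Determinant.det (?A) =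
    (\<Sum>p | p permutes {0..<n}. signof p * (\<Prod>j<n. ?A $$ (p j, j)))"
    by (rule det_col) simp
  also have "\<dots> = ?R"
    unfolding atLeast0LessThan
  proof (intro sum.cong refl arg_cong2[where f="(*)"])
    fix p assume "p \<in> {p. p permutes {..<n}}"
    then have p: "p permutes {..<n}" by simp
    have "(\<Prod>j<n. ?A $$ (p j, j)) =
      (\<Prod>j<n. \<Sum>k\<in>F. c k * e k (x (p j)) * e' k (x j))"
    proof (rule prod.cong[OF refl])
      fix j assume "j \<in> {..<n}"
      then have "j < n" "p j < n" using permutes_in_image[OF p, of j] by auto
      then show "?A $$ (p j, j) = (\<Sum>k\<in>F. c k * e k (x (p j)) * e' k (x j))"
        by simp
    qed
    also have "\<dots> = (\<Sum>k\<in>{..<n} \<rightarrow>\<^sub>E F. \<Prod>j<n. c (k j) * e (k j) (x (p j)) * e' (k j) (x j))"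
      by (rule prod_sum_PiE) (use assms in auto)
    also have "\<dots> = (\<Sum>k\<in>{..<n} \<rightarrow>\<^sub>E F. \<Prod>j<n. c (k j) * (e (k (Hilbert_Choice.inv p j)) (x j) * e' (k j) (x j)))"
    proof (rule sum.cong[OF refl])
      fix k
      have "(\<Prod>j<n. e (k j) (x (p j))) = (\<Prod>j<n. e (k (Hilbert_Choice.inv p j)) (x j))"
        using prod.permutes_inv[OF p, of "\<lambda>a b. e (k b) (x a)"] .
      then show "(\<Prod>j<n. c (k j) * e (k j) (x (p j)) * e' (k j) (x j)) = (\<Prod>j<n. c (k j) * (e (k (Hilbert_Choice.inv p j)) (x j) * e' (k j) (x j)))"
        by (simp add: prod.distrib mult.assoc)
    qed
    finally show "(\<Prod>j<n. ?A $$ (p j, j)) = \<dots>" .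
  qed
  finally show ?thesis .
qed

text \<open>After expanding every entry and the determinant, each summand is a product of functions of one
  point each. By orthogonality on \<open>B j\<close>, the \<open>j\<close>-th factor vanishes unless the permutation
  preserves \<open>k\<close> at \<open>j\<close>; summing the signs of these permutations gives \<open>det_equality_pattern\<close>.\<close>

lemma
  fixes M :: "'a measure" and c :: "nat \<Rightarrow> complex" and e :: "nat \<Rightarrow> 'a \<Rightarrow> complex" and B :: "nat \<Rightarrow> 'a set"
  assumes sf: "sigma_finite_measure M" and F: "finite F"
    and e: "\<And>k. sq_int M (e k)" and B: "\<And>j. B j \<in> sets M"
    and orth: "\<And>j k l. j < n \<Longrightarrow> (\<integral>x. indicator (B j) x * (e k x * cnj (e l x)) \<partial>M) = (if k = l then q k j else 0)"
  defines "g \<equiv> \<lambda>x. (\<Prod>j<n. indicator (B j) (x j)) *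
      Determinant.det (Matrix.mat n n (\<lambda>(i, j). \<Sum>k\<in>F. c k * e k (x i) * cnj (e k (x j))))"
  shows integrable_det_finite_rank: "integrable (Pi\<^sub>M {..<n} (\<lambda>_. M)) g"
    and integral_det_finite_rank: "integral\<^sup>L (Pi\<^sub>M {..<n} (\<lambda>_. M)) g =
      (\<Sum>k | k \<in> {..<n} \<rightarrow>\<^sub>E F \<and> inj_on k {..<n}. \<Prod>j<n. c (k j) * q (k j) j)"
proof -
  interpret product_sigma_finite "\<lambda>_::nat. M"
    using sf by (simp add: product_sigma_finite_def)
  define t where "t p k j y = c (k j) * (indicator (B j) y * (e (k (Hilbert_Choice.inv p j)) y * cnj (e (k j) y)))"
    for p and k :: "nat \<Rightarrow> nat" and j y
  have it: "integrable M (t p k j)" for p k j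
  proof -
    have "integrable M (\<lambda>y. (indicator (B j) y * e (k (Hilbert_Choice.inv p j)) y) * cnj (e (k j) y))"
      by (intro sq_int_integrable_mult sq_int_indicator e B)
    from integrable_mult_right[OF this, of "c (k j)"] show ?thesis
      unfolding t_def by (simp add: mult.assoc)
  qed
  have g: "g x = (\<Sum>p | p permutes {..<n}. signof p * (\<Sum>k\<in>{..<n} \<rightarrow>\<^sub>E F. \<Prod>j<n. t p k j (x j)))" for x
    unfolding g_def t_def det_finite_rank[OF F, where x=x and e=e and e'="\<lambda>k y. cnj (e k y)" and c=c] prod.distrib sum_distrib_left
    by (intro sum.cong refl) (simp only: mult_ac)
  have int1: "integrable (Pi\<^sub>M {..<n} (\<lambda>_. M)) (\<lambda>x. \<Prod>j<n. t p k j (x j))" for p k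
    by (rule product_integrable_prod) (auto intro: it)
  show "integrable (Pi\<^sub>M {..<n} (\<lambda>_. M)) g"
    unfolding g[abs_def] by (intro Bochner_Integration.integrable_sum integrable_mult_right int1)
  have "integral\<^sup>L (Pi\<^sub>M {..<n} (\<lambda>_. M)) g =
    (\<Sum>p | p permutes {..<n}. signof p * (\<Sum>k\<in>{..<n} \<rightarrow>\<^sub>E F. \<integral>x. (\<Prod>j<n. t p k j (x j)) \<partial>Pi\<^sub>M {..<n} (\<lambda>_. M)))"
    unfolding g[abs_def] by (subst Bochner_Integration.integral_sum; simp add: Bochner_Integration.integral_sum int1)
  also have "\<dots> = (\<Sum>p | p permutes {..<n}. signof p * (\<Sum>k\<in>{..<n} \<rightarrow>\<^sub>E F. (\<Prod>j<n. c (k j) * q (k j) j) * (\<Prod>j<n. if k (p j) = k j then 1 else 0)))"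
  proof (intro sum.cong refl arg_cong2[where f="(*)"])
    fix p k assume "p \<in> {p. p permutes {..<n}}"
    then have p: "p permutes {..<n}" by simp
    have "(\<integral>x. (\<Prod>j<n. t p k j (x j)) \<partial>Pi\<^sub>M {..<n} (\<lambda>_. M)) = (\<Prod>j<n. integral\<^sup>L M (t p k j))"
      by (rule product_integral_prod) (auto intro: it)
    also have "\<dots> = (\<Prod>j<n. (c (k j) * q (k j) j) * (if k (Hilbert_Choice.inv p j) = k j then 1 else 0))"
      by (rule prod.cong) (auto simp: t_def[abs_def] orth)
    also have "\<dots> = (\<Prod>j<n. c (k j) * q (k j) j) * (\<Prod>j<n. if k j = k (Hilbert_Choice.inv p j) then 1 else 0)"
      by (simp add: prod.distrib eq_commute)
    also have "(\<Prod>j<n. if k j = k (Hilbert_Choice.inv p j) then 1 else (0::complex)) = (\<Prod>j<n. if k (p j) = k j then 1 else 0)"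
      using prod.permutes_inv[OF p, of "\<lambda>a b. if k a = k b then 1 else (0::complex)"] by simp
    finally show "(\<integral>x. (\<Prod>j<n. t p k j (x j)) \<partial>Pi\<^sub>M {..<n} (\<lambda>_. M)) = (\<Prod>j<n. c (k j) * q (k j) j) * (\<Prod>j<n. if k (p j) = k j then 1 else 0)" .
  qed
  also have "\<dots> = (\<Sum>k\<in>{..<n} \<rightarrow>\<^sub>E F. (\<Prod>j<n. c (k j) * q (k j) j) *
      (\<Sum>p | p permutes {..<n}. signof p * (\<Prod>j<n. if k (p j) = k j then 1 else 0)))"
  proof -
    have "(\<Sum>p\<in>P. s p * (\<Sum>k\<in>Q. b k * d p k)) = (\<Sum>k\<in>Q. b k * (\<Sum>p\<in>P. s p * d p k))"
      for P :: "(nat \<Rightarrow> nat) set" and Q :: "(nat \<Rightarrow> nat) set" and s b and d :: "_ \<Rightarrow> _ \<Rightarrow> complex"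
      unfolding sum_distrib_left by (subst sum.swap) (simp add: mult.left_commute)
    then show ?thesis .
  qed
  also have "\<dots> = (\<Sum>k\<in>{..<n} \<rightarrow>\<^sub>E F. (\<Prod>j<n. c (k j) * q (k j) j) * (if inj_on k {..<n} then 1 else 0))"
  proof (intro sum.cong refl arg_cong2[where f="(*)"])
    fix k :: "nat \<Rightarrow> nat"
    have "(if inj_on k {..<n} then 1 else (0::complex)) = (\<Sum>p | p permutes {0..<n}. signof p * (\<Prod>j<n. Matrix.mat n n (\<lambda>(i, j). if k i = k j then 1 else 0) $$ (p j, j)))"
      unfolding det_equality_pattern[symmetric] by (rule det_col) simp
    also have "\<dots> = (\<Sum>p | p permutes {..<n}. signof p * (\<Prod>j<n. if k (p j) = k j then 1 else 0))"
      unfolding atLeast0LessThan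
    proof (intro sum.cong refl arg_cong2[where f="(*)"] prod.cong)
      fix p j assume "p \<in> {p. p permutes {..<n}}" and j: "j \<in> {..<n}"
      then have "p j < n" using permutes_in_image[of p "{..<n}" j] by simp
      then show "Matrix.mat n n (\<lambda>(i, j). if k i = k j then 1 else 0) $$ (p j, j) = (if k (p j) = k j then 1 else (0::complex))"
        using j by simp
    qed
    finally show "(\<Sum>p | p permutes {..<n}. signof p * (\<Prod>j<n. if k (p j) = k j then 1 else 0)) = (if inj_on k {..<n} then 1 else (0::complex))" ..
  qed
  also have "\<dots> = (\<Sum>k\<in>{..<n} \<rightarrow>\<^sub>E F. if inj_on k {..<n} then (\<Prod>j<n. c (k j) * q (k j) j) else 0)"
    by (intro sum.cong) auto
  also have "\<dots> = (\<Sum>k | k \<in> {..<n} \<rightarrow>\<^sub>E F \<and> inj_on k {..<n}. \<Prod>j<n. c (k j) * q (k j) j)"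
    by (subst sum.inter_filter) (auto intro: finite_PiE F)
  finally show "integral\<^sup>L (Pi\<^sub>M {..<n} (\<lambda>_. M)) g =
      (\<Sum>k | k \<in> {..<n} \<rightarrow>\<^sub>E F \<and> inj_on k {..<n}. \<Prod>j<n. c (k j) * q (k j) j)" .
qed

text \<open>The factor \<open>fact n\<close> could be removed by Hadamard's inequality; for a dominating function
  at fixed \<open>n\<close> the trivial bound suffices.\<close>

lemma norm_det_le:
  fixes K :: "'a \<Rightarrow> 'a \<Rightarrow> complex"
  assumes K: "\<And>i j. i < n \<Longrightarrow> j < n \<Longrightarrow> cmod (K (x i) (x j)) \<le> sqrt (d (x i)) * sqrt (d (x j))"
    and d: "\<And>i. i < n \<Longrightarrow> 0 \<le> d (x i)"
  shows "cmod (Determinant.det (Matrix.mat n n (\<lambda>(i, j). K (x i) (x j)))) \<le> fact n * (\<Prod>j<n. d (x j))"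
proof -
  have "Determinant.det (Matrix.mat n n (\<lambda>(i, j). K (x i) (x j))) =
    (\<Sum>p | p permutes {..<n}. signof p * (\<Prod>j<n. Matrix.mat n n (\<lambda>(i, j). K (x i) (x j)) $$ (p j, j)))"
    using det_col[of "Matrix.mat n n (\<lambda>(i, j). K (x i) (x j))" n] by (simp add: atLeast0LessThan)
  also have "cmod \<dots> \<le> (\<Sum>p | p permutes {..<n}. \<Prod>j<n. d (x j))"
  proof (rule sum_norm_le)
    fix p assume "p \<in> {p. p permutes {..<n}}"
    then have p: "p permutes {..<n}" by simp
    have pn: "p j < n" if "j < n" for j using permutes_in_image[OF p, of j] that by auto
    have "cmod (signof p * (\<Prod>j<n. Matrix.mat n n (\<lambda>(i, j). K (x i) (x j)) $$ (p j, j))) = (\<Prod>j<n. cmod (K (x (p j)) (x j)))"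
      using pn by (auto simp: norm_mult sign_def prod_norm[symmetric] intro!: prod.cong)
    also have "\<dots> \<le> (\<Prod>j<n. sqrt (d (x (p j))) * sqrt (d (x j)))"
      using pn K by (intro prod_mono) auto
    also have "\<dots> = (\<Prod>j<n. sqrt (d (x (p j)))) * (\<Prod>j<n. sqrt (d (x j)))"
      by (rule prod.distrib)
    also have "(\<Prod>j<n. sqrt (d (x (p j)))) = (\<Prod>j<n. sqrt (d (x j)))"
      using prod.permute[OF p, of "\<lambda>j. sqrt (d (x j))"] by (simp add: o_def)
    also have "(\<Prod>j<n. sqrt (d (x j))) * (\<Prod>j<n. sqrt (d (x j))) = (\<Prod>j<n. d (x j))"
      unfolding prod.distrib[symmetric] using d by (intro prod.cong) auto
    finally show "cmod (signof p * (\<Prod>j<n. Matrix.mat n n (\<lambda>(i, j). K (x i) (x j)) $$ (p j, j))) \<le> (\<Prod>j<n. d (x j))" .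
  qed
  also have "\<dots> = fact n * (\<Prod>j<n. d (x j))"
    using card_permutations[of "{..<n}" n] by simp
  finally show ?thesis .
qed

lemma tendsto_det:
  fixes A :: "nat \<Rightarrow> nat \<Rightarrow> nat \<Rightarrow> complex"
  assumes "\<And>i j. i < n \<Longrightarrow> j < n \<Longrightarrow> (\<lambda>m. A m i j) \<longlonglongrightarrow> L i j"
  shows "(\<lambda>m. Determinant.det (Matrix.mat n n (\<lambda>(i, j). A m i j))) \<longlonglongrightarrow> Determinant.det (Matrix.mat n n (\<lambda>(i, j). L i j))"
proof -
  have *: "Determinant.det (Matrix.mat n n (\<lambda>(i, j). A i j)) =
    (\<Sum>p | p permutes {..<n}. signof p * (\<Prod>j<n. A (p j) j))" for A :: "nat \<Rightarrow> nat \<Rightarrow> complex"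
    using det_col[of "Matrix.mat n n (\<lambda>(i, j). A i j)" n]
    by (auto simp: atLeast0LessThan dest: permutes_in_image intro!: sum.cong prod.cong)
  show ?thesis unfolding *
    by (intro tendsto_intros assms) (auto dest: permutes_in_image)
qed

lemma AE_PiM_sigma_finite_component:
  assumes "sigma_finite_measure M" "finite I" "i \<in> I" "AE y in M. P y"
  shows "AE x in Pi\<^sub>M I (\<lambda>_. M). P (x i)"
proof -
  interpret product_sigma_finite "\<lambda>_. M"
    using assms by (simp add: product_sigma_finite_def)
  obtain N where N: "N \<in> null_sets M" "{y \<in> space M. \<not> P y} \<subseteq> N"
    using assms(4) unfolding eventually_ae_filter by auto
  let ?S = "\<Pi>\<^sub>E j\<in>I. if j = i then N else space M"
  have "emeasure (Pi\<^sub>M I (\<lambda>_. M)) ?S = 0"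
    using assms N by (subst emeasure_PiM) (auto simp: null_sets_def intro!: prod_zero bexI[of _ i])
  moreover have "?S \<in> sets (Pi\<^sub>M I (\<lambda>_. M))"
    using N assms(2) by (intro sets_PiM_I_finite) auto
  ultimately have "?S \<in> null_sets (Pi\<^sub>M I (\<lambda>_. M))" by auto
  moreover have "{x \<in> space (Pi\<^sub>M I (\<lambda>_. M)). \<not> P (x i)} \<subseteq> ?S"
    using N assms(3) by (auto simp: space_PiM PiE_iff extensional_def)
  ultimately show ?thesis unfolding eventually_ae_filter by blast
qed

text \<open>The passage from finitely many eigenfunctions to all of them, by dominated convergence. The
  result is kept as a limit over the number of eigenfunctions rather than as an infinite sum over
  tuples, since the balls in cells will produce exactly the same finite sums.\<close>

theorem nn_integral_det_limit:
  fixes M :: "'a measure" and c :: "nat \<Rightarrow> real" and e :: "nat \<Rightarrow> 'a \<Rightarrow> complex" and B :: "nat \<Rightarrow> 'a set"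
  assumes sf: "sigma_finite_measure M"
    and e: "\<And>k. sq_int M (e k)" and e1: "\<And>k. sqnorm M (e k) \<le> 1" and B: "\<And>j. B j \<in> sets M"
    and c: "\<And>k. 0 \<le> c k" "summable c"
    and orth: "\<And>j k l. j < n \<Longrightarrow> (\<integral>x. indicator (B j) x * (e k x * cnj (e l x)) \<partial>M) = (if k = l then complex_of_real (q k j) else 0)"
    and N: "N \<in> null_sets M"
    and K: "\<And>x y i j. i < n \<Longrightarrow> j < n \<Longrightarrow> x \<in> B i - N \<Longrightarrow> y \<in> B j - N \<Longrightarrow> (\<lambda>k. c k * e k x * cnj (e k y)) sums K x y"
    and \<rho>: "\<rho> \<in> borel_measurable (Pi\<^sub>M {..<n} (\<lambda>_. M))" "\<And>x. x \<in> space (Pi\<^sub>M {..<n} (\<lambda>_. M)) \<Longrightarrow> 0 \<le> \<rho> x"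
    and det: "\<And>x. x \<in> space (Pi\<^sub>M {..<n} (\<lambda>_. M)) \<Longrightarrow> complex_of_real (\<rho> x) = Determinant.det (Matrix.mat n n (\<lambda>(i, j). K (x i) (x j)))"
  shows "(\<lambda>m. ennreal (\<Sum>k | k \<in> {..<n} \<rightarrow>\<^sub>E {..<m} \<and> inj_on k {..<n}. \<Prod>j<n. c (k j) * q (k j) j)) \<longlonglongrightarrow>
    (\<integral>\<^sup>+x\<in>(\<Pi>\<^sub>E j\<in>{..<n}. B j). ennreal (\<rho> x) \<partial>Pi\<^sub>M {..<n} (\<lambda>_. M))"
proof -
  interpret product_sigma_finite "\<lambda>_::nat. M"
    using sf by (simp add: product_sigma_finite_def)
  let ?P = "Pi\<^sub>M {..<n} (\<lambda>_. M)"
  define Km where "Km m x y = (\<Sum>k<m. complex_of_real (c k) * e k x * cnj (e k y))" for m x y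
  define g where "g m x = (\<Prod>j<n. indicator (B j) (x j)) * Determinant.det (Matrix.mat n n (\<lambda>(i, j). Km m (x i) (x j)))" for m x
  define gl where "gl x = complex_of_real (indicator (\<Pi>\<^sub>E j\<in>{..<n}. B j) x * \<rho> x)" for x
  define d where "d x = (\<Sum>k. c k * (cmod (e k x))\<^sup>2)" for x
  have gi: "integral\<^sup>L ?P (g m) = complex_of_real (\<Sum>k | k \<in> {..<n} \<rightarrow>\<^sub>E {..<m} \<and> inj_on k {..<n}. \<Prod>j<n. c (k j) * q (k j) j)"
    and gint: "integrable ?P (g m)" for m
    using integral_det_finite_rank[where c="\<lambda>k. complex_of_real (c k)" and q="\<lambda>k j. complex_of_real (q k j)", OF sf _ e B orth, of "{..<m}"]
      integrable_det_finite_rank[where c="\<lambda>k. complex_of_real (c k)" and q="\<lambda>k j. complex_of_real (q k j)", OF sf _ e B orth, of "{..<m}"]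
    unfolding g_def Km_def by simp_all
  note [measurable] = sq_int_measurable[OF e] B \<rho>(1)
  have dm: "d \<in> borel_measurable M" unfolding d_def by measurable
  note d_nn = nn_integral_weighted_squares[of c M e, OF c(1) e]
  have "summable (\<lambda>k. c k * sqnorm M (e k))"
    by (rule summable_comparison_test'[OF c(2)]) (use c e1 in \<open>auto simp: mult_left_le\<close>)
  then have d_fin: "(\<integral>\<^sup>+x. (\<Sum>k. ennreal (c k * (cmod (e k x))\<^sup>2)) \<partial>M) < \<infinity>"
    unfolding d_nn using c by (subst suminf_ennreal2) auto
  then have ds: "AE x in M. summable (\<lambda>k. c k * (cmod (e k x))\<^sup>2)"
  proof -
    have "AE x in M. (\<Sum>k. ennreal (c k * (cmod (e k x))\<^sup>2)) \<noteq> \<infinity>"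
      using d_fin by (intro nn_integral_PInf_AE) auto
    then show ?thesis by eventually_elim (intro summable_suminf_not_top, use c in auto)
  qed
  have "(\<integral>\<^sup>+x. ennreal (d x) \<partial>M) = (\<integral>\<^sup>+x. (\<Sum>k. ennreal (c k * (cmod (e k x))\<^sup>2)) \<partial>M)"
    by (rule nn_integral_cong_AE, use ds in eventually_elim) (use c in \<open>simp add: d_def suminf_ennreal2\<close>)
  moreover have "AE x in M. 0 \<le> d x"
    using ds by eventually_elim (use c in \<open>auto simp: d_def intro!: suminf_nonneg\<close>)
  ultimately have dint: "integrable M d"
    using d_fin dm by (intro integrableI_nonneg) auto
  have "AE y in M. summable (\<lambda>k. c k * (cmod (e k y))\<^sup>2) \<and> y \<notin> N"
    using ds AE_not_in[OF N] by eventually_elim auto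
  then have good: "AE x in ?P. \<forall>j\<in>{..<n}. summable (\<lambda>k. c k * (cmod (e k (x j)))\<^sup>2) \<and> x j \<notin> N"
    by (intro AE_finite_allI AE_PiM_sigma_finite_component sf) auto
  have Kb: "cmod (Km m x y) \<le> sqrt (d x) * sqrt (d y)"
    if "summable (\<lambda>k. c k * (cmod (e k x))\<^sup>2)" "summable (\<lambda>k. c k * (cmod (e k y))\<^sup>2)" for m x y
  proof -
    have L: "L2_set (\<lambda>k. sqrt (c k) * cmod (e k x)) {..<m} \<le> sqrt (d x)" if "summable (\<lambda>k. c k * (cmod (e k x))\<^sup>2)" for x
      using that c unfolding L2_set_def d_def by (auto simp: power_mult_distrib intro!: sum_le_suminf)
    have "cmod (Km m x y) \<le> (\<Sum>k<m. \<bar>sqrt (c k) * cmod (e k x)\<bar> * \<bar>sqrt (c k) * cmod (e k y)\<bar>)"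
      unfolding Km_def
    proof (rule sum_norm_le)
      fix k
      have "cmod (complex_of_real (c k) * e k x * cnj (e k y)) = (sqrt (c k) * sqrt (c k)) * cmod (e k x) * cmod (e k y)"
        using c(1)[of k] by (simp add: norm_mult)
      then show "cmod (complex_of_real (c k) * e k x * cnj (e k y)) \<le> \<bar>sqrt (c k) * cmod (e k x)\<bar> * \<bar>sqrt (c k) * cmod (e k y)\<bar>"
        using c(1)[of k] by (simp only: abs_mult abs_norm_cancel real_sqrt_abs2 abs_of_nonneg[OF real_sqrt_ge_zero] mult_ac order_refl)
    qed
    also have "\<dots> \<le> L2_set (\<lambda>k. sqrt (c k) * cmod (e k x)) {..<m} * L2_set (\<lambda>k. sqrt (c k) * cmod (e k y)) {..<m}"
      by (rule L2_set_mult_ineq)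
    also have "\<dots> \<le> sqrt (d x) * sqrt (d y)"
      using that c(1) unfolding d_def[of x]
      by (intro mult_mono L[unfolded d_def] L) (auto simp: L2_set_nonneg intro!: suminf_nonneg)
    finally show ?thesis .
  qed
  have lim: "AE x in ?P. (\<lambda>m. g m x) \<longlonglongrightarrow> gl x"
    using good AE_space
  proof eventually_elim
    case (elim x)
    show ?case
    proof (cases "\<forall>j<n. x j \<in> B j")
      case True
      have ind: "(\<Prod>j<n. indicator (B j) (x j)) = (1::complex)" using True by simp
      have "x \<in> (\<Pi>\<^sub>E j\<in>{..<n}. B j)" using True elim by (auto simp: space_PiM PiE_iff)
      then have "gl x = Determinant.det (Matrix.mat n n (\<lambda>(i, j). K (x i) (x j)))"
        using det[OF elim(2)] by (simp add: gl_def)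
      moreover have "(\<lambda>m. Determinant.det (Matrix.mat n n (\<lambda>(i, j). Km m (x i) (x j)))) \<longlonglongrightarrow> Determinant.det (Matrix.mat n n (\<lambda>(i, j). K (x i) (x j)))"
      proof (rule tendsto_det)
        fix i j assume ij: "i < n" "j < n"
        show "(\<lambda>m. Km m (x i) (x j)) \<longlonglongrightarrow> K (x i) (x j)"
          using K[OF ij, of "x i" "x j"] True ij elim unfolding Km_def sums_def by auto
      qed
      ultimately show ?thesis unfolding g_def ind by simp
    next
      case False
      then have z: "(\<Prod>j<n. indicator (B j) (x j)) = (0::complex)"
        by (intro prod_zero) (auto intro!: bexI)
      moreover have "x \<notin> (\<Pi>\<^sub>E j\<in>{..<n}. B j)" using False by auto
      ultimately show ?thesis unfolding g_def gl_def z by simp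
    qed
  qed
  have bound: "AE x in ?P. norm (g m x) \<le> fact n * (\<Prod>j<n. d (x j))" for m
    using good
  proof eventually_elim
    case (elim x)
    have d0: "0 \<le> d (x j)" if "j < n" for j
      using elim that c unfolding d_def by (intro suminf_nonneg) auto
    have "norm (g m x) = cmod (\<Prod>j<n. indicator (B j) (x j)) * cmod (Determinant.det (Matrix.mat n n (\<lambda>(i, j). Km m (x i) (x j))))"
      by (simp add: g_def norm_mult)
    also have "\<dots> \<le> 1 * cmod (Determinant.det (Matrix.mat n n (\<lambda>(i, j). Km m (x i) (x j))))"
      by (intro mult_right_mono) (auto simp: prod_norm[symmetric] indicator_def intro!: prod_le_1)
    also have "\<dots> \<le> fact n * (\<Prod>j<n. d (x j))"
      unfolding mult_1 using elim by (intro norm_det_le Kb d0) auto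
    finally show ?case .
  qed
  have [measurable]: "(\<Pi>\<^sub>E j\<in>{..<n}. B j) \<in> sets ?P" by (intro sets_PiM_I_finite) auto
  have glm: "gl \<in> borel_measurable ?P" unfolding gl_def by measurable
  have wint: "integrable ?P (\<lambda>x. fact n * (\<Prod>j<n. d (x j)))"
    by (intro integrable_mult_right product_integrable_prod dint) simp
  note dc = glm borel_measurable_integrable[OF gint] wint lim bound
  have lim_gl: "(\<lambda>m. integral\<^sup>L ?P (g m)) \<longlonglongrightarrow> integral\<^sup>L ?P gl"
    by (rule integral_dominated_convergence[OF dc])
  have "integrable ?P gl"
    by (rule integrable_dominated_convergence[OF dc])
  from integrable_Re[OF this] have int: "integrable ?P (\<lambda>x. indicator (\<Pi>\<^sub>E j\<in>{..<n}. B j) x * \<rho> x)"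
    by (simp add: gl_def)
  have "(\<integral>\<^sup>+x\<in>(\<Pi>\<^sub>E j\<in>{..<n}. B j). ennreal (\<rho> x) \<partial>?P) = (\<integral>\<^sup>+x. ennreal (indicator (\<Pi>\<^sub>E j\<in>{..<n}. B j) x * \<rho> x) \<partial>?P)"
    by (intro nn_integral_cong) (simp add: indicator_def)
  also have "\<dots> = ennreal (\<integral>x. indicator (\<Pi>\<^sub>E j\<in>{..<n}. B j) x * \<rho> x \<partial>?P)"
    using int by (rule nn_integral_eq_integral) (use \<rho>(2) AE_space in \<open>auto elim: eventually_mono\<close>)
  finally have nn: "(\<integral>\<^sup>+x\<in>(\<Pi>\<^sub>E j\<in>{..<n}. B j). ennreal (\<rho> x) \<partial>?P) = ennreal (\<integral>x. indicator (\<Pi>\<^sub>E j\<in>{..<n}. B j) x * \<rho> x \<partial>?P)" .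
  have "integral\<^sup>L ?P gl = complex_of_real (\<integral>x. indicator (\<Pi>\<^sub>E j\<in>{..<n}. B j) x * \<rho> x \<partial>?P)"
    unfolding gl_def by (rule integral_complex_of_real)
  from lim_gl[unfolded gi this tendsto_of_real_iff] show ?thesis
    unfolding nn by (rule tendsto_ennrealI)
qed

section \<open>Factorial moments of a simple point process\<close>

text \<open>The number of injective \<open>n\<close>-tuples of points, the \<open>j\<close>-th one of colour \<open>f j\<close>, when there are
  \<open>N i\<close> points of colour \<open>i\<close>: the \<open>j\<close>-th choice excludes the points of the same colour already
  chosen. The truncated subtraction gives 0 when a colour is exhausted, so this is a product of falling
  factorials of the \<open>N i\<close>.\<close>

definition falling_moment :: "('r \<Rightarrow> nat) \<Rightarrow> nat \<Rightarrow> (nat \<Rightarrow> 'r) \<Rightarrow> nat" where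
  "falling_moment N n f = (\<Prod>j<n. N (f j) - card {l. l < j \<and> f l = f j})"

lemma card_injective_tuples:
  fixes C :: "'r \<Rightarrow> 'b set"
  assumes S: "finite S" and disj: "disjoint_family C"
  shows "card {x \<in> {..<n} \<rightarrow>\<^sub>E S. (\<forall>j<n. x j \<in> C (f j)) \<and> inj_on x {..<n}} =
    falling_moment (\<lambda>i. card (S \<inter> C i)) n f"
proof (induction n)
  case 0
  have "{x \<in> {..<0} \<rightarrow>\<^sub>E S. (\<forall>j<0. x j \<in> C (f j)) \<and> inj_on x {..<0}} = {\<lambda>_. undefined}"
    by auto
  then show ?case by (simp add: falling_moment_def)
next
  case (Suc n)
  define T where "T n = {x \<in> {..<n} \<rightarrow>\<^sub>E S. (\<forall>j<n. x j \<in> C (f j)) \<and> inj_on x {..<n}}" for n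
  define R where "R x = S \<inter> C (f n) - x ` {..<n}" for x
  have fT: "finite (T n)" unfolding T_def by (intro finite_Collect_conjI disjI1) (simp add: S finite_PiE)
  let ?h = "\<lambda>(x, y). x(n := y)"
  have img: "T (Suc n) = ?h ` (SIGMA x:T n. R x)"
  proof (intro subset_antisym subsetI)
    fix z assume z: "z \<in> T (Suc n)"
    have "restrict z {..<n} \<in> T n"
      using z unfolding T_def by (auto simp: PiE_iff inj_on_def)
    moreover have "z n \<in> R (restrict z {..<n})"
    proof -
      have inj: "inj_on z {..<Suc n}" using z by (simp add: T_def)
      have "z n \<noteq> z l" if "l < n" for l
        using inj_onD[OF inj, of n l] that by auto
      then show ?thesis using z unfolding T_def R_def by (auto simp: PiE_iff)
    qed
    moreover have "z = ?h (restrict z {..<n}, z n)"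
      using z unfolding T_def by (auto simp: PiE_iff extensional_def fun_eq_iff less_Suc_eq)
    ultimately show "z \<in> ?h ` (SIGMA x:T n. R x)" by blast
  next
    fix z assume "z \<in> ?h ` (SIGMA x:T n. R x)"
    then obtain x y where z: "z = x(n := y)" "x \<in> T n" "y \<in> R x" by auto
    then have "inj_on z {..<n}" "z ` {..<n} = x ` {..<n}"
      unfolding T_def by (auto simp: inj_on_def)
    then have "inj_on z {..<Suc n}"
      using z unfolding R_def lessThan_Suc by (subst inj_on_insert) auto
    then show "z \<in> T (Suc n)"
      using z unfolding T_def R_def by (auto simp: PiE_iff extensional_def less_Suc_eq)
  qed
  have inj: "inj_on ?h (SIGMA x:T n. R x)"
  proof (rule inj_onI, clarify)
    fix x y x' y' assume a: "x \<in> T n" "x' \<in> T n" "x(n := y) = x'(n := y')"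
    have "x = x'"
    proof
      fix j
      show "x j = x' j"
      proof (cases "j = n")
        case True
        then show ?thesis using a unfolding T_def by (auto simp: PiE_iff extensional_def)
      next
        case False
        then show ?thesis using fun_cong[OF a(3), of j] by simp
      qed
    qed
    then show "x = x' \<and> y = y'" using fun_cong[OF a(3), of n] by simp
  qed
  have R: "card (R x) = card (S \<inter> C (f n)) - card {l. l < n \<and> f l = f n}" if x: "x \<in> T n" for x
  proof -
    have "S \<inter> C (f n) \<inter> x ` {..<n} = x ` {l. l < n \<and> f l = f n}"
    proof (intro subset_antisym subsetI)
      fix y assume "y \<in> S \<inter> C (f n) \<inter> x ` {..<n}"
      then obtain l where l: "l < n" "y = x l" "x l \<in> C (f n)" by auto
      then have "x l \<in> C (f l)" using x by (auto simp: T_def)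
      then have "f l = f n" using l disj unfolding disjoint_family_on_def by blast
      then show "y \<in> x ` {l. l < n \<and> f l = f n}" using l by auto
    next
      fix y assume "y \<in> x ` {l. l < n \<and> f l = f n}"
      then obtain l where l: "l < n" "y = x l" "f l = f n" by auto
      then have "x l \<in> C (f l)" "x l \<in> S" using x by (auto simp: T_def)
      then show "y \<in> S \<inter> C (f n) \<inter> x ` {..<n}" using l by auto
    qed
    moreover have "card (x ` {l. l < n \<and> f l = f n}) = card {l. l < n \<and> f l = f n}"
      by (rule card_image) (use x in \<open>auto simp: T_def inj_on_def\<close>)
    ultimately show ?thesis
      unfolding R_def using S by (subst card_Diff_subset_Int) auto
  qed
  have "card (T (Suc n)) = card (SIGMA x:T n. R x)"
    unfolding img by (rule card_image[OF inj])
  also have "\<dots> = (\<Sum>x\<in>T n. card (R x))"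
    by (rule card_SigmaI) (use fT S in \<open>auto simp: R_def\<close>)
  also have "\<dots> = card (T n) * (card (S \<inter> C (f n)) - card {l. l < n \<and> f l = f n})"
    by (simp add: R)
  also have "\<dots> = falling_moment (\<lambda>i. card (S \<inter> C i)) (Suc n) f"
    using Suc.IH unfolding T_def falling_moment_def by simp
  finally show ?case unfolding T_def .
qed

lemma separating_open_sequence:
  obtains b :: "nat \<Rightarrow> 'a::{second_countable_topology, t2_space} set"
  where "\<And>i. open (b i)" "\<And>x y. x \<noteq> y \<Longrightarrow> \<exists>i. x \<in> b i \<and> y \<notin> b i"
proof -
  obtain \<B> :: "'a set set" where B: "countable \<B>" "topological_basis \<B>"
    using ex_countable_basis by auto
  define b where "b = from_nat_into (insert UNIV \<B>)"
  have rb: "range b = insert UNIV \<B>"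
    unfolding b_def by (rule range_from_nat_into) (use B in auto)
  have "open (b i)" for i
    using rb topological_basis_open[OF B(2)] rangeI[of b i] by auto
  moreover have "\<exists>i. x \<in> b i \<and> y \<notin> b i" if neq: "x \<noteq> y" for x y
  proof -
    obtain U where "open U" "x \<in> U" "y \<notin> U" using t1_space[OF neq] by blast
    then obtain V where "V \<in> \<B>" "x \<in> V" "V \<subseteq> U" using topological_basisE[OF B(2)] by metis
    moreover have "V \<in> range b" using rb \<open>V \<in> \<B>\<close> by simp
    ultimately show ?thesis using \<open>y \<notin> U\<close> by auto
  qed
  ultimately show thesis using that by blast
qed

text \<open>A finite integer-valued measure without atoms must be zero: among the sets of positive mass one of
  minimal mass cannot be split, so from each set of a separating sequence either the part inside or
  the part outside has mass 0, and what survives is a single point of positive mass.\<close>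

lemma finite_simple_integer_measure_atoms:
  fixes X :: "'a::{second_countable_topology, t2_space} measure"
  assumes sets: "sets X = sets borel"
    and fin: "emeasure X UNIV < \<infinity>"
    and int: "\<And>B. B \<in> sets borel \<Longrightarrow> emeasure X B \<in> range of_nat \<union> {\<infinity>}"
    and simple: "\<And>x. emeasure X {x} \<le> 1"
  shows "\<exists>S. finite S \<and> (\<forall>B\<in>sets borel. emeasure X B = of_nat (card (S \<inter> B)))"
proof -
  have sp: "space X = UNIV" using sets_eq_imp_space_eq[OF sets] by simp
  interpret finite_measure X using fin by (intro finite_measureI) (auto simp: sp)
  have int': "\<exists>n. emeasure X B = of_nat n" if "B \<in> sets borel" for B
    using int[OF that] emeasure_finite[of B] by auto
  define S where "S = {x. emeasure X {x} = 1}"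
  have pt: "emeasure X {x} = 0" if "x \<notin> S" for x
  proof -
    obtain n where n: "emeasure X {x} = of_nat n" using int'[of "{x}"] by auto
    then have "n \<le> 1" using simple[of x] by (metis of_nat_1 of_nat_le_iff)
    then show ?thesis using n that by (cases n) (auto simp: S_def)
  qed
  have finF: "emeasure X F = of_nat (card F)" if "finite F" "F \<subseteq> S" for F
  proof -
    have "emeasure X F = (\<Sum>x\<in>F. emeasure X {x})"
      by (rule emeasure_eq_sum_singleton) (use that sets in auto)
    also have "\<dots> = (\<Sum>x\<in>F. 1)" by (rule sum.cong) (use that in \<open>auto simp: S_def\<close>)
    finally show ?thesis by simp
  qed
  have fS: "finite S"
  proof -
    obtain n where n: "emeasure X UNIV = of_nat n" using int'[of UNIV] by auto
    have "card F \<le> n" if "finite F" "F \<subseteq> S" for F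
    proof -
      have "of_nat (card F) \<le> emeasure X UNIV"
        unfolding finF[OF that, symmetric] by (rule emeasure_mono) (use sets in auto)
      then show ?thesis unfolding n by simp
    qed
    then show ?thesis using infinite_arbitrarily_large[of S "Suc n"] by (metis Suc_n_not_le_n)
  qed
  have Sm: "S \<in> sets borel" by (intro borel_closed finite_imp_closed fS)
  have rest: "emeasure X (- S) = 0"
  proof (rule ccontr)
    assume pos: "emeasure X (- S) \<noteq> 0"
    define Q where "Q n \<longleftrightarrow> (\<exists>B\<in>sets borel. B \<subseteq> - S \<and> emeasure X B = of_nat n \<and> n > 0)" for n
    obtain n0 where n0: "emeasure X (- S) = of_nat n0" using int'[of "- S"] Sm by auto
    have "Q n0" unfolding Q_def using n0 pos Sm by (intro bexI[of _ "- S"]) auto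
    define m where "m = (LEAST n. Q n)"
    have "Q m" unfolding m_def by (rule LeastI[of Q, OF \<open>Q n0\<close>])
    then obtain B where B: "B \<in> sets borel" "B \<subseteq> - S" "emeasure X B = of_nat m" "m > 0"
      unfolding Q_def by auto
    have min: "emeasure X (B \<inter> C) = 0 \<or> emeasure X (B - C) = 0" if C: "C \<in> sets borel" for C
    proof (rule ccontr)
      assume a: "\<not> ?thesis"
      obtain p where p: "emeasure X (B \<inter> C) = of_nat p" using int'[OF sets.Int[OF B(1) C]] by auto
      obtain q where q: "emeasure X (B - C) = of_nat q" using int'[OF sets.Diff[OF B(1) C]] by auto
      have "emeasure X B = emeasure X (B \<inter> C) + emeasure X (B - C)"
        using B(1) C sets by (subst plus_emeasure) (auto simp: Int_Diff_Un)
      then have "of_nat m = (of_nat (p + q) :: ennreal)" unfolding B p q by simp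
      then have "m = p + q" by (simp only: of_nat_eq_iff)
      moreover have "p > 0" "q > 0" using a p q by auto
      moreover have "Q p" unfolding Q_def using B p \<open>p > 0\<close> that by (intro bexI[of _ "B \<inter> C"]) auto
      ultimately show False using Least_le[of Q p] unfolding m_def[symmetric] by simp
    qed
    obtain b :: "nat \<Rightarrow> 'a set" where b: "\<And>i. open (b i)" "\<And>x y. x \<noteq> y \<Longrightarrow> \<exists>i. x \<in> b i \<and> y \<notin> b i"
      using separating_open_sequence[where 'a='a] by blast
    have bm: "b i \<in> sets borel" for i using b(1) by auto
    define h where "h i = (if emeasure X (B \<inter> b i) = 0 then B \<inter> b i else B - b i)" for i
    have h0: "h i \<in> null_sets X" for i
      using min[OF bm[of i]] B bm[of i] sets by (auto simp: h_def null_sets_def)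
    have un: "(\<Union>i. h i) \<in> null_sets X" by (rule null_sets_UN[OF h0])
    have "emeasure X (B - (\<Union>i. h i)) = emeasure X B"
      by (rule emeasure_Diff_null_set[OF un]) (use B sets in auto)
    then have ne: "emeasure X (B - (\<Union>i. h i)) \<noteq> 0" using B by simp
    then obtain x where x: "x \<in> B - (\<Union>i. h i)" by (metis all_not_in_conv emeasure_empty)
    have "B - (\<Union>i. h i) \<subseteq> {x}"
    proof
      fix y assume y: "y \<in> B - (\<Union>i. h i)"
      show "y \<in> {x}"
      proof (rule ccontr)
        assume "y \<notin> {x}"
        then obtain i where "x \<in> b i" "y \<notin> b i" using b(2)[of x y] by auto
        then have "x \<in> h i \<or> y \<in> h i" using x y by (auto simp: h_def)
        then show False using x y by auto
      qed
    qed
    then have "emeasure X (B - (\<Union>i. h i)) \<le> emeasure X {x}"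
      by (rule emeasure_mono) (use sets in auto)
    also have "\<dots> = 0" using pt x B by auto
    finally show False using ne by simp
  qed
  show ?thesis
  proof (intro exI[of _ S] conjI fS ballI)
    fix B :: "'a set" assume B: "B \<in> sets borel"
    have "emeasure X B = emeasure X (S \<inter> B) + emeasure X (B - S)"
      using B Sm sets by (subst plus_emeasure) (auto intro!: arg_cong[where f="emeasure X"])
    also have "emeasure X (B - S) = 0"
      using emeasure_mono[of "B - S" "- S" X] rest Sm sets by auto
    finally show "emeasure X B = of_nat (card (S \<inter> B))"
      using fS by (simp add: finF)
  qed
qed

text \<open>The label of \<open>x\<close> in the partition generated by the first \<open>m\<close> sets of the sequence. The partitions
  are finite, become finer with \<open>m\<close>, and eventually separate any two points if the sequence does.\<close>

definition cell :: "(nat \<Rightarrow> 'a set) \<Rightarrow> nat \<Rightarrow> 'a \<Rightarrow> nat set" where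
  "cell b m x = {i. i < m \<and> x \<in> b i}"

lemma cell_measurable:
  assumes "\<And>i. b i \<in> sets borel"
  shows "cell b m -` {a} \<in> sets borel"
proof -
  have "cell b m -` {a} = (\<Inter>i. if i < m then (if i \<in> a then b i else - b i) else (if i \<in> a then {} else UNIV))"
  proof (rule Set.set_eqI)
    fix x
    have 1: "cell b m x = a \<longleftrightarrow> (\<forall>i. (i < m \<and> x \<in> b i) \<longleftrightarrow> i \<in> a)"
      unfolding cell_def set_eq_iff by simp
    have 2: "x \<in> (if i < m then (if i \<in> a then b i else - b i) else (if i \<in> a then {} else UNIV)) \<longleftrightarrow>
      ((i < m \<and> x \<in> b i) \<longleftrightarrow> i \<in> a)" for i
      by simp
    show "x \<in> cell b m -` {a} \<longleftrightarrow>
      x \<in> (\<Inter>i. if i < m then (if i \<in> a then b i else - b i) else (if i \<in> a then {} else UNIV))"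
      unfolding INT_iff vimage_singleton_eq 1 2 by simp
  qed
  also have "\<dots> \<in> sets borel"
    using assms by (intro sets.countable_INT) auto
  finally show ?thesis .
qed

lemma cell_mono_neq:
  assumes "cell b m x \<noteq> cell b m y" "m \<le> m'"
  shows "cell b m' x \<noteq> cell b m' y"
proof
  assume "cell b m' x = cell b m' y"
  then have "cell b m' x \<inter> {..<m} = cell b m' y \<inter> {..<m}" by simp
  moreover have "cell b m' z \<inter> {..<m} = cell b m z" for z using assms(2) by (auto simp: cell_def)
  ultimately show False using assms(1) by simp
qed

lemma eventually_cell_inj_on:
  fixes x :: "nat \<Rightarrow> 'a"
  assumes b: "\<And>x y. x \<noteq> y \<Longrightarrow> \<exists>i. x \<in> b i \<and> y \<notin> b i"
    and x: "inj_on x {..<n}"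
  shows "eventually (\<lambda>m. inj_on (\<lambda>j. cell b m (x j)) {..<n}) sequentially"
proof -
  have "eventually (\<lambda>m. \<forall>i\<in>{..<n}. \<forall>j\<in>{..<n}. i \<noteq> j \<longrightarrow> cell b m (x i) \<noteq> cell b m (x j)) sequentially"
  proof (intro eventually_ball_finite finite_lessThan ballI)
    fix i j assume ij: "i \<in> {..<n}" "j \<in> {..<n}"
    show "eventually (\<lambda>m. i \<noteq> j \<longrightarrow> cell b m (x i) \<noteq> cell b m (x j)) sequentially"
    proof (cases "i = j")
      case False
      then have "x i \<noteq> x j" using x ij by (auto simp: inj_on_def)
      then obtain k where k: "x i \<in> b k" "x j \<notin> b k" using b by blast
      show ?thesis
      proof (rule eventually_sequentiallyI[of "Suc k"], rule impI)
        fix m assume "Suc k \<le> m"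
        then have "k \<in> cell b m (x i)" "k \<notin> cell b m (x j)" using k by (simp_all add: cell_def)
        then show "cell b m (x i) \<noteq> cell b m (x j)" by metis
      qed
    qed simp
  qed
  then show ?thesis by eventually_elim (auto simp: inj_on_def)
qed

definition injective_labels :: "nat \<Rightarrow> nat \<Rightarrow> (nat \<Rightarrow> nat set) set" where
  "injective_labels n m = {a \<in> {..<n} \<rightarrow>\<^sub>E Pow {..<m}. inj_on a {..<n}}"

lemma finite_injective_labels [simp]: "finite (injective_labels n m)"
  unfolding injective_labels_def by (intro finite_Collect_conjI disjI1) (simp add: finite_PiE)

text \<open>A tuple with pairwise different labels lies in exactly one of the boxes, the one that its own
  labels determine.\<close>

lemma sum_indicator_cells:
  assumes x: "x \<in> extensional {..<n}"
  shows "(\<Sum>a\<in>injective_labels n m. indicator (\<Pi>\<^sub>E j\<in>{..<n}. cell b m -` {a j} \<inter> B j) x) =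
    (indicator {x. (\<forall>j<n. x j \<in> B j) \<and> inj_on (\<lambda>j. cell b m (x j)) {..<n}} x :: 'c::semiring_1)"
proof -
  let ?a = "restrict (\<lambda>j. cell b m (x j)) {..<n}"
  have "(\<Sum>a\<in>injective_labels n m. indicator (\<Pi>\<^sub>E j\<in>{..<n}. cell b m -` {a j} \<inter> B j) x) =
    (\<Sum>a\<in>injective_labels n m. if a = ?a then (if \<forall>j<n. x j \<in> B j then 1 else 0) else (0::'c))"
  proof (rule sum.cong[OF refl])
    fix a assume a: "a \<in> injective_labels n m"
    have "a = ?a \<longleftrightarrow> (\<forall>j<n. cell b m (x j) = a j)"
      using a by (auto simp: injective_labels_def PiE_iff extensional_def fun_eq_iff)
    then show "indicator (\<Pi>\<^sub>E j\<in>{..<n}. cell b m -` {a j} \<inter> B j) x =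
      (if a = ?a then (if \<forall>j<n. x j \<in> B j then 1 else 0) else (0::'c))"
      using x by (auto simp: indicator_def PiE_iff)
  qed
  also have "\<dots> = (if ?a \<in> injective_labels n m then (if \<forall>j<n. x j \<in> B j then 1 else 0) else 0)"
    by (subst sum.delta) auto
  also have "?a \<in> injective_labels n m \<longleftrightarrow> inj_on (\<lambda>j. cell b m (x j)) {..<n}"
    by (auto simp: injective_labels_def cell_def inj_on_def)
  finally show ?thesis by (auto simp: indicator_def)
qed

lemma sum_prod_card_cells:
  assumes S: "finite S"
  shows "(\<Sum>a\<in>injective_labels n m. \<Prod>j<n. card (S \<inter> (cell b m -` {a j} \<inter> B j))) =
    card {x \<in> {..<n} \<rightarrow>\<^sub>E S. (\<forall>j<n. x j \<in> B j) \<and> inj_on (\<lambda>j. cell b m (x j)) {..<n}}"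
proof -
  let ?T = "{..<n} \<rightarrow>\<^sub>E S"
  let ?E = "\<lambda>a. \<Pi>\<^sub>E j\<in>{..<n}. cell b m -` {a j} \<inter> B j"
  have fT: "finite ?T" by (simp add: S finite_PiE)
  have "(\<Sum>a\<in>injective_labels n m. \<Prod>j<n. card (S \<inter> (cell b m -` {a j} \<inter> B j))) =
    (\<Sum>a\<in>injective_labels n m. \<Sum>x\<in>?T. indicator (?E a) x)"
  proof (rule sum.cong[OF refl])
    fix a
    have "(\<Prod>j<n. card (S \<inter> (cell b m -` {a j} \<inter> B j))) = card (\<Pi>\<^sub>E j\<in>{..<n}. S \<inter> (cell b m -` {a j} \<inter> B j))"
      by (simp add: card_PiE)
    also have "(\<Pi>\<^sub>E j\<in>{..<n}. S \<inter> (cell b m -` {a j} \<inter> B j)) = ?T \<inter> ?E a"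
      by (auto simp: PiE_iff)
    also have "card (?T \<inter> ?E a) = (\<Sum>x\<in>?T. indicator (?E a) x)"
      using fT by (simp add: sum_indicator_eq_card)
    finally show "(\<Prod>j<n. card (S \<inter> (cell b m -` {a j} \<inter> B j))) = (\<Sum>x\<in>?T. indicator (?E a) x)" .
  qed
  also have "\<dots> = (\<Sum>x\<in>?T. \<Sum>a\<in>injective_labels n m. indicator (?E a) x)"
    by (rule sum.swap)
  also have "\<dots> = (\<Sum>x\<in>?T. indicator {x. (\<forall>j<n. x j \<in> B j) \<and> inj_on (\<lambda>j. cell b m (x j)) {..<n}} x)"
    by (intro sum.cong refl sum_indicator_cells) (auto simp: PiE_iff)
  also have "\<dots> = card (?T \<inter> {x. (\<forall>j<n. x j \<in> B j) \<and> inj_on (\<lambda>j. cell b m (x j)) {..<n}})"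
    using fT by (simp add: sum_indicator_eq_card)
  finally show ?thesis by (simp add: Int_def)
qed

text \<open>The mass as a natural number. It is 0 for infinite mass, which occurs with probability 0 below.\<close>

definition count_in :: "'a measure \<Rightarrow> 'a set \<Rightarrow> nat" where
  "count_in X A = nat \<lfloor>measure X A\<rfloor>"

text \<open>Joint intensities speak about products of masses of disjoint sets only. Summing over tuples of
  distinct cells of the \<open>m\<close>-th partition counts the tuples of points which that partition separates;
  as \<open>m\<close> grows these become all tuples of distinct points, and monotone convergence applies on both
  sides. On the right the limit misses the tuples with repetitions, where the intensity is 0.\<close>

theorem falling_moment_joint_intensity:
  fixes X :: "'w \<Rightarrow> 'a::polish_space measure" and D :: "'r \<Rightarrow> 'a set"
  assumes pp: "point_process M X" and simple: "simple_process M X"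
    and fin: "AE \<omega> in M. emeasure (X \<omega>) UNIV < \<infinity>"
    and ji: "joint_intensities M X \<mu> \<rho>" and \<mu>: "sets \<mu> = sets borel"
    and D: "\<And>i. D i \<in> sets borel" "disjoint_family D" and n: "n \<ge> 1"
    and van: "\<And>x. x \<in> extensional {..<n} \<Longrightarrow> \<not> inj_on x {..<n} \<Longrightarrow> \<rho> n x = 0"
  shows "(\<integral>\<^sup>+\<omega>. of_nat (falling_moment (\<lambda>i. count_in (X \<omega>) (D i)) n f) \<partial>M) =
    (\<integral>\<^sup>+x\<in>(\<Pi>\<^sub>E j\<in>{..<n}. D (f j)). ennreal (\<rho> n x) \<partial>Pi\<^sub>M {..<n} (\<lambda>_. \<mu>))"
proof -
  let ?P = "Pi\<^sub>M {..<n} (\<lambda>_. \<mu>)"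
  obtain b :: "nat \<Rightarrow> 'a set" where b: "\<And>i. open (b i)" "\<And>x y. x \<noteq> y \<Longrightarrow> \<exists>i. x \<in> b i \<and> y \<notin> b i"
    by (rule separating_open_sequence) auto
  have bm: "b i \<in> sets borel" for i using b(1) by auto
  define E where "E m a j = cell b m -` {a j} \<inter> D (f j)" for m a j
  have Em: "E m a j \<in> sets borel" for m a j
    unfolding E_def by (intro sets.Int cell_measurable bm D)
  define Z where "Z m \<omega> = (\<Sum>a\<in>injective_labels n m. \<Prod>j<n. emeasure (X \<omega>) (E m a j))" for m \<omega>
  have Xm[measurable]: "(\<lambda>\<omega>. emeasure (X \<omega>) B) \<in> borel_measurable M" if "B \<in> sets borel" for B
    using pp that unfolding point_process_def by blast
  have Zm: "Z m \<in> borel_measurable M" for m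
    unfolding Z_def by (intro borel_measurable_sum borel_measurable_prod_ennreal Xm Em)
  have good: "AE \<omega> in M. \<exists>S. finite S \<and> (\<forall>B\<in>sets borel. emeasure (X \<omega>) B = of_nat (card (S \<inter> B)))"
    using fin simple[unfolded simple_process_def] AE_space
  proof eventually_elim
    case (elim \<omega>)
    have rm: "radon_measure (X \<omega>) \<and> (\<forall>B\<in>sets borel. emeasure (X \<omega>) B \<in> range of_nat \<union> {\<infinity>})"
      using pp elim(3) unfolding point_process_def by blast
    have sets: "sets (X \<omega>) = sets borel"
      using conjunct1[OF rm] unfolding radon_measure_def by (rule conjunct1)
    show ?case
      by (rule finite_simple_integer_measure_atoms[OF sets elim(1) bspec[OF conjunct2[OF rm]] spec[OF elim(2)]])
  qed
  define T where "T S m = {x \<in> {..<n} \<rightarrow>\<^sub>E S. (\<forall>j<n. x j \<in> D (f j)) \<and> inj_on (\<lambda>j. cell b m (x j)) {..<n}}" for S m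
  define TI where "TI S = {x \<in> {..<n} \<rightarrow>\<^sub>E S. (\<forall>j<n. x j \<in> D (f j)) \<and> inj_on x {..<n}}" for S
  have fTI: "finite (TI S)" if "finite S" for S
    unfolding TI_def using that by (intro finite_Collect_conjI disjI1) (simp add: finite_PiE)
  have T_sub: "T S m \<subseteq> T S m'" if "m \<le> m'" for S m m'
  proof
    fix x assume x: "x \<in> T S m"
    have "inj_on (\<lambda>j. cell b m' (x j)) {..<n}"
    proof (rule inj_onI)
      fix i j assume ij: "i \<in> {..<n}" "j \<in> {..<n}" "cell b m' (x i) = cell b m' (x j)"
      then have "cell b m (x i) = cell b m (x j)" using cell_mono_neq[OF _ that, of b "x i" "x j"] by blast
      then show "i = j" using x ij unfolding T_def by (auto dest: inj_onD)
    qed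
    then show "x \<in> T S m'" using x by (simp add: T_def)
  qed
  have T_TI: "T S m \<subseteq> TI S" for S m
  proof
    fix x assume x: "x \<in> T S m"
    then have "inj_on (cell b m \<circ> x) {..<n}" by (simp add: T_def o_def)
    then have "inj_on x {..<n}" by (rule inj_on_imageI2)
    then show "x \<in> TI S" using x by (simp add: T_def TI_def)
  qed
  have ZT: "Z m \<omega> = of_nat (card (T S m))"
    if "finite S" "\<forall>B\<in>sets borel. emeasure (X \<omega>) B = of_nat (card (S \<inter> B))" for S m \<omega>
    unfolding Z_def T_def using that(2) Em
    by (subst sum_prod_card_cells[OF that(1), where n=n and m=m and b=b and B="\<lambda>j. D (f j)", symmetric]) (simp add: E_def)
  define sep where "sep m = {x. (\<forall>j<n. x j \<in> D (f j)) \<and> inj_on (\<lambda>j. cell b m (x j)) {..<n}}" for m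
  have "(\<integral>\<^sup>+\<omega>. of_nat (falling_moment (\<lambda>i. count_in (X \<omega>) (D i)) n f) \<partial>M) = (\<integral>\<^sup>+\<omega>. (SUP m. Z m \<omega>) \<partial>M)"
  proof (rule nn_integral_cong_AE, use good in eventually_elim)
    case (elim \<omega>)
    then obtain S where S: "finite S" "\<forall>B\<in>sets borel. emeasure (X \<omega>) B = of_nat (card (S \<inter> B))" by auto
    have cnt: "count_in (X \<omega>) (D i) = card (S \<inter> D i)" for i
      using S(2) D(1)[of i] by (simp add: count_in_def measure_def)
    have "eventually (\<lambda>m. \<forall>x\<in>TI S. inj_on (\<lambda>j. cell b m (x j)) {..<n}) sequentially"
      by (intro eventually_ball_finite fTI S(1) ballI eventually_cell_inj_on b(2)) (auto simp: TI_def)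
    then obtain m0 where m0: "\<forall>x\<in>TI S. inj_on (\<lambda>j. cell b m0 (x j)) {..<n}"
      by (auto simp: eventually_sequentially)
    have eq: "T S m0 = TI S" using m0 T_TI[of S m0] by (auto simp: T_def TI_def)
    have "(SUP m. Z m \<omega>) = of_nat (card (TI S))"
    proof (rule antisym)
      show "(SUP m. Z m \<omega>) \<le> of_nat (card (TI S))"
        by (rule SUP_least) (simp add: ZT[OF S] card_mono[OF fTI[OF S(1)] T_TI])
      show "of_nat (card (TI S)) \<le> (SUP m. Z m \<omega>)"
        by (rule SUP_upper2[of m0]) (simp_all add: ZT[OF S] eq)
    qed
    then show ?case
      unfolding TI_def card_injective_tuples[OF S(1) D(2)] cnt by simp
  qed
  also have "\<dots> = (SUP m. integral\<^sup>N M (Z m))"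
  proof (rule nn_integral_monotone_convergence_SUP_AE)
    fix m
    show "Z m \<in> borel_measurable M" by (rule Zm)
    show "AE \<omega> in M. Z m \<omega> \<le> Z (Suc m) \<omega>"
      using good
    proof eventually_elim
      case (elim \<omega>)
      then obtain S where S: "finite S" "\<forall>B\<in>sets borel. emeasure (X \<omega>) B = of_nat (card (S \<inter> B))" by auto
      have "finite (T S (Suc m))" using finite_subset[OF T_TI fTI[OF S(1)]] .
      then show ?case using T_sub[of m "Suc m" S] by (simp add: ZT[OF S] card_mono)
    qed
  qed
  also have "\<dots> = (SUP m. \<integral>\<^sup>+x. indicator (sep m) x * ennreal (\<rho> n x) \<partial>?P)"
  proof (rule SUP_cong[OF refl])
    fix m
    have [measurable]: "\<rho> n \<in> borel_measurable ?P"
      using ji n unfolding joint_intensities_def by blast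
    have [measurable]: "(\<Pi>\<^sub>E j\<in>{..<n}. E m a j) \<in> sets ?P" for a
      by (intro sets_PiM_I_finite) (auto simp: \<mu> Em)
    have "integral\<^sup>N M (Z m) = (\<Sum>a\<in>injective_labels n m. \<integral>\<^sup>+\<omega>. (\<Prod>j<n. emeasure (X \<omega>) (E m a j)) \<partial>M)"
      unfolding Z_def by (rule nn_integral_sum) (intro borel_measurable_prod_ennreal Xm Em)
    also have "\<dots> = (\<Sum>a\<in>injective_labels n m. \<integral>\<^sup>+x\<in>(\<Pi>\<^sub>E j\<in>{..<n}. E m a j). ennreal (\<rho> n x) \<partial>?P)"
    proof (rule sum.cong[OF refl])
      fix a assume a: "a \<in> injective_labels n m"
      have "disjoint_family_on (E m a) {..<n}"
        using a unfolding disjoint_family_on_def E_def injective_labels_def inj_on_def by auto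
      then show "(\<integral>\<^sup>+\<omega>. (\<Prod>j<n. emeasure (X \<omega>) (E m a j)) \<partial>M) = (\<integral>\<^sup>+x\<in>(\<Pi>\<^sub>E j\<in>{..<n}. E m a j). ennreal (\<rho> n x) \<partial>?P)"
        using ji n Em unfolding joint_intensities_def by blast
    qed
    also have "\<dots> = (\<integral>\<^sup>+x. (\<Sum>a\<in>injective_labels n m. ennreal (\<rho> n x) * indicator (\<Pi>\<^sub>E j\<in>{..<n}. E m a j) x) \<partial>?P)"
      by (rule nn_integral_sum[symmetric]) measurable
    also have "\<dots> = (\<integral>\<^sup>+x. indicator (sep m) x * ennreal (\<rho> n x) \<partial>?P)"
    proof (rule nn_integral_cong)
      fix x assume "x \<in> space ?P"
      then have "x \<in> extensional {..<n}" by (auto simp: space_PiM PiE_iff)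
      then show "(\<Sum>a\<in>injective_labels n m. ennreal (\<rho> n x) * indicator (\<Pi>\<^sub>E j\<in>{..<n}. E m a j) x) =
        indicator (sep m) x * ennreal (\<rho> n x)"
        unfolding sum_distrib_left[symmetric] E_def sep_def by (subst sum_indicator_cells) (auto simp: mult.commute)
    qed
    finally show "integral\<^sup>N M (Z m) = \<dots>" .
  qed
  also have "\<dots> = (\<integral>\<^sup>+x. (SUP m. indicator (sep m) x * ennreal (\<rho> n x)) \<partial>?P)"
  proof (rule nn_integral_monotone_convergence_SUP[symmetric])
    show "incseq (\<lambda>m x. indicator (sep m) x * ennreal (\<rho> n x))"
    proof (intro incseq_SucI le_funI mult_right_mono)
      fix m x
      show "indicator (sep m) x \<le>
        (indicator (sep (Suc m)) x :: ennreal)"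
      proof -
        have "cell b (Suc m) u = cell b (Suc m) v \<Longrightarrow> cell b m u = cell b m v" for u v
          using cell_mono_neq[of b m u v "Suc m"] by auto
        then have "inj_on (\<lambda>j. cell b m (x j)) {..<n} \<Longrightarrow> inj_on (\<lambda>j. cell b (Suc m) (x j)) {..<n}"
          unfolding inj_on_def by blast
        then show ?thesis by (auto simp: indicator_def sep_def)
      qed
    qed simp
    fix m
    have [measurable]: "\<rho> n \<in> borel_measurable ?P"
      using ji n unfolding joint_intensities_def by blast
    have [measurable]: "(\<Pi>\<^sub>E j\<in>{..<n}. E m a j) \<in> sets ?P" for a
      by (intro sets_PiM_I_finite) (auto simp: \<mu> Em)
    have "(\<lambda>x. (\<Sum>a\<in>injective_labels n m. indicator (\<Pi>\<^sub>E j\<in>{..<n}. E m a j) x) * ennreal (\<rho> n x)) \<in> borel_measurable ?P"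
      by measurable
    then show "(\<lambda>x. indicator (sep m) x * ennreal (\<rho> n x)) \<in> borel_measurable ?P"
      by (subst measurable_cong) (auto simp: E_def sep_def space_PiM PiE_iff sum_indicator_cells[symmetric])
  qed
  also have "\<dots> = (\<integral>\<^sup>+x\<in>(\<Pi>\<^sub>E j\<in>{..<n}. D (f j)). ennreal (\<rho> n x) \<partial>?P)"
  proof (rule nn_integral_cong)
    fix x assume "x \<in> space ?P"
    then have x: "x \<in> extensional {..<n}" by (auto simp: space_PiM PiE_iff)
    show "(SUP m. indicator (sep m) x * ennreal (\<rho> n x)) =
      ennreal (\<rho> n x) * indicator (\<Pi>\<^sub>E j\<in>{..<n}. D (f j)) x"
    proof (cases "inj_on x {..<n} \<and> (\<forall>j<n. x j \<in> D (f j))")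
      case True
      then obtain m0 where m0: "inj_on (\<lambda>j. cell b m0 (x j)) {..<n}"
        using eventually_cell_inj_on[of b x n] b(2) by (auto simp: eventually_sequentially)
      have "(SUP m. indicator (sep m) x * ennreal (\<rho> n x)) = ennreal (\<rho> n x)"
      proof (rule antisym)
        show "(SUP m. indicator (sep m) x * ennreal (\<rho> n x)) \<le> ennreal (\<rho> n x)"
          by (rule SUP_least) (auto simp: indicator_def)
        show "ennreal (\<rho> n x) \<le> (SUP m. indicator (sep m) x * ennreal (\<rho> n x))"
          by (rule SUP_upper2[of m0]) (use True m0 in \<open>auto simp: sep_def\<close>)
      qed
      then show ?thesis using True x by (simp add: indicator_def PiE_iff)
    next
      case False
      show ?thesis
      proof (cases "\<forall>j<n. x j \<in> D (f j)")
        case True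
        then have "\<rho> n x = 0" using van[OF x] False by blast
        then show ?thesis by simp
      next
        case out: False
        then have "x \<notin> (\<Pi>\<^sub>E j\<in>{..<n}. D (f j))" by (auto simp: PiE_iff)
        moreover have "x \<notin> sep m" for m
          using out by (auto simp: sep_def)
        ultimately show ?thesis by simp
      qed
    qed
  qed
  finally show ?thesis .
qed

section \<open>Factorial moments determine the law\<close>

lemma binomial_times_fact_Suc: "fact (Suc m) * (N choose Suc m) = (N - m) * (fact m * (N choose m))"
proof -
  have "Suc m * (N choose Suc m) = (N - m) * (N choose m)"
    unfolding binomial_absorption binomial_absorb_comp by simp
  then have "fact m * (Suc m * (N choose Suc m)) = fact m * ((N - m) * (N choose m))" by simp
  then show ?thesis by (simp only: fact_Suc of_nat_id mult_ac)
qed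

lemma falling_moment_binomial:
  fixes N :: "'r::finite \<Rightarrow> nat"
  shows "falling_moment N n f = (\<Prod>i\<in>UNIV. fact (card {j. j < n \<and> f j = i}) * (N i choose card {j. j < n \<and> f j = i}))"
proof (induction n)
  case 0
  then show ?case by (simp add: falling_moment_def)
next
  case (Suc n)
  define k where "k n i = card {j. j < n \<and> f j = i}" for n i
  have k: "k (Suc n) i = (if i = f n then Suc (k n i) else k n i)" for i
  proof -
    have "{j. j < Suc n \<and> f j = i} = (if i = f n then insert n {j. j < n \<and> f j = i} else {j. j < n \<and> f j = i})"
      by (auto simp: less_Suc_eq)
    then show ?thesis by (simp add: k_def)
  qed
  define F where "F j i = fact j * (N i choose j)" for j i
  have "(\<Prod>i\<in>UNIV. F (k (Suc n) i) i) = F (Suc (k n (f n))) (f n) * (\<Prod>i\<in>UNIV - {f n}. F (k n i) i)"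
    by (subst prod.remove[of UNIV "f n"]) (auto simp: k intro!: prod.cong)
  also have "\<dots> = (N (f n) - k n (f n)) * (F (k n (f n)) (f n) * (\<Prod>i\<in>UNIV - {f n}. F (k n i) i))"
    unfolding F_def binomial_times_fact_Suc by simp
  also have "F (k n (f n)) (f n) * (\<Prod>i\<in>UNIV - {f n}. F (k n i) i) = (\<Prod>i\<in>UNIV. F (k n i) i)"
    by (rule prod.remove[symmetric]) auto
  finally show ?case using Suc unfolding falling_moment_def k_def F_def by simp
qed

text \<open>Every product of falling factorials occurs as a \<open>falling_moment\<close>.\<close>

lemma ex_tuple_with_multiplicities:
  fixes m :: "'r::finite \<Rightarrow> nat"
  shows "\<exists>(n::nat) f. \<forall>i. card {j. j < n \<and> f j = i} = m i"
proof -
  obtain xs where xs: "mset xs = Abs_multiset m" using ex_mset by blast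
  have "count_list xs i = m i" for i
    using arg_cong[OF xs, of "\<lambda>M. count M i"] by (simp add: count_mset count_Abs_multiset)
  then have "card {j. j < length xs \<and> xs ! j = i} = m i" for i
    using count_list_eq_length_filter[of xs i] length_filter_conv_card[of "(=) i" xs]
    by (simp add: eq_commute)
  then show ?thesis by (intro exI[of _ "length xs"] exI[of _ "(!) xs"]) simp
qed

text \<open>Binomial inversion: the number of points is recovered from its binomial moments, by
  \<open>(N choose t) (t choose n) = (N choose n) (N - n choose t - n)\<close> and the vanishing of alternating row
  sums of Pascal's triangle.\<close>

lemma binomial_inversion:
  "(\<Sum>t\<le>N. (-1) ^ (t + n) * int (t choose n) * int (N choose t)) = of_bool (N = n)"
proof (cases "n \<le> N")
  case False
  then have "(\<Sum>t\<le>N. (-1) ^ (t + n) * int (t choose n) * int (N choose t)) = 0"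
    by (intro sum.neutral) (auto simp: binomial_eq_0)
  then show ?thesis using False by auto
next
  case True
  have "(\<Sum>t\<le>N. (-1) ^ (t + n) * int (t choose n) * int (N choose t)) =
    (\<Sum>t\<in>{n..N}. (-1) ^ (t + n) * int (t choose n) * int (N choose t))"
    by (rule sum.mono_neutral_right) (auto simp: binomial_eq_0)
  also have "\<dots> = (\<Sum>s\<in>{0..N-n}. (-1) ^ s * (int (N choose n) * int (N - n choose s)))"
  proof (rule sum.reindex_bij_witness[of _ "\<lambda>s. s + n" "\<lambda>t. t - n"])
    fix t assume t: "t \<in> {n..N}"
    have "(-1::int) ^ (t + n) = (-1) ^ (t - n)"
      using t by (auto simp: minus_one_power_iff)
    moreover have "int (t choose n) * int (N choose t) = int (N choose n) * int (N - n choose (t - n))"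
      using choose_mult[of n t N] t by (simp add: mult.commute flip: of_nat_mult)
    ultimately show "(-1) ^ (t - n) * (int (N choose n) * int (N - n choose (t - n))) = (-1) ^ (t + n) * int (t choose n) * int (N choose t)"
      by simp
  qed (use True in auto)
  also have "\<dots> = int (N choose n) * (\<Sum>s\<le>N-n. (-1) ^ s * of_nat (N - n choose s))"
    by (simp add: sum_distrib_left mult_ac atLeast0AtMost)
  also have "\<dots> = of_bool (N = n)"
    using choose_alternating_sum[of "N - n", where ?'a=int] True by (cases "N = n") auto
  finally show ?thesis .
qed

text \<open>The inversion in several variables for a target \<open>n\<close>. Expectations are taken in \<open>[0,\<infinity>]\<close>, so
  the terms of positive and negative sign are kept on different sides of the equation.\<close>

context
  fixes n :: "'r::finite \<Rightarrow> nat"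
begin

definition even_gap :: "('r \<Rightarrow> nat) \<Rightarrow> bool" where
  "even_gap m \<longleftrightarrow> even (\<Sum>i\<in>UNIV. m i + n i)"

definition inversion_term :: "('r \<Rightarrow> nat) \<Rightarrow> ('r \<Rightarrow> nat) \<Rightarrow> nat" where
  "inversion_term N m = (\<Prod>i\<in>UNIV. (m i choose n i) * (N i choose m i))"

definition below :: "('r \<Rightarrow> nat) \<Rightarrow> ('r \<Rightarrow> nat) set" where
  "below N = (\<Pi>\<^sub>E i\<in>UNIV. {..N i})"

lemma finite_below [simp]: "finite (below N)" by (simp add: below_def finite_PiE)

lemma inversion_term_outside: "m \<notin> below N \<Longrightarrow> inversion_term N m = 0"
  unfolding below_def inversion_term_def by (auto intro!: prod_zero simp: PiE_iff binomial_eq_0 not_le)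

lemma inversion_int: "(\<Sum>m\<in>below N. (if even_gap m then 1 else -1) * int (inversion_term N m)) = of_bool (N = n)"
proof -
  have "(\<Sum>m\<in>below N. (if even_gap m then 1 else -1) * int (inversion_term N m)) =
    (\<Sum>m\<in>below N. \<Prod>i\<in>UNIV. (-1) ^ (m i + n i) * int (m i choose n i) * int (N i choose m i))"
  proof (rule sum.cong[OF refl])
    fix m
    have "(if even_gap m then 1 else -1) = (\<Prod>i\<in>UNIV. (-1::int) ^ (m i + n i))"
      unfolding even_gap_def power_sum[symmetric] by (simp add: minus_one_power_iff)
    then show "(if even_gap m then 1 else -1) * int (inversion_term N m) = (\<Prod>i\<in>UNIV. (-1) ^ (m i + n i) * int (m i choose n i) * int (N i choose m i))"
      by (simp add: inversion_term_def prod.distrib mult.assoc)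
  qed
  also have "\<dots> = (\<Prod>i\<in>UNIV. \<Sum>t\<le>N i. (-1) ^ (t + n i) * int (t choose n i) * int (N i choose t))"
    unfolding below_def by (rule prod_sum_PiE[symmetric]) auto
  also have "\<dots> = (\<Prod>i\<in>UNIV. of_bool (N i = n i))"
    unfolding binomial_inversion ..
  also have "\<dots> = of_bool (N = n)"
    by (auto simp: fun_eq_iff of_bool_def intro!: prod_zero)
  finally show ?thesis .
qed

lemma inversion_nat:
  "of_bool (N = n) + (\<Sum>m | m \<in> below N \<and> \<not> even_gap m. inversion_term N m) = (\<Sum>m | m \<in> below N \<and> even_gap m. inversion_term N m)"
proof -
  have "(\<Sum>m\<in>below N. (if even_gap m then 1 else -1) * int (inversion_term N m)) =
    (\<Sum>m\<in>below N. (if even_gap m then int (inversion_term N m) else 0) - (if \<not> even_gap m then int (inversion_term N m) else 0))"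
    by (rule sum.cong) auto
  also have "\<dots> = int (\<Sum>m | m \<in> below N \<and> even_gap m. inversion_term N m) - int (\<Sum>m | m \<in> below N \<and> \<not> even_gap m. inversion_term N m)"
    by (simp add: sum_subtractf sum.inter_filter of_nat_sum if_distrib[of int] cong: if_cong)
  finally have "int (of_bool (N = n) + (\<Sum>m | m \<in> below N \<and> \<not> even_gap m. inversion_term N m)) = int (\<Sum>m | m \<in> below N \<and> even_gap m. inversion_term N m)"
    unfolding inversion_int by (simp del: of_nat_sum)
  then show ?thesis by (simp only: of_nat_eq_iff)
qed

text \<open>One factor \<open>2 ^ N i\<close> bounds the weights \<open>m i choose n i\<close>, the other is the sum of a row of
  Pascal's triangle.\<close>

lemma sum_inversion_term_le: "(\<Sum>m\<in>below N. inversion_term N m) \<le> (\<Prod>i\<in>UNIV. 4 ^ N i)"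
proof -
  have "(\<Sum>m\<in>below N. inversion_term N m) = (\<Prod>i\<in>UNIV. \<Sum>t\<le>N i. (t choose n i) * (N i choose t))"
    unfolding below_def inversion_term_def by (rule prod_sum_PiE[symmetric]) auto
  also have "\<dots> \<le> (\<Prod>i\<in>UNIV. 4 ^ N i)"
  proof (intro prod_mono conjI)
    fix i
    have "(\<Sum>t\<le>N i. (t choose n i) * (N i choose t)) \<le> (\<Sum>t\<le>N i. 2 ^ N i * (N i choose t))"
    proof (intro sum_mono mult_right_mono)
      fix t assume "t \<in> {..N i}"
      have "t choose n i \<le> 2 ^ t" by (rule binomial_le_pow2)
      also have "\<dots> \<le> 2 ^ N i" using \<open>t \<in> {..N i}\<close> by (intro power_increasing) auto
      finally show "t choose n i \<le> 2 ^ N i" .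
    qed simp
    also have "\<dots> = 2 ^ N i * 2 ^ N i"
      by (simp add: sum_distrib_left[symmetric] choose_row_sum)
    also have "\<dots> = 4 ^ N i" by (simp flip: power_mult_distrib)
    finally show "(\<Sum>t\<le>N i. (t choose n i) * (N i choose t)) \<le> 4 ^ N i" .
  qed simp
  finally show ?thesis .
qed

lemma nn_integral_inversion_term:
  "(\<integral>\<^sup>+m. (if P m then of_nat (inversion_term N m) else 0) \<partial>count_space UNIV) = of_nat (\<Sum>m | m \<in> below N \<and> P m. inversion_term N m)"
proof -
  have "(\<integral>\<^sup>+m. (if P m then of_nat (inversion_term N m) else 0) \<partial>count_space UNIV) = (\<Sum>m\<in>below N. (if P m then of_nat (inversion_term N m) else 0))"
    by (rule nn_integral_count_space'[OF finite_below]) (auto simp: inversion_term_outside)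
  also have "\<dots> = of_nat (\<Sum>m | m \<in> below N \<and> P m. inversion_term N m)"
    by (simp add: sum.inter_filter of_nat_sum if_distrib cong: if_cong)
  finally show ?thesis .
qed

lemma expectation_inversion_term:
  assumes "prob_space M" and N: "N \<in> measurable M (count_space UNIV)"
  shows "(\<integral>\<^sup>+\<omega>. of_nat (\<Sum>m | m \<in> below (N \<omega>) \<and> P m. inversion_term (N \<omega>) m) \<partial>M) =
    (\<integral>\<^sup>+m. (if P m then of_nat (\<Prod>i\<in>UNIV. m i choose n i) * (\<integral>\<^sup>+\<omega>. of_nat (\<Prod>i\<in>UNIV. N \<omega> i choose m i) \<partial>M) else 0) \<partial>count_space UNIV)"
proof -
  interpret prob_space M by fact
  interpret C: sigma_finite_measure "count_space (UNIV :: ('r \<Rightarrow> nat) set)"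
    by (rule sigma_finite_measure_count_space_countable) simp
  interpret P: pair_sigma_finite "count_space (UNIV :: ('r \<Rightarrow> nat) set)" M ..
  have meas: "(\<lambda>p. (\<lambda>m \<omega>. (if P m then of_nat (inversion_term (N \<omega>) m) else 0 :: ennreal)) (fst p) (snd p)) \<in> borel_measurable (count_space UNIV \<Otimes>\<^sub>M M)"
  proof (rule measurable_compose_countable[where g=fst])
    fix m
    have "(\<lambda>N. if P m then of_nat (inversion_term N m) else 0 :: ennreal) \<circ> (N \<circ> snd) \<in> borel_measurable (count_space UNIV \<Otimes>\<^sub>M M)"
      by (intro measurable_comp[OF measurable_comp[OF measurable_snd N]]) simp
    then show "(\<lambda>p. (if P m then of_nat (inversion_term (N (snd p)) m) else 0 :: ennreal)) \<in> borel_measurable (count_space UNIV \<Otimes>\<^sub>M M)"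
      by (simp add: o_def)
  qed simp
  have "(\<integral>\<^sup>+\<omega>. of_nat (\<Sum>m | m \<in> below (N \<omega>) \<and> P m. inversion_term (N \<omega>) m) \<partial>M) =
    (\<integral>\<^sup>+\<omega>. \<integral>\<^sup>+m. (if P m then of_nat (inversion_term (N \<omega>) m) else 0) \<partial>count_space UNIV \<partial>M)"
    unfolding nn_integral_inversion_term ..
  also have "\<dots> = (\<integral>\<^sup>+m. \<integral>\<^sup>+\<omega>. (if P m then of_nat (inversion_term (N \<omega>) m) else 0) \<partial>M \<partial>count_space UNIV)"
    by (rule P.Fubini') (use meas in \<open>simp add: case_prod_beta'\<close>)
  also have "\<dots> = (\<integral>\<^sup>+m. (if P m then of_nat (\<Prod>i\<in>UNIV. m i choose n i) * (\<integral>\<^sup>+\<omega>. of_nat (\<Prod>i\<in>UNIV. N \<omega> i choose m i) \<partial>M) else 0) \<partial>count_space UNIV)"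
  proof (rule nn_integral_cong)
    fix m
    have "(\<lambda>\<omega>. of_nat (\<Prod>i\<in>UNIV. N \<omega> i choose m i) :: ennreal) \<in> borel_measurable M"
      using measurable_comp[OF N, of "\<lambda>N. of_nat (\<Prod>i\<in>UNIV. N i choose m i) :: ennreal" borel] by (simp add: o_def)
    then show "(\<integral>\<^sup>+\<omega>. (if P m then of_nat (inversion_term (N \<omega>) m) else 0) \<partial>M) =
      (if P m then of_nat (\<Prod>i\<in>UNIV. m i choose n i) * (\<integral>\<^sup>+\<omega>. of_nat (\<Prod>i\<in>UNIV. N \<omega> i choose m i) \<partial>M) else 0)"
      by (simp add: inversion_term_def prod.distrib nn_integral_cmult del: of_nat_prod)
  qed
  finally show ?thesis .
qed

end

text \<open>Equality of all moments determines the law once the negative part of the inversion formula has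
  finite expectation and can be cancelled. It is dominated by \<open>\<Prod>i. 4 ^ N i\<close>; finiteness for one of
  the two variables is enough because both have the same expectations.\<close>

theorem distr_eqI_binomial_moments:
  fixes N1 :: "'a \<Rightarrow> 'r::finite \<Rightarrow> nat" and N2 :: "'b \<Rightarrow> 'r \<Rightarrow> nat"
  assumes M1: "prob_space M1" and M2: "prob_space M2"
    and N1: "N1 \<in> measurable M1 (count_space UNIV)" and N2: "N2 \<in> measurable M2 (count_space UNIV)"
    and eq: "\<And>m. (\<integral>\<^sup>+\<omega>. of_nat (\<Prod>i\<in>UNIV. N1 \<omega> i choose m i) \<partial>M1) = (\<integral>\<^sup>+\<omega>. of_nat (\<Prod>i\<in>UNIV. N2 \<omega> i choose m i) \<partial>M2)"
    and fin: "(\<integral>\<^sup>+\<omega>. of_nat (\<Prod>i\<in>UNIV. 4 ^ N2 \<omega> i) \<partial>M2) < \<infinity>"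
  shows "distr M1 (count_space UNIV) N1 = distr M2 (count_space UNIV) N2"
proof (rule measure_eqI_countable[of _ UNIV])
  fix n :: "'r \<Rightarrow> nat"
  define S where "S b N = (\<Sum>m | m \<in> below N \<and> even_gap n m = b. inversion_term n N m)" for b N
  have S_eq: "(\<integral>\<^sup>+\<omega>. of_nat (S b (N1 \<omega>)) \<partial>M1) = (\<integral>\<^sup>+\<omega>. of_nat (S b (N2 \<omega>)) \<partial>M2)" for b
    unfolding S_def expectation_inversion_term[OF M1 N1] expectation_inversion_term[OF M2 N2] eq ..
  have key: "emeasure (distr M (count_space UNIV) N) {n} + (\<integral>\<^sup>+\<omega>. of_nat (S False (N \<omega>)) \<partial>M) = (\<integral>\<^sup>+\<omega>. of_nat (S True (N \<omega>)) \<partial>M)"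
    if N: "N \<in> measurable M (count_space UNIV)" for M :: "'c measure" and N
  proof -
    have meas: "(\<lambda>\<omega>. g (N \<omega>) :: ennreal) \<in> borel_measurable M" for g
      using measurable_comp[OF N, of g borel] by (simp add: o_def)
    have "emeasure (distr M (count_space UNIV) N) {n} = (\<integral>\<^sup>+x. indicator {n} x \<partial>distr M (count_space UNIV) N)"
      by simp
    also have "\<dots> = (\<integral>\<^sup>+\<omega>. of_bool (N \<omega> = n) \<partial>M)"
      by (subst nn_integral_distr[OF N]) (auto intro!: nn_integral_cong simp: indicator_def)
    finally have "emeasure (distr M (count_space UNIV) N) {n} + (\<integral>\<^sup>+\<omega>. of_nat (S False (N \<omega>)) \<partial>M) =
      (\<integral>\<^sup>+\<omega>. of_bool (N \<omega> = n) + of_nat (S False (N \<omega>)) \<partial>M)"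
      using meas[of "\<lambda>x. of_bool (x = n)"] meas[of "\<lambda>x. of_nat (S False x)"] by (simp add: nn_integral_add)
    also have "\<dots> = (\<integral>\<^sup>+\<omega>. of_nat (S True (N \<omega>)) \<partial>M)"
    proof (rule nn_integral_cong)
      fix \<omega>
      have "of_bool (N \<omega> = n) + S False (N \<omega>) = S True (N \<omega>)"
        using inversion_nat[of "N \<omega>" n] by (simp add: S_def)
      from arg_cong[OF this, of "of_nat :: nat \<Rightarrow> ennreal"]
      show "of_bool (N \<omega> = n) + of_nat (S False (N \<omega>)) = (of_nat (S True (N \<omega>)) :: ennreal)" by simp
    qed
    finally show ?thesis .
  qed
  have "(\<integral>\<^sup>+\<omega>. of_nat (S False (N2 \<omega>)) \<partial>M2) \<le> (\<integral>\<^sup>+\<omega>. of_nat (\<Prod>i\<in>UNIV. 4 ^ N2 \<omega> i) \<partial>M2)"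
  proof (rule nn_integral_mono)
    fix \<omega>
    have "S False (N2 \<omega>) \<le> (\<Sum>m\<in>below (N2 \<omega>). inversion_term n (N2 \<omega>) m)"
      unfolding S_def by (rule sum_mono2) auto
    also have "\<dots> \<le> (\<Prod>i\<in>UNIV. 4 ^ N2 \<omega> i)" by (rule sum_inversion_term_le)
    finally show "of_nat (S False (N2 \<omega>)) \<le> (of_nat (\<Prod>i\<in>UNIV. 4 ^ N2 \<omega> i) :: ennreal)"
      by (simp del: of_nat_prod)
  qed
  then have "(\<integral>\<^sup>+\<omega>. of_nat (S False (N2 \<omega>)) \<partial>M2) \<noteq> \<infinity>" using fin by (metis leD)
  then show "emeasure (distr M1 (count_space UNIV) N1) {n} = emeasure (distr M2 (count_space UNIV) N2) {n}"
    using key[OF N1] key[OF N2] unfolding S_eq by (metis ennreal_add_left_cancel add.commute infinity_ennreal_def)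
qed simp_all

corollary distr_eqI_falling_moments:
  fixes N1 :: "'a \<Rightarrow> 'r::finite \<Rightarrow> nat" and N2 :: "'b \<Rightarrow> 'r \<Rightarrow> nat"
  assumes M1: "prob_space M1" and M2: "prob_space M2"
    and N1: "N1 \<in> measurable M1 (count_space UNIV)" and N2: "N2 \<in> measurable M2 (count_space UNIV)"
    and eq: "\<And>n f. (\<integral>\<^sup>+\<omega>. of_nat (falling_moment (N1 \<omega>) n f) \<partial>M1) = (\<integral>\<^sup>+\<omega>. of_nat (falling_moment (N2 \<omega>) n f) \<partial>M2)"
    and fin: "(\<integral>\<^sup>+\<omega>. of_nat (\<Prod>i\<in>UNIV. 4 ^ N2 \<omega> i) \<partial>M2) < \<infinity>"
  shows "distr M1 (count_space UNIV) N1 = distr M2 (count_space UNIV) N2"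
proof (rule distr_eqI_binomial_moments[OF M1 M2 N1 N2 _ fin])
  fix m :: "'r \<Rightarrow> nat"
  obtain n :: nat and f where nf: "\<And>i. card {j. j < n \<and> f j = i} = m i"
    using ex_tuple_with_multiplicities[of m] by blast
  define C where "C = (\<Prod>i\<in>UNIV. fact (m i) :: nat)"
  have C: "of_nat C \<noteq> (0::ennreal)" "of_nat C \<noteq> (\<infinity>::ennreal)" by (simp_all add: C_def del: of_nat_prod)
  have *: "(\<integral>\<^sup>+\<omega>. of_nat (falling_moment (N \<omega>) n f) \<partial>M) = of_nat C * (\<integral>\<^sup>+\<omega>. of_nat (\<Prod>i\<in>UNIV. N \<omega> i choose m i) \<partial>M)"
    if N: "N \<in> measurable M (count_space UNIV)" for M :: "'c measure" and N
  proof -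
    have "(\<lambda>\<omega>. of_nat (\<Prod>i\<in>UNIV. N \<omega> i choose m i) :: ennreal) \<in> borel_measurable M"
      using measurable_comp[OF N, of "\<lambda>N. of_nat (\<Prod>i\<in>UNIV. N i choose m i) :: ennreal" borel] by (simp add: o_def)
    then show ?thesis
      unfolding falling_moment_binomial nf prod.distrib C_def[symmetric]
      by (simp add: nn_integral_cmult del: of_nat_prod)
  qed
  show "(\<integral>\<^sup>+\<omega>. of_nat (\<Prod>i\<in>UNIV. N1 \<omega> i choose m i) \<partial>M1) = (\<integral>\<^sup>+\<omega>. of_nat (\<Prod>i\<in>UNIV. N2 \<omega> i choose m i) \<partial>M2)"
    using eq[of n f] C unfolding *[OF N1] *[OF N2] by (simp add: ennreal_mult_cancel_left)
qed

section \<open>Independent balls in cells\<close>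

lemma coordinates_indep_vars:
  fixes \<nu> :: "nat \<Rightarrow> 'b::second_countable_topology measure"
  assumes "\<And>k. prob_space (\<nu> k)" and sets: "\<And>k. sets (\<nu> k) = sets borel"
  shows "prob_space.indep_vars (Pi\<^sub>M UNIV \<nu>) (\<lambda>_. borel) (\<lambda>k \<omega>. \<omega> k) UNIV"
proof -
  interpret product_prob_space \<nu> UNIV
    using assms(1) by (simp add: product_prob_space_def product_prob_space_axioms_def product_sigma_finite_def prob_space_imp_sigma_finite)
  have rv: "(\<lambda>\<omega>. \<omega> k) \<in> measurable (Pi\<^sub>M UNIV \<nu>) borel" for k
    using measurable_component_singleton[of k UNIV \<nu>] measurable_cong_sets[OF refl sets[of k], of "Pi\<^sub>M UNIV \<nu>"] by simp
  have "distr (Pi\<^sub>M UNIV \<nu>) (Pi\<^sub>M UNIV (\<lambda>_. borel)) (\<lambda>x. \<lambda>i\<in>UNIV. x i) = distr (Pi\<^sub>M UNIV \<nu>) (Pi\<^sub>M UNIV (\<lambda>_. borel)) (\<lambda>x. x)"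
    by (simp add: restrict_def)
  also have "\<dots> = Pi\<^sub>M UNIV \<nu>"
    by (rule distr_id2) (intro sets_PiM_cong refl sets[symmetric])
  also have "\<dots> = Pi\<^sub>M UNIV (\<lambda>k. distr (Pi\<^sub>M UNIV \<nu>) borel (\<lambda>\<omega>. \<omega> k))"
  proof (rule PiM_cong[OF refl])
    fix k
    have "distr (Pi\<^sub>M UNIV \<nu>) borel (\<lambda>\<omega>. \<omega> k) = distr (Pi\<^sub>M UNIV \<nu>) (\<nu> k) (\<lambda>\<omega>. \<omega> k)"
      by (rule distr_cong) (auto simp: sets)
    then show "\<nu> k = distr (Pi\<^sub>M UNIV \<nu>) borel (\<lambda>\<omega>. \<omega> k)" by (simp add: PiM_component)
  qed
  finally show ?thesis
    by (subst P.indep_vars_iff_distr_eq_PiM') (auto intro: rv)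
qed

lemma summable_on_iff_abs_summable_on_cart:
  fixes f :: "'k \<Rightarrow> real ^ 'r::finite"
  shows "f summable_on I \<longleftrightarrow> (\<lambda>k. norm (f k)) summable_on I"
proof
  assume s: "f summable_on I"
  have comp: "(\<lambda>k. \<bar>vec_nth (f k) i\<bar>) summable_on I" for i
  proof -
    have "(\<lambda>k. vec_nth (f k) i) summable_on I"
      using summable_on_bounded_linear[OF bounded_linear_vec_nth s, of i] by (simp add: o_def)
    then show ?thesis
      by (rule summable_on_iff_abs_summable_on_real[THEN iffD1, unfolded real_norm_def])
  qed
  have "(\<lambda>k. \<Sum>i\<in>A. \<bar>vec_nth (f k) i\<bar>) summable_on I" if "finite A" for A
    using that by (induction A) (auto intro: summable_on_add comp)
  from this[of UNIV] have "(\<lambda>k. \<Sum>i\<in>UNIV. \<bar>vec_nth (f k) i\<bar>) summable_on I" by simp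
  then show "(\<lambda>k. norm (f k)) summable_on I"
    by (rule summable_on_comparison_test) (auto intro: norm_le_l1_cart)
qed (rule abs_summable_summable)

text \<open>An unordered sum is 0 where it does not converge; the set of convergence is measurable since
  in finite dimension convergence is the same as absolute convergence.\<close>

lemma borel_measurable_infsum_coordinates:
  fixes X :: "nat \<Rightarrow> 'w \<Rightarrow> real ^ 'r::finite"
  assumes [measurable]: "\<And>k. X k \<in> borel_measurable M"
  shows "(\<lambda>\<omega>. \<Sum>\<^sub>\<infinity>k\<in>I. X k \<omega>) \<in> borel_measurable M"
proof -
  define Y where "Y k \<omega> = (if k \<in> I then X k \<omega> else 0)" for k \<omega>
  have [measurable]: "Y k \<in> borel_measurable M" for k
    by (cases "k \<in> I") (auto simp: Y_def[abs_def])
  have eq: "(\<Sum>\<^sub>\<infinity>k\<in>I. X k \<omega>) = (if (\<Sum>k. ennreal (norm (Y k \<omega>))) < \<infinity> then (\<Sum>k. Y k \<omega>) else 0)" for \<omega>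
  proof -
    have i: "(\<Sum>\<^sub>\<infinity>k\<in>I. X k \<omega>) = (\<Sum>\<^sub>\<infinity>k. Y k \<omega>)"
      by (rule infsum_cong_neutral) (auto simp: Y_def)
    have "(\<lambda>k. Y k \<omega>) summable_on UNIV \<longleftrightarrow> summable (\<lambda>k. norm (Y k \<omega>))"
      unfolding summable_on_iff_abs_summable_on_cart by (rule summable_on_UNIV_nonneg_real_iff) simp
    also have "\<dots> \<longleftrightarrow> (\<Sum>k. ennreal (norm (Y k \<omega>))) < \<infinity>"
    proof
      assume "summable (\<lambda>k. norm (Y k \<omega>))"
      then have "(\<Sum>k. ennreal (norm (Y k \<omega>))) \<noteq> \<infinity>"
        unfolding infinity_ennreal_def by (rule ennreal_suminf_neq_top) simp
      then show "(\<Sum>k. ennreal (norm (Y k \<omega>))) < \<infinity>" by (simp add: less_top)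
    next
      assume "(\<Sum>k. ennreal (norm (Y k \<omega>))) < \<infinity>"
      then show "summable (\<lambda>k. norm (Y k \<omega>))" by (intro summable_suminf_not_top) (auto simp: less_top)
    qed
    finally have s: "(\<lambda>k. Y k \<omega>) summable_on UNIV \<longleftrightarrow> (\<Sum>k. ennreal (norm (Y k \<omega>))) < \<infinity>" .
    show ?thesis
    proof (cases "(\<lambda>k. Y k \<omega>) summable_on UNIV")
      case True
      from has_sum_imp_sums[OF has_sum_infsum[OF True]] show ?thesis
        using True s unfolding i by (simp add: sums_iff)
    next
      case False
      then show ?thesis using s unfolding i by (simp add: infsum_not_exists)
    qed
  qed
  show ?thesis unfolding eq by measurable
qed

lemma measurable_count_space_fun:
  fixes N :: "'w \<Rightarrow> 'r::finite \<Rightarrow> nat"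
  assumes [measurable]: "\<And>i. (\<lambda>\<omega>. N \<omega> i) \<in> measurable M (count_space UNIV)"
  shows "N \<in> measurable M (count_space UNIV)"
proof -
  have "N -` {n} \<inter> space M \<in> sets M" for n
  proof -
    have "N -` {n} \<inter> space M = {\<omega>\<in>space M. \<forall>i\<in>UNIV. N \<omega> i = n i}" by (auto simp: fun_eq_iff)
    also have "\<dots> \<in> sets M" by measurable
    finally show ?thesis .
  qed
  then show ?thesis by (simp add: measurable_count_space_eq2_countable)
qed

text \<open>Ball \<open>k\<close> falls into cell \<open>i\<close> with probability \<open>lam k i\<close>, recorded as the standard basis
  vector of \<open>i\<close>, or into no cell, recorded as 0. All natural numbers index balls; a ball that
  should be absent gets \<open>lam k = 0\<close>.\<close>

locale independent_balls =
  fixes lam :: "nat \<Rightarrow> 'r::finite \<Rightarrow> real"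
  assumes lam_nonneg: "0 \<le> lam k i" and lam_le: "(\<Sum>i\<in>UNIV. lam k i) \<le> 1"
    and lam_summable: "summable (\<lambda>k. \<Sum>i\<in>UNIV. lam k i)"
begin

definition ball_pmf :: "nat \<Rightarrow> 'r option pmf" where
  "ball_pmf k = embed_pmf (\<lambda>x. case x of None \<Rightarrow> 1 - (\<Sum>i\<in>UNIV. lam k i) | Some i \<Rightarrow> lam k i)"

definition cell_vector :: "'r option \<Rightarrow> real ^ 'r" where
  "cell_vector x = (case x of None \<Rightarrow> 0 | Some i \<Rightarrow> axis i 1)"

definition ball_law :: "nat \<Rightarrow> (real ^ 'r) measure" where
  "ball_law k = distr (measure_pmf (ball_pmf k)) borel cell_vector"

definition joint_law :: "(nat \<Rightarrow> real ^ 'r) measure" where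
  "joint_law = Pi\<^sub>M UNIV ball_law"

definition cell_count :: "(nat \<Rightarrow> real ^ 'r) \<Rightarrow> 'r \<Rightarrow> nat" where
  "cell_count \<omega> i = card {k. \<omega> k = axis i 1}"

lemma pmf_ball: "pmf (ball_pmf k) x = (case x of None \<Rightarrow> 1 - (\<Sum>i\<in>UNIV. lam k i) | Some i \<Rightarrow> lam k i)"
proof -
  define p where "p x = (case x of None \<Rightarrow> 1 - (\<Sum>i\<in>UNIV. lam k i) | Some i \<Rightarrow> lam k i)" for x
  have nn: "0 \<le> p x" for x
    using lam_nonneg lam_le by (auto simp: p_def split: option.split)
  have "(\<integral>\<^sup>+x. ennreal (p x) \<partial>count_space UNIV) = (\<Sum>x\<in>UNIV. ennreal (p x))"
    by (rule nn_integral_count_space_finite) simp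
  also have "\<dots> = ennreal (\<Sum>x\<in>UNIV. p x)"
    by (rule sum_ennreal) (rule nn)
  also have "(\<Sum>x\<in>UNIV. p x) = 1"
    by (simp add: UNIV_option_conv sum.reindex p_def)
  finally have "pmf (embed_pmf p) x = p x" by (intro pmf_embed_pmf nn) simp
  then show ?thesis unfolding ball_pmf_def p_def[abs_def] .
qed

lemma axis_1_eq [simp]: "axis i (1::real) = axis j 1 \<longleftrightarrow> i = j"
  by (simp add: axis_eq_axis)

lemma axis_1_neq_0 [simp]: "axis i (1::real) \<noteq> 0"
  by (metis axis_eq_0_iff one_neq_zero)

lemma inj_cell_vector: "inj cell_vector"
  unfolding cell_vector_def inj_def by (auto split: option.splits dest: sym)

lemma sets_ball [simp, measurable_cong]: "sets (ball_law k) = sets borel"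
  by (simp add: ball_law_def)

lemma prob_space_ball: "prob_space (ball_law k)"
  unfolding ball_law_def by (rule prob_space.prob_space_distr) (auto intro: measure_pmf.prob_space_axioms)

lemma emeasure_ball_singleton: "emeasure (ball_law k) {cell_vector x} = ennreal (pmf (ball_pmf k) x)"
proof -
  have "emeasure (ball_law k) {cell_vector x} = emeasure (measure_pmf (ball_pmf k)) (cell_vector -` {cell_vector x})"
    unfolding ball_law_def by (subst emeasure_distr) auto
  also have "cell_vector -` {cell_vector x} = {x}" using inj_cell_vector by (auto dest: injD)
  finally show ?thesis by (simp add: emeasure_pmf_single)
qed

lemma emeasure_ball_axis: "emeasure (ball_law k) {axis i 1} = ennreal (lam k i)"
  using emeasure_ball_singleton[of k "Some i"] by (simp add: cell_vector_def pmf_ball)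

lemma emeasure_ball_0: "emeasure (ball_law k) {0} = ennreal (1 - (\<Sum>i\<in>UNIV. lam k i))"
  using emeasure_ball_singleton[of k None] by (simp add: cell_vector_def pmf_ball)

sublocale PP: product_prob_space ball_law UNIV
  using prob_space_ball by (simp add: product_prob_space_def product_prob_space_axioms_def product_sigma_finite_def prob_space_imp_sigma_finite)

lemma prob_space_balls: "prob_space joint_law"
  unfolding joint_law_def by (rule PP.P.prob_space_axioms)

lemma coordinate_measurable [measurable]: "(\<lambda>\<omega>. \<omega> k) \<in> borel_measurable joint_law"
  unfolding joint_law_def
  using measurable_component_singleton[of k UNIV ball_law] measurable_cong_sets[OF refl sets_ball[of k], of "Pi\<^sub>M UNIV ball_law"] by simp

lemma balls_indep: "prob_space.indep_vars joint_law (\<lambda>_. borel) (\<lambda>k \<omega>. \<omega> k) UNIV"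
  unfolding joint_law_def by (rule coordinates_indep_vars[OF prob_space_ball sets_ball])

lemma emeasure_balls_coordinate: "A \<in> sets borel \<Longrightarrow> emeasure joint_law {\<omega>\<in>space joint_law. \<omega> k \<in> A} = emeasure (ball_law k) A"
  unfolding joint_law_def by (rule PP.emeasure_PiM_Collect_single) auto

lemma measure_balls_axis: "measure joint_law {\<omega>\<in>space joint_law. \<omega> k = axis i 1} = lam k i"
  using emeasure_balls_coordinate[of "{axis i 1}" k] lam_nonneg[of k i] by (simp add: emeasure_ball_axis measure_def)

lemma measure_balls_0: "measure joint_law {\<omega>\<in>space joint_law. \<omega> k = 0} = 1 - (\<Sum>i\<in>UNIV. lam k i)"
  using emeasure_balls_coordinate[of "{0}" k] lam_le[of k] by (simp add: emeasure_ball_0 measure_def)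

lemma AE_cell_vector: "AE \<omega> in joint_law. \<omega> k \<in> range cell_vector"
proof -
  have "range cell_vector \<in> sets borel" by (intro borel_closed finite_imp_closed) simp
  then have "AE x in ball_law k. x \<in> range cell_vector"
    unfolding ball_law_def by (subst AE_distr_iff) auto
  then show ?thesis unfolding joint_law_def by (intro PP.AE_component) auto
qed

text \<open>Borel-Cantelli: the probabilities that the balls hit some cell have a finite sum.\<close>

lemma AE_finitely_many_nonzero: "AE \<omega> in joint_law. finite {k. \<omega> k \<noteq> 0}"
proof -
  interpret prob_space joint_law by (rule prob_space_balls)
  let ?A = "\<lambda>k. {\<omega>\<in>space joint_law. \<omega> k \<noteq> 0}"
  have A: "?A k \<in> sets joint_law" for k by measurable
  have "measure joint_law (?A k) = (\<Sum>i\<in>UNIV. lam k i)" for k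
  proof -
    have "?A k = space joint_law - {\<omega>\<in>space joint_law. \<omega> k = 0}" by auto
    then show ?thesis by (simp add: prob_compl measure_balls_0)
  qed
  then have "summable (\<lambda>k. measure joint_law (?A k))" using lam_summable by simp
  from borel_cantelli_AE1[OF A _ this] have "AE \<omega> in joint_law. eventually (\<lambda>k. \<omega> \<in> space joint_law - ?A k) sequentially"
    by (simp add: less_top[symmetric])
  with AE_space show ?thesis
  proof eventually_elim
    case (elim \<omega>)
    then obtain K where "\<And>k. k \<ge> K \<Longrightarrow> \<omega> k = 0" by (auto simp: eventually_sequentially)
    then have "{k. \<omega> k \<noteq> 0} \<subseteq> {..<K}" by (auto simp: not_less[symmetric])
    then show ?case by (rule finite_subset) simp
  qed
qed

lemma cell_count_measurable: "cell_count \<in> measurable joint_law (count_space UNIV)"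
proof (rule measurable_count_space_fun)
  fix i
  show "(\<lambda>\<omega>. cell_count \<omega> i) \<in> measurable joint_law (count_space UNIV)"
    unfolding cell_count_def by (rule measurable_card) measurable
qed

text \<open>The counts of the first \<open>m\<close> balls. They increase to the full counts and almost surely reach
  them, which reduces expectations to finitely many balls.\<close>

definition truncated_count :: "nat \<Rightarrow> (nat \<Rightarrow> real ^ 'r) \<Rightarrow> 'r \<Rightarrow> nat" where
  "truncated_count m \<omega> i = card ({..<m} \<inter> {k. \<omega> k = axis i 1})"

lemma truncated_count_measurable: "truncated_count m \<in> measurable joint_law (count_space UNIV)"
proof (rule measurable_count_space_fun)
  fix i
  show "(\<lambda>\<omega>. truncated_count m \<omega> i) \<in> measurable joint_law (count_space UNIV)"
    unfolding truncated_count_def by (rule measurable_card) measurable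
qed

lemma truncated_count_mono: "m \<le> m' \<Longrightarrow> truncated_count m \<omega> i \<le> truncated_count m' \<omega> i"
  unfolding truncated_count_def by (intro card_mono) auto

lemma eventually_truncated_count:
  assumes "finite {k. \<omega> k \<noteq> 0}"
  shows "eventually (\<lambda>m. truncated_count m \<omega> = cell_count \<omega>) sequentially"
proof -
  obtain K where K: "{k. \<omega> k \<noteq> 0} \<subseteq> {..<K}" using finite_nat_bounded[OF assms] by auto
  show ?thesis
  proof (rule eventually_sequentiallyI[of K], rule ext)
    fix m i assume "K \<le> m"
    have "k < m" if "\<omega> k = axis i 1" for k
    proof -
      have "k \<in> {k. \<omega> k \<noteq> 0}" using that by simp
      then show ?thesis using K \<open>K \<le> m\<close> by (meson lessThan_iff less_le_trans subsetD)
    qed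
    then have "{..<m} \<inter> {k. \<omega> k = axis i 1} = {k. \<omega> k = axis i 1}" by auto
    then show "truncated_count m \<omega> i = cell_count \<omega> i" by (simp add: truncated_count_def cell_count_def)
  qed
qed

lemma nn_integral_cell_count:
  fixes g :: "('r \<Rightarrow> nat) \<Rightarrow> ennreal"
  assumes mono: "\<And>N N'. (\<And>i. N i \<le> N' i) \<Longrightarrow> g N \<le> g N'"
  shows "(\<lambda>m. \<integral>\<^sup>+\<omega>. g (truncated_count m \<omega>) \<partial>joint_law) \<longlonglongrightarrow> (\<integral>\<^sup>+\<omega>. g (cell_count \<omega>) \<partial>joint_law)"
proof -
  have inc: "incseq (\<lambda>m \<omega>. g (truncated_count m \<omega>))"
    by (intro incseq_SucI le_funI mono truncated_count_mono) simp
  have "(\<integral>\<^sup>+\<omega>. g (cell_count \<omega>) \<partial>joint_law) = (\<integral>\<^sup>+\<omega>. (SUP m. g (truncated_count m \<omega>)) \<partial>joint_law)"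
  proof (rule nn_integral_cong_AE, use AE_finitely_many_nonzero in eventually_elim)
    case (elim \<omega>)
    have "(\<lambda>m. g (truncated_count m \<omega>)) \<longlonglongrightarrow> (SUP m. g (truncated_count m \<omega>))"
      by (rule LIMSEQ_SUP) (use inc in \<open>auto simp: incseq_def le_fun_def\<close>)
    moreover have "(\<lambda>m. g (truncated_count m \<omega>)) \<longlonglongrightarrow> g (cell_count \<omega>)"
      by (rule tendsto_eventually) (use eventually_truncated_count[OF elim] in \<open>auto elim: eventually_mono\<close>)
    ultimately show ?case by (rule LIMSEQ_unique[symmetric])
  qed
  also have "\<dots> = (SUP m. \<integral>\<^sup>+\<omega>. g (truncated_count m \<omega>) \<partial>joint_law)"
  proof (rule nn_integral_monotone_convergence_SUP[OF inc])
    show "(\<lambda>\<omega>. g (truncated_count m \<omega>)) \<in> borel_measurable joint_law" for m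
      using measurable_comp[OF truncated_count_measurable, of g borel] by (simp add: o_def)
  qed
  finally show ?thesis
    using LIMSEQ_SUP[of "\<lambda>m. \<integral>\<^sup>+\<omega>. g (truncated_count m \<omega>) \<partial>joint_law"] inc
    by (simp add: incseq_def le_fun_def nn_integral_mono)
qed

text \<open>Distinct balls are independent, so the expected number of injective tuples of balls in
  prescribed cells is a sum of products. These are the same sums as in \<open>nn_integral_det_limit\<close>.\<close>

lemma falling_moment_truncated_count:
  "(\<integral>\<^sup>+\<omega>. of_nat (falling_moment (truncated_count m \<omega>) n f) \<partial>joint_law) =
    ennreal (\<Sum>k | k \<in> {..<n} \<rightarrow>\<^sub>E {..<m} \<and> inj_on k {..<n}. \<Prod>j<n. lam (k j) (f j))"
proof -
  let ?T = "{k. k \<in> {..<n} \<rightarrow>\<^sub>E {..<m} \<and> inj_on k {..<n}}"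
  let ?E = "\<lambda>k. {\<omega>\<in>space joint_law. \<forall>j<n. \<omega> (k j) = axis (f j) 1}"
  have fT: "finite ?T" by (intro finite_Collect_conjI disjI1) (simp add: finite_PiE)
  have E: "?E k \<in> sets joint_law" for k by measurable
  have "(\<integral>\<^sup>+\<omega>. of_nat (falling_moment (truncated_count m \<omega>) n f) \<partial>joint_law) =
    (\<integral>\<^sup>+\<omega>. (\<Sum>k\<in>?T. indicator (?E k) \<omega>) \<partial>joint_law)"
  proof (rule nn_integral_cong)
    fix \<omega> assume \<omega>: "\<omega> \<in> space joint_law"
    have "disjoint_family (\<lambda>i. {k. \<omega> k = axis i 1})"
      unfolding disjoint_family_on_def by (auto dest: sym)
    from card_injective_tuples[OF finite_lessThan this, of n m f]
    have "falling_moment (truncated_count m \<omega>) n f = card {x \<in> {..<n} \<rightarrow>\<^sub>E {..<m}. (\<forall>j<n. x j \<in> {k. \<omega> k = axis (f j) 1}) \<and> inj_on x {..<n}}"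
      by (simp add: truncated_count_def[abs_def])
    also have "\<dots> = card (?T \<inter> {k. \<omega> \<in> ?E k})" by (rule arg_cong[where f=card]) (use \<omega> in auto)
    also have "\<dots> = (\<Sum>k\<in>?T. indicator {k. \<omega> \<in> ?E k} k)"
      using fT by (simp add: sum_indicator_eq_card)
    finally have "of_nat (falling_moment (truncated_count m \<omega>) n f) = (of_nat (\<Sum>k\<in>?T. indicator {k. \<omega> \<in> ?E k} k) :: ennreal)"
      by (rule arg_cong)
    also have "\<dots> = (\<Sum>k\<in>?T. indicator (?E k) \<omega>)"
      unfolding of_nat_sum by (rule sum.cong) (auto simp: indicator_def)
    finally show "of_nat (falling_moment (truncated_count m \<omega>) n f) = (\<Sum>k\<in>?T. indicator (?E k) \<omega> :: ennreal)" .
  qed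
  also have "\<dots> = (\<Sum>k\<in>?T. emeasure joint_law (?E k))"
    using E by (subst nn_integral_sum) auto
  also have "\<dots> = (\<Sum>k\<in>?T. ennreal (\<Prod>j<n. lam (k j) (f j)))"
  proof (rule sum.cong[OF refl])
    fix k assume "k \<in> ?T"
    then have inj: "inj_on k {..<n}" by simp
    let ?X = "\<lambda>l. {axis (f (the_inv_into {..<n} k l)) (1::real)}"
    have "?E k = {\<omega>\<in>space joint_law. \<forall>l\<in>k ` {..<n}. \<omega> l \<in> ?X l}"
      using the_inv_into_f_f[OF inj] by auto
    also have "emeasure joint_law \<dots> = (\<Prod>l\<in>k ` {..<n}. emeasure (ball_law l) (?X l))"
      unfolding joint_law_def by (rule PP.emeasure_PiM_Collect) auto
    also have "\<dots> = (\<Prod>j<n. emeasure (ball_law (k j)) {axis (f j) 1})"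
      using the_inv_into_f_f[OF inj] by (subst prod.reindex[OF inj]) auto
    also have "\<dots> = ennreal (\<Prod>j<n. lam (k j) (f j))"
      unfolding emeasure_ball_axis by (rule prod_ennreal) (rule lam_nonneg)
    finally show "emeasure joint_law (?E k) = ennreal (\<Prod>j<n. lam (k j) (f j))" .
  qed
  also have "\<dots> = ennreal (\<Sum>k\<in>?T. \<Prod>j<n. lam (k j) (f j))"
    by (rule sum_ennreal) (auto intro: prod_nonneg lam_nonneg)
  finally show ?thesis .
qed

lemma falling_moment_cell_count:
  "(\<lambda>m. ennreal (\<Sum>k | k \<in> {..<n} \<rightarrow>\<^sub>E {..<m} \<and> inj_on k {..<n}. \<Prod>j<n. lam (k j) (f j))) \<longlonglongrightarrow>
    (\<integral>\<^sup>+\<omega>. of_nat (falling_moment (cell_count \<omega>) n f) \<partial>joint_law)"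
  unfolding falling_moment_truncated_count[symmetric]
proof (rule nn_integral_cell_count)
  fix N N' :: "'r \<Rightarrow> nat" assume "\<And>i. N i \<le> N' i"
  then have "falling_moment N n f \<le> falling_moment N' n f"
    unfolding falling_moment_def by (intro prod_mono conjI diff_le_mono) auto
  then show "of_nat (falling_moment N n f) \<le> (of_nat (falling_moment N' n f) :: ennreal)"
    by (rule of_nat_mono)
qed

text \<open>Each ball contributes a factor with expectation \<open>1 + 3 \<lambda> \<le> exp (3 \<lambda>)\<close>, where \<open>\<lambda>\<close> is its
  probability of hitting some cell.\<close>

lemma exponential_moment_cell_count:
  "(\<integral>\<^sup>+\<omega>. of_nat (\<Prod>i\<in>UNIV. 4 ^ cell_count \<omega> i) \<partial>joint_law) < \<infinity>"
proof -
  define h where "h v = (if v \<in> range (\<lambda>i. axis i 1) then 4 else 1 :: ennreal)" for v :: "real ^ 'r"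
  define C where "C = exp (3 * (\<Sum>k. \<Sum>i\<in>UNIV. lam k i))"
  have hm[measurable]: "h \<in> borel_measurable borel"
    unfolding h_def by (intro measurable_If) (auto intro!: borel_closed finite_imp_closed)
  interpret prob_space joint_law by (rule prob_space_balls)
  have le: "(\<integral>\<^sup>+\<omega>. of_nat (\<Prod>i\<in>UNIV. 4 ^ truncated_count m \<omega> i) \<partial>joint_law) \<le> ennreal C" for m
  proof -
    have eq: "of_nat (\<Prod>i\<in>UNIV. 4 ^ truncated_count m \<omega> i) = (\<Prod>k<m. h (\<omega> k))" for \<omega>
    proof -
      have "(\<Prod>i\<in>UNIV. (4::nat) ^ truncated_count m \<omega> i) = 4 ^ (\<Sum>i\<in>UNIV. truncated_count m \<omega> i)"
        by (rule power_sum[symmetric])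
      also have "(\<Sum>i\<in>UNIV. truncated_count m \<omega> i) = card (\<Union>i. {..<m} \<inter> {k. \<omega> k = axis i 1})"
        unfolding truncated_count_def by (rule card_UN_disjoint[symmetric]) (auto dest: sym)
      also have "(\<Union>i. {..<m} \<inter> {k. \<omega> k = axis i 1}) = {k\<in>{..<m}. \<omega> k \<in> range (\<lambda>i. axis i 1)}" by auto
      also have "(4::nat) ^ card {k\<in>{..<m}. \<omega> k \<in> range (\<lambda>i. axis i 1)} = (\<Prod>k<m. if \<omega> k \<in> range (\<lambda>i. axis i 1) then 4 else 1)"
        by (subst prod.inter_filter[symmetric]) auto
      finally have "of_nat (\<Prod>i\<in>UNIV. 4 ^ truncated_count m \<omega> i) = (of_nat (\<Prod>k<m. if \<omega> k \<in> range (\<lambda>i. axis i 1) then 4 else 1) :: ennreal)"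
        by (rule arg_cong)
      also have "\<dots> = (\<Prod>k<m. h (\<omega> k))"
        unfolding of_nat_prod h_def by (rule prod.cong) auto
      finally show ?thesis .
    qed
    have "(\<integral>\<^sup>+\<omega>. of_nat (\<Prod>i\<in>UNIV. 4 ^ truncated_count m \<omega> i) \<partial>joint_law) = (\<Prod>k<m. \<integral>\<^sup>+\<omega>. h (\<omega> k) \<partial>joint_law)"
      unfolding eq
      by (rule indep_vars_nn_integral)
         (auto intro!: indep_vars_subset[OF indep_vars_compose2[OF balls_indep, of "\<lambda>_. h" "\<lambda>_. borel"]] hm)
    also have "\<dots> = (\<Prod>k<m. ennreal (1 + 3 * (\<Sum>i\<in>UNIV. lam k i)))"
    proof (rule prod.cong[OF refl])
      fix k
      have "(\<integral>\<^sup>+\<omega>. h (\<omega> k) \<partial>joint_law) = (\<integral>\<^sup>+\<omega>. 1 + 3 * (\<Sum>i\<in>UNIV. indicator {\<omega>\<in>space joint_law. \<omega> k = axis i 1} \<omega>) \<partial>joint_law)"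
      proof (rule nn_integral_cong)
        fix \<omega> assume "\<omega> \<in> space joint_law"
        then have ind: "(\<Sum>i\<in>UNIV. indicator {\<omega>\<in>space joint_law. \<omega> k = axis i 1} \<omega>) = (\<Sum>i\<in>UNIV. if \<omega> k = axis i 1 then 1 else 0 :: ennreal)"
          by (intro sum.cong) (auto simp: indicator_def)
        show "h (\<omega> k) = 1 + 3 * (\<Sum>i\<in>UNIV. indicator {\<omega>\<in>space joint_law. \<omega> k = axis i 1} \<omega>)"
        proof (cases "\<omega> k \<in> range (\<lambda>i. axis i (1::real))")
          case True
          then obtain i where "\<omega> k = axis i 1" by auto
          then show ?thesis unfolding ind by (simp add: h_def)
        next
          case False
          then have "\<omega> k \<noteq> axis i 1" for i by auto
          then show ?thesis unfolding ind using False by (simp add: h_def)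
        qed
      qed
      also have "\<dots> = 1 + 3 * (\<Sum>i\<in>UNIV. ennreal (lam k i))"
      proof -
        have [measurable]: "{\<omega>\<in>space joint_law. \<omega> k = axis i 1} \<in> sets joint_law" for i by measurable
        have "emeasure joint_law {\<omega>\<in>space joint_law. \<omega> k = axis i 1} = ennreal (lam k i)" for i
          using emeasure_balls_coordinate[of "{axis i 1}" k] by (simp add: emeasure_ball_axis)
        then show ?thesis
          by (simp add: nn_integral_add nn_integral_cmult nn_integral_sum emeasure_space_1)
      qed
      also have "\<dots> = ennreal (1 + 3 * (\<Sum>i\<in>UNIV. lam k i))"
        using lam_nonneg by (simp add: sum_ennreal ennreal_mult sum_nonneg ennreal_plus)
      finally show "(\<integral>\<^sup>+\<omega>. h (\<omega> k) \<partial>joint_law) = ennreal (1 + 3 * (\<Sum>i\<in>UNIV. lam k i))" .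
    qed
    also have "\<dots> = ennreal (\<Prod>k<m. 1 + 3 * (\<Sum>i\<in>UNIV. lam k i))"
      using lam_nonneg by (intro prod_ennreal) (simp add: sum_nonneg)
    also have "\<dots> \<le> ennreal (\<Prod>k<m. exp (3 * (\<Sum>i\<in>UNIV. lam k i)))"
      using lam_nonneg by (intro ennreal_leI prod_mono conjI exp_ge_add_one_self) (simp add: sum_nonneg)
    also have "\<dots> = ennreal (exp (\<Sum>k<m. 3 * (\<Sum>i\<in>UNIV. lam k i)))"
      by (simp add: exp_sum)
    also have "\<dots> \<le> ennreal C"
      unfolding C_def sum_distrib_left[symmetric] using lam_summable
      by (intro ennreal_leI) (auto intro!: sum_le_suminf sum_nonneg lam_nonneg)
    finally show ?thesis .
  qed
  have "(\<integral>\<^sup>+\<omega>. of_nat (\<Prod>i\<in>UNIV. 4 ^ cell_count \<omega> i) \<partial>joint_law) \<le> ennreal C"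
  proof (rule LIMSEQ_le_const2[OF nn_integral_cell_count])
    show "(of_nat (\<Prod>i\<in>UNIV. 4 ^ N i) :: ennreal) \<le> of_nat (\<Prod>i\<in>UNIV. 4 ^ N' i)"
      if "\<And>i. N i \<le> N' i" for N N' :: "'r \<Rightarrow> nat"
    proof -
      have "(\<Prod>i\<in>UNIV. 4 ^ N i :: nat) \<le> (\<Prod>i\<in>UNIV. 4 ^ N' i)"
        by (intro prod_mono conjI power_increasing that) auto
      then show ?thesis by (simp del: of_nat_prod)
    qed
  qed (use le in auto)
  then show ?thesis by (rule le_less_trans) simp
qed

lemma AE_sum_of_balls:
  assumes "\<And>k i. k \<notin> I \<Longrightarrow> lam k i = 0"
  shows "AE \<omega> in joint_law. \<omega> summable_on I \<and> (\<Sum>\<^sub>\<infinity>k\<in>I. \<omega> k) = (\<chi> i. real (cell_count \<omega> i))"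
proof -
  have "AE \<omega> in joint_law. \<forall>k. \<omega> k \<in> range cell_vector"
    unfolding AE_all_countable using AE_cell_vector by blast
  moreover have "AE \<omega> in joint_law. \<forall>k\<in>-I. \<omega> k = 0"
  proof (rule AE_ball_countable[THEN iffD2], simp, rule ballI)
    fix k assume k: "k \<in> - I"
    interpret prob_space joint_law by (rule prob_space_balls)
    have "measure joint_law {\<omega>\<in>space joint_law. \<omega> k = 0} = 1" using k assms by (simp add: measure_balls_0)
    then show "AE \<omega> in joint_law. \<omega> k = 0" by (subst (asm) prob_Collect_eq_1) auto
  qed
  ultimately show ?thesis
    using AE_finitely_many_nonzero
  proof eventually_elim
    case (elim \<omega>)
    let ?F = "{k. \<omega> k \<noteq> 0}"
    have pos: "\<omega> k = 0 \<or> (\<exists>i. \<omega> k = axis i 1)" for k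
    proof -
      obtain x where "\<omega> k = cell_vector x" using elim(1) by blast
      then show ?thesis by (cases x) (auto simp: cell_vector_def)
    qed
    have sub: "?F \<subseteq> I" using elim(2) by auto
    have hs: "(\<omega> has_sum (\<Sum>k\<in>?F. \<omega> k)) ?F" by (rule has_sum_finite[OF elim(3)])
    then have hs': "(\<omega> has_sum (\<Sum>k\<in>?F. \<omega> k)) I"
      by (rule has_sum_cong_neutral[THEN iffD1, rotated -1]) (use sub in auto)
    have "vec_nth (\<Sum>k\<in>?F. \<omega> k) i = real (cell_count \<omega> i)" for i
    proof -
      have "vec_nth (\<Sum>k\<in>?F. \<omega> k) i = (\<Sum>k\<in>?F. if \<omega> k = axis i 1 then 1 else 0)"
        unfolding sum_component
      proof (rule sum.cong[OF refl])
        fix k assume "k \<in> ?F"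
        then obtain j where "\<omega> k = axis j 1" using pos[of k] by auto
        moreover have "vec_nth (axis j (1::real)) i = (if j = i then 1 else 0)" by (simp add: axis_def)
        ultimately show "vec_nth (\<omega> k) i = (if \<omega> k = axis i 1 then 1 else 0)" by simp
      qed
      also have "\<dots> = real (card {k\<in>?F. \<omega> k = axis i 1})"
        using elim(3) by (subst sum.inter_filter[symmetric]) auto
      also have "{k\<in>?F. \<omega> k = axis i 1} = {k. \<omega> k = axis i 1}" by auto
      finally show ?thesis by (simp add: cell_count_def)
    qed
    then have "(\<Sum>k\<in>?F. \<omega> k) = (\<chi> i. real (cell_count \<omega> i))" by (simp add: Finite_Cartesian_Product.vec_eq_iff del: sum_component)
    then show ?case using hs' by (auto simp: summable_on_def infsumI)
  qed
qed

end

section \<open>The spectrum on the pieces\<close>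

lemma L2_on_iff_sq_int: "L2_on \<mu> A f \<longleftrightarrow> sq_int \<mu> (\<lambda>x. indicator A x * f x)"
proof -
  have 1: "(\<lambda>x. indicat_real A x *\<^sub>R f x) = (\<lambda>x. indicator A x * f x)"
    by (auto simp: indicator_def fun_eq_iff)
  have 2: "(\<lambda>x. indicat_real A x *\<^sub>R (cmod (f x))\<^sup>2) = (\<lambda>x. (cmod (indicator A x * f x))\<^sup>2)"
    by (auto simp: indicator_def fun_eq_iff)
  show ?thesis unfolding L2_on_def sq_int_def set_borel_measurable_def set_integrable_def 1 2 ..
qed

lemma L2_inner_eq_ip: "L2_inner \<mu> A f g = ip \<mu> (\<lambda>x. indicator A x * f x) (\<lambda>x. indicator A x * g x)"
  unfolding L2_inner_def ip_def set_lebesgue_integral_def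
  by (rule Bochner_Integration.integral_cong) (auto simp: indicator_def)

lemma integral_op_eq: "integral_op \<mu> K A f x = (\<integral>y. K x y * (indicator A y * f y) \<partial>\<mu>)"
  unfolding integral_op_def set_lebesgue_integral_def
  by (rule Bochner_Integration.integral_cong) (auto simp: indicator_def)

lemma sqnorm_indicator_le:
  assumes "sq_int M f" "A \<in> sets M"
  shows "sqnorm M (\<lambda>x. indicator A x * f x) \<le> sqnorm M f"
  unfolding sqnorm_def
proof (rule integral_mono)
  show "integrable M (\<lambda>x. (cmod (indicator A x * f x))\<^sup>2)"
    using sq_int_indicator[OF assms] by (simp add: sq_int_def)
  show "integrable M (\<lambda>x. (cmod (f x))\<^sup>2)" using assms by (simp add: sq_int_def)
qed (auto simp: indicator_def)

lemma ip_indicator: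
  "ip M (\<lambda>x. indicator A x * f x) (\<lambda>x. indicator A x * g x) = (\<integral>x. indicator A x * (f x * cnj (g x)) \<partial>M)"
  "ip M (\<lambda>x. indicator A x * f x) g = (\<integral>x. indicator A x * (f x * cnj (g x)) \<partial>M)"
  unfolding ip_def by (rule Bochner_Integration.integral_cong; auto simp: indicator_def)+

lemma (in kernel_expansion) restrict_expansion:
  assumes A: "A \<in> sets M"
  shows "kernel_expansion M (\<lambda>x y. indicator A x * indicator A y * G x y) a (\<lambda>n x. indicator A x * u n x) N"
proof
  show "sq_int M (\<lambda>x. indicator A x * u n x)" for n by (intro sq_int_indicator u_sq_int A)
  show "sqnorm M (\<lambda>x. indicator A x * u n x) \<le> 1" for n
    using sqnorm_indicator_le[OF u_sq_int A] u_le by (rule order_trans)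
  fix x assume x: "x \<in> space M"
  note [measurable] = A G_meas[OF x]
  show "(\<lambda>y. indicator A x * indicator A y * G x y) \<in> borel_measurable M" by measurable
next
  fix x y assume "x \<in> space M - N" "y \<in> space M - N"
  from G_sums[OF this]
  show "(\<lambda>n. complex_of_real (a n) * (indicator A x * u n x) * cnj (indicator A y * u n y)) sums
    (indicator A x * indicator A y * G x y)"
    by (cases "x \<in> A"; cases "y \<in> A") simp_all
qed (auto intro: a_nonneg a_summable N)

text \<open>A locally compact second countable space is covered by countably many open sets contained in
  compact sets.\<close>

lemma radon_sigma_finite:
  fixes \<mu> :: "'a::polish_space measure"
  assumes lc: "locally_compact_space (euclidean :: 'a topology)" and rm: "radon_measure \<mu>"
  shows "sigma_finite_measure \<mu>"
proof
  have sets: "sets \<mu> = sets borel"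
    using rm unfolding radon_measure_def by (rule conjunct1)
  have cpt: "\<forall>C. compact C \<longrightarrow> emeasure \<mu> C < \<infinity>"
    using rm unfolding radon_measure_def by (rule conjunct1[OF conjunct2])
  have sp: "space \<mu> = UNIV" using sets_eq_imp_space_eq[OF sets] by simp
  define F where "F = {U :: 'a set. open U \<and> (\<exists>C. compact C \<and> U \<subseteq> C)}"
  have "\<Union>F = UNIV"
  proof -
    have "\<exists>U\<in>F. x \<in> U" for x
    proof -
      have "\<exists>U C. openin euclidean U \<and> compactin euclidean C \<and> x \<in> U \<and> U \<subseteq> C"
        using lc unfolding locally_compact_space_def by simp
      then show ?thesis unfolding F_def by auto
    qed
    then show ?thesis by blast
  qed
  moreover obtain F' where F': "F' \<subseteq> F" "countable F'" "\<Union>F' = \<Union>F"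
    using Lindelof[of F] unfolding F_def by blast
  ultimately have "\<Union>F' = space \<mu>" by (simp add: sp)
  moreover have "F' \<subseteq> sets \<mu>" using F' unfolding F_def sets by auto
  moreover have "emeasure \<mu> U \<noteq> \<infinity>" if U: "U \<in> F'" for U
  proof -
    obtain C where C: "compact C" "U \<subseteq> C" using U F' unfolding F_def by auto
    have "emeasure \<mu> U \<le> emeasure \<mu> C"
      by (rule emeasure_mono) (use C in \<open>auto simp: sets compact_imp_closed\<close>)
    then show ?thesis using cpt C(1) by (auto simp: less_top top_unique)
  qed
  ultimately show "\<exists>A. countable A \<and> A \<subseteq> sets \<mu> \<and> \<Union>A = space \<mu> \<and> (\<forall>a\<in>A. emeasure \<mu> a \<noteq> \<infinity>)"
    using F'(2) by (intro exI[of _ F'] conjI ballI) simp_all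
qed

text \<open>The trace-class condition, applied to the eigenfunctions themselves.\<close>

lemma eigenvalues_summable:
  assumes tc: "trace_class_kernel \<mu> K" and sa: "nonneg_selfadjoint_kernel \<mu> K"
    and eig: "\<And>k. k \<in> J \<Longrightarrow> eigenfunction \<mu> K UNIV (\<psi> k) (\<kappa> k)"
    and nonneg: "\<And>k. k \<in> J \<Longrightarrow> 0 \<le> \<kappa> k"
    and on: "orthonormal_on \<mu> UNIV J \<psi>"
  shows "summable (\<lambda>k. if k \<in> J then \<kappa> k else 0)"
proof -
  have val: "cmod (L2_inner \<mu> UNIV (integral_op \<mu> K UNIV (\<psi> k)) (\<psi> k)) = \<kappa> k" if k: "k \<in> J" for k
  proof -
    have L2: "L2_on \<mu> UNIV (\<psi> k)" using eig[OF k] by (simp add: eigenfunction_def)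
    then have m1: "\<psi> k \<in> borel_measurable \<mu>" unfolding L2_on_iff_sq_int sq_int_def by simp
    have "L2_on \<mu> UNIV (integral_op \<mu> K UNIV (\<psi> k))"
      using sa L2 unfolding nonneg_selfadjoint_kernel_def by blast
    then have m2: "integral_op \<mu> K UNIV (\<psi> k) \<in> borel_measurable \<mu>" unfolding L2_on_iff_sq_int sq_int_def by simp
    have "ip \<mu> (integral_op \<mu> K UNIV (\<psi> k)) (\<psi> k) = ip \<mu> (\<lambda>x. complex_of_real (\<kappa> k) * \<psi> k x) (\<psi> k)"
      unfolding ip_def
    proof (rule integral_cong_AE)
      have [measurable]: "cnj \<in> borel_measurable borel"
        by (intro borel_measurable_continuous_onI continuous_intros)
      note [measurable] = m1 m2
      show "(\<lambda>x. integral_op \<mu> K UNIV (\<psi> k) x * cnj (\<psi> k x)) \<in> borel_measurable \<mu>"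
        "(\<lambda>x. complex_of_real (\<kappa> k) * \<psi> k x * cnj (\<psi> k x)) \<in> borel_measurable \<mu>"
        by measurable
      show "AE x in \<mu>. integral_op \<mu> K UNIV (\<psi> k) x * cnj (\<psi> k x) = complex_of_real (\<kappa> k) * \<psi> k x * cnj (\<psi> k x)"
        using eig[OF k] unfolding eigenfunction_def by (auto elim: eventually_mono)
    qed
    also have "\<dots> = complex_of_real (\<kappa> k)"
      using on k unfolding orthonormal_on_def L2_inner_eq_ip by (simp add: ip_scale_left)
    finally show ?thesis using nonneg[OF k] by (simp add: L2_inner_eq_ip)
  qed
  have "(\<lambda>k. cmod (L2_inner \<mu> UNIV (integral_op \<mu> K UNIV (\<psi> k)) (\<psi> k))) summable_on J"
    using tc on unfolding trace_class_kernel_def by blast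
  then have "\<kappa> summable_on J" by (rule summable_on_cong[THEN iffD1, rotated]) (simp add: val)
  then have "(\<lambda>k. if k \<in> J then \<kappa> k else 0) summable_on UNIV"
    by (rule summable_on_cong_neutral[THEN iffD1, rotated -1]) auto
  then show ?thesis by (rule summable_on_imp_summable)
qed

lemma kernel_expansionI:
  fixes \<mu> :: "'a measure"
  assumes tc: "trace_class_kernel \<mu> K" and sa: "nonneg_selfadjoint_kernel \<mu> K"
    and eig: "\<forall>k\<in>J. eigenfunction \<mu> K UNIV (\<psi> k) (\<kappa> k) \<and> 0 \<le> \<kappa> k \<and> \<kappa> k \<le> 1"
    and on: "orthonormal_on \<mu> UNIV J \<psi>"
    and N: "N \<in> null_sets \<mu>"
    and exp: "\<forall>x\<in>- N. \<forall>y\<in>- N. ((\<lambda>k. complex_of_real (\<kappa> k) * \<psi> k x * cnj (\<psi> k y)) has_sum K x y) J"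
  shows "kernel_expansion \<mu> K (\<lambda>k. if k \<in> J then \<kappa> k else 0) (\<lambda>k x. if k \<in> J then \<psi> k x else 0) N"
proof
  have s: "sq_int \<mu> (\<psi> k)" if "k \<in> J" for k
    using eig that unfolding eigenfunction_def L2_on_iff_sq_int by simp
  have n: "sqnorm \<mu> (\<psi> k) = 1" if "k \<in> J" for k
    using on that ip_self[of \<mu> "\<psi> k"] unfolding orthonormal_on_def L2_inner_eq_ip by simp
  show "sq_int \<mu> (\<lambda>x. if k \<in> J then \<psi> k x else 0)" for k using s by (cases "k \<in> J") auto
  show "sqnorm \<mu> (\<lambda>x. if k \<in> J then \<psi> k x else 0) \<le> 1" for k
    using n by (cases "k \<in> J") (auto simp: sqnorm_def)
  show "0 \<le> (if k \<in> J then \<kappa> k else 0)" for k using eig by simp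
  show "summable (\<lambda>k. if k \<in> J then \<kappa> k else 0)"
    by (rule eigenvalues_summable[OF tc sa _ _ on]) (use eig in auto)
  show "N \<in> null_sets \<mu>" by (rule N)
  show "K x \<in> borel_measurable \<mu>" if "x \<in> space \<mu>" for x
  proof -
    have "case_prod K \<in> borel_measurable (\<mu> \<Otimes>\<^sub>M \<mu>)"
      using sa unfolding nonneg_selfadjoint_kernel_def by blast
    from measurable_compose[OF measurable_Pair1'[OF that] this] show ?thesis by simp
  qed
  show "(\<lambda>n. complex_of_real (if n \<in> J then \<kappa> n else 0) * (if n \<in> J then \<psi> n x else 0) * cnj (if n \<in> J then \<psi> n y else 0)) sums K x y"
    if "x \<in> space \<mu> - N" "y \<in> space \<mu> - N" for x y
  proof -
    have "((\<lambda>k. complex_of_real (\<kappa> k) * \<psi> k x * cnj (\<psi> k y)) has_sum K x y) J"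
      using exp that by simp
    then have "((\<lambda>n. complex_of_real (if n \<in> J then \<kappa> n else 0) * (if n \<in> J then \<psi> n x else 0) * cnj (if n \<in> J then \<psi> n y else 0)) has_sum K x y) UNIV"
      by (rule has_sum_cong_neutral[THEN iffD1, rotated -1]) auto
    then show ?thesis by (rule has_sum_imp_sums)
  qed
qed

text \<open>The probabilities of the balls. With \<open>e k\<close> the eigenfunction \<open>\<phi> k\<close> normalized in \<open>L\<^sup>2\<close> of the
  union and extended by 0, the union's kernel is \<open>\<Sum>k. c k * e k x * cnj (e k y)\<close>. Restricting this
  expansion to a piece, where the \<open>e k\<close> are still orthogonal, exhibits \<open>e k\<close> as an
  eigenfunction there with eigenvalue \<open>c k * q k i\<close>, where \<open>q k i\<close> is the squared norm of \<open>e k\<close>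
  on \<open>D i\<close>. Summed over the disjoint pieces the \<open>q k i\<close> give at most 1, and \<open>c k \<le> 1\<close> since
  the eigenvalues \<open>\<kappa>\<close> are at most 1. Indices outside \<open>I\<close> are filled with \<open>c k = 0\<close> and \<open>e k = 0\<close>.\<close>

lemma piecewise_spectral_data:
  fixes \<mu> :: "'a measure" and D :: "'r::finite \<Rightarrow> 'a set"
  assumes tc: "trace_class_kernel \<mu> K" and sa: "nonneg_selfadjoint_kernel \<mu> K"
    and eig: "\<forall>k\<in>J. eigenfunction \<mu> K UNIV (\<psi> k) (\<kappa> k) \<and> 0 \<le> \<kappa> k \<and> \<kappa> k \<le> 1"
    and on: "orthonormal_on \<mu> UNIV J \<psi>"
    and N: "N \<in> null_sets \<mu>"
    and exp: "\<forall>x\<in>- N. \<forall>y\<in>- N. ((\<lambda>k. complex_of_real (\<kappa> k) * \<psi> k x * cnj (\<psi> k y)) has_sum K x y) J"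
    and D: "\<And>i. D i \<in> sets \<mu>" "disjoint_family D"
    and common: "common_eigenfunctions \<mu> K D I \<phi> lam"
  obtains c e q N' where "\<forall>k. sq_int \<mu> (e k) \<and> sqnorm \<mu> (e k) \<le> 1" "\<forall>k. 0 \<le> c k \<and> c k \<le> 1"
      "summable c" "N' \<in> null_sets \<mu>"
      "\<forall>x\<in>space \<mu> \<inter> (\<Union>i. D i) - N'. \<forall>y\<in>space \<mu> \<inter> (\<Union>i. D i) - N'.
         (\<lambda>k. complex_of_real (c k) * e k x * cnj (e k y)) sums K x y"
      "\<forall>i k l. (\<integral>x. indicator (D i) x * (e k x * cnj (e l x)) \<partial>\<mu>) = (if k = l then complex_of_real (q k i) else 0)"
      "\<forall>k i. 0 \<le> q k i" "\<forall>k. (\<Sum>i\<in>UNIV. q k i) \<le> 1"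
      "\<forall>k i. (if k \<in> I then lam k i else 0) = c k * q k i"
proof -
  define DD where "DD = (\<Union>i. D i)"
  have DDm: "DD \<in> sets \<mu>" unfolding DD_def using D(1) by auto
  interpret W: kernel_expansion \<mu> K "\<lambda>k. if k \<in> J then \<kappa> k else 0" "\<lambda>k x. if k \<in> J then \<psi> k x else 0" N
    by (rule kernel_expansionI[OF tc sa eig on N exp])
  define G where "G x y = indicator DD x * indicator DD y * K x y" for x y
  interpret W': kernel_expansion \<mu> G "\<lambda>k. if k \<in> J then \<kappa> k else 0"
    "\<lambda>k x. indicator DD x * (if k \<in> J then \<psi> k x else 0)" N
    using W.restrict_expansion[OF DDm] unfolding G_def[abs_def] .
  obtain c0 where es: "eigensystem \<mu> K DD I \<phi> c0"
    using common unfolding common_eigenfunctions_def DD_def by blast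
  define f where "f k = (\<lambda>x. indicator DD x * \<phi> k x)" for k
  have fs: "sq_int \<mu> (f k)" if "k \<in> I" for k
    using es that unfolding eigensystem_def orthogonal_on_def L2_on_iff_sq_int f_def by blast
  define s where "s k = sqrt (sqnorm \<mu> (f k))" for k
  have s: "0 < s k" if k: "k \<in> I" for k
  proof -
    have "\<not> (AE x in \<mu>. x \<in> DD \<longrightarrow> \<phi> k x = 0)"
      using es k unfolding eigensystem_def eigenfunction_def by blast
    then have "\<not> (AE x in \<mu>. f k x = 0)"
      unfolding f_def by (auto elim!: eventually_mono simp: indicator_def split: if_splits)
    then have "sqnorm \<mu> (f k) \<noteq> 0" using sqnorm_eq_0_AE[OF fs[OF k]] by blast
    then show ?thesis unfolding s_def using sqnorm_nonneg[of \<mu> "f k"] by (simp add: less_le)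
  qed
  define e where "e k = (\<lambda>x. if k \<in> I then complex_of_real (1 / s k) * f k x else 0)" for k
  have e_in: "e k = (\<lambda>x. complex_of_real (1 / s k) * f k x)" if "k \<in> I" for k
    using that by (simp add: e_def)
  have e_out: "e k = (\<lambda>x. 0)" if "k \<notin> I" for k
    using that by (simp add: e_def)
  have e_sq: "sq_int \<mu> (e k)" for k
    by (cases "k \<in> I") (auto simp: e_in e_out intro: sq_int_scale fs simp del: of_real_divide)
  have e_DD: "indicator DD x * e k x = e k x" for k x
    by (auto simp: e_def f_def indicator_def)
  have eo: "orthonormal \<mu> I e"
    unfolding orthonormal_def
  proof (intro conjI ballI e_sq)
    fix k l assume kl: "k \<in> I" "l \<in> I"
    have *: "ip \<mu> (e k) (e l) = complex_of_real (1 / s k) * (complex_of_real (1 / s l) * ip \<mu> (f k) (f l))"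
      unfolding e_in[OF kl(1)] e_in[OF kl(2)] ip_scale_left ip_scale_right complex_cnj_complex_of_real ..
    show "ip \<mu> (e k) (e l) = (if k = l then 1 else 0)"
    proof (cases "k = l")
      case True
      have "sqnorm \<mu> (f k) = s k * s k" unfolding s_def by simp
      then have "ip \<mu> (f k) (f l) = complex_of_real (s k * s k)"
        using True ip_self[of \<mu> "f k"] by simp
      then show ?thesis using s[OF kl(1)] True unfolding * by simp
    next
      case False
      then have "ip \<mu> (f k) (f l) = 0"
        using es kl unfolding eigensystem_def orthogonal_on_def L2_inner_eq_ip f_def by blast
      then show ?thesis using False unfolding * by simp
    qed
  qed
  have e_norm: "sqnorm \<mu> (e k) \<le> 1" for k
  proof (cases "k \<in> I")
    case True
    then show ?thesis using eo ip_self[of \<mu> "e k"] by (simp add: orthonormal_def)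
  qed (simp add: e_out sqnorm_def)
  have e_eig: "AE x in \<mu>. W'.op (e k) x = complex_of_real (c0 k) * e k x" if k: "k \<in> I" for k
  proof -
    have "AE x in \<mu>. x \<in> DD \<longrightarrow> integral_op \<mu> K DD (\<phi> k) x = complex_of_real (c0 k) * \<phi> k x"
      using es k unfolding eigensystem_def eigenfunction_def by blast
    then show ?thesis
    proof eventually_elim
      case (elim x)
      have "W'.op (e k) x = (\<integral>y. indicator DD x * complex_of_real (1 / s k) * (K x y * (indicator DD y * \<phi> k y)) \<partial>\<mu>)"
        unfolding W'.op_def e_in[OF k] f_def G_def
        by (rule Bochner_Integration.integral_cong) (auto simp: indicator_def)
      also have "\<dots> = indicator DD x * complex_of_real (1 / s k) * integral_op \<mu> K DD (\<phi> k) x"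
        unfolding integral_op_eq by (rule integral_mult_right_zero)
      also have "\<dots> = complex_of_real (c0 k) * e k x"
        using elim unfolding e_in[OF k] f_def by (auto simp: indicator_def)
      finally show ?case .
    qed
  qed
  have compl: "AE x in \<mu>. W'.op g x = 0"
    if g: "sq_int \<mu> g" and orth: "\<And>k. k \<in> I \<Longrightarrow> ip \<mu> g (e k) = 0" for g
  proof -
    have "L2_on \<mu> DD g" unfolding L2_on_iff_sq_int by (rule sq_int_indicator[OF g DDm])
    moreover have "L2_inner \<mu> DD g (\<phi> k) = 0" if k: "k \<in> I" for k
    proof -
      have "ip \<mu> g (e k) = complex_of_real (1 / s k) * ip \<mu> g (f k)"
        unfolding e_in[OF k] ip_scale_right complex_cnj_complex_of_real ..
      then have "ip \<mu> g (f k) = 0" using orth[OF k] s[OF k] by simp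
      moreover have "ip \<mu> g (f k) = L2_inner \<mu> DD g (\<phi> k)"
        unfolding L2_inner_eq_ip f_def ip_def
        by (rule Bochner_Integration.integral_cong) (auto simp: indicator_def)
      ultimately show ?thesis by simp
    qed
    ultimately have "AE x in \<mu>. x \<in> DD \<longrightarrow> integral_op \<mu> K DD g x = 0"
      using es unfolding eigensystem_def by blast
    then show ?thesis
    proof eventually_elim
      case (elim x)
      have "W'.op g x = (\<integral>y. indicator DD x * (K x y * (indicator DD y * g y)) \<partial>\<mu>)"
        unfolding W'.op_def G_def by (rule Bochner_Integration.integral_cong) (auto simp: mult_ac)
      also have "\<dots> = indicator DD x * integral_op \<mu> K DD g x"
        unfolding integral_op_eq by (rule integral_mult_right_zero)
      also have "\<dots> = 0" using elim by (auto simp: indicator_def)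
      finally show ?case .
    qed
  qed
  define c where "c k = (if k \<in> I then c0 k else 0)" for k
  have c0: "0 \<le> c0 k" if "k \<in> I" for k
    by (rule W'.eigen_expansion(1)[OF eo e_eig compl that])
  have csum: "summable c"
    unfolding c_def by (rule W'.eigen_expansion(2)[OF eo e_eig compl])
  obtain N' where N': "N' \<in> null_sets \<mu>"
    "\<And>x y. x \<in> space \<mu> - N' \<Longrightarrow> y \<in> space \<mu> - N' \<Longrightarrow>
      (\<lambda>k. if k \<in> I then complex_of_real (c0 k) * e k x * cnj (e k y) else 0) sums G x y"
    using W'.eigen_expansion(3)[OF eo e_eig compl] by blast
  have G_sums: "(\<lambda>k. complex_of_real (c k) * e k x * cnj (e k y)) sums G x y"
    if "x \<in> space \<mu> - N'" "y \<in> space \<mu> - N'" for x y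
  proof -
    have "(\<lambda>k. if k \<in> I then complex_of_real (c0 k) * e k x * cnj (e k y) else 0) =
      (\<lambda>k. complex_of_real (c k) * e k x * cnj (e k y))" by (auto simp: c_def)
    then show ?thesis using N'(2)[OF that] by simp
  qed
  interpret E: kernel_expansion \<mu> G c e N'
    by standard (use c0 csum e_sq e_norm N'(1) W'.G_meas G_sums in \<open>auto simp: c_def\<close>)

  \<comment> \<open>The form at \<open>e k\<close> is a sum of squared coefficients with weights \<open>\<kappa> n \<le> 1\<close>; Bessel's
    inequality for the \<open>\<psi> n\<close> bounds it by the squared norm of \<open>e k\<close>.\<close>
  have c_le: "c k \<le> 1" for k
  proof (cases "k \<in> I")
    case True
    have meas: "(\<lambda>x. complex_of_real (c0 k) * e k x) \<in> borel_measurable \<mu>"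
      by (rule sq_int_measurable[OF sq_int_scale[OF e_sq]])
    let ?a = "\<lambda>n. if n \<in> J then \<kappa> n else 0" and ?u = "\<lambda>n x. indicator DD x * (if n \<in> J then \<psi> n x else 0)"
    have 1: "complex_of_real (?a n) * ip \<mu> (e k) (?u n) * ip \<mu> (?u n) (e k) = complex_of_real (?a n * (cmod (ip \<mu> (e k) (?u n)))\<^sup>2)" for n
      unfolding of_real_mult complex_norm_square ip_cnj by (simp add: mult.assoc)
    have 2: "ip \<mu> (\<lambda>x. complex_of_real (c0 k) * e k x) (e k) = complex_of_real (c k)"
      using eo True by (simp add: ip_scale_left orthonormal_def c_def)
    have "(\<lambda>n. complex_of_real (?a n * (cmod (ip \<mu> (e k) (?u n)))\<^sup>2)) sums complex_of_real (c k)"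
      using W'.form_sums[OF e_sq e_sq meas e_eig[OF True], of k] unfolding 1 2 .
    then have sums: "(\<lambda>n. ?a n * (cmod (ip \<mu> (e k) (?u n)))\<^sup>2) sums c k"
      unfolding sums_of_real_iff .
    have psi_on: "orthonormal \<mu> J \<psi>"
      using on unfolding orthonormal_on_def orthogonal_on_def orthonormal_def L2_on_iff_sq_int L2_inner_eq_ip
      by auto
    have "(\<Sum>n<m. ?a n * (cmod (ip \<mu> (e k) (?u n)))\<^sup>2) \<le> 1" for m
    proof -
      have "(\<Sum>n<m. ?a n * (cmod (ip \<mu> (e k) (?u n)))\<^sup>2) \<le> (\<Sum>n<m. if n \<in> J then (cmod (ip \<mu> (e k) (\<psi> n)))\<^sup>2 else 0)"
      proof (rule sum_mono)
        fix n
        show "?a n * (cmod (ip \<mu> (e k) (?u n)))\<^sup>2 \<le> (if n \<in> J then (cmod (ip \<mu> (e k) (\<psi> n)))\<^sup>2 else 0)"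
        proof (cases "n \<in> J")
          case n: True
          have "ip \<mu> (e k) (?u n) = ip \<mu> (e k) (\<psi> n)"
            unfolding ip_def using e_DD[of _ k] n
            by (intro Bochner_Integration.integral_cong refl) (auto simp: indicator_def split: if_splits)
          moreover have "\<kappa> n \<le> 1" "0 \<le> \<kappa> n" using eig n by auto
          ultimately show ?thesis using n by (simp add: mult_left_le_one_le)
        qed simp
      qed
      also have "\<dots> = (\<Sum>n\<in>{..<m} \<inter> J. (cmod (ip \<mu> (e k) (\<psi> n)))\<^sup>2)"
        by (rule sum.inter_restrict[symmetric]) simp
      also have "\<dots> \<le> sqnorm \<mu> (e k)"
        by (rule Bessel[OF psi_on _ _ e_sq]) auto
      also have "\<dots> \<le> 1" by (rule e_norm)
      finally show ?thesis .
    qed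
    then show ?thesis
      using sums unfolding sums_def by (intro LIMSEQ_le_const2[of _ "c k" 1]) auto
  qed (simp add: c_def)

  define q where "q k i = sqnorm \<mu> (\<lambda>x. indicator (D i) x * e k x)" for k i
  have on_D: "(\<integral>x. indicator (D i) x * (e k x * cnj (e l x)) \<partial>\<mu>) = (if k = l then complex_of_real (q k i) else 0)" for i k l
  proof (cases "k = l")
    case True
    then show ?thesis unfolding ip_indicator(1)[symmetric] q_def by (simp add: ip_self)
  next
    case False
    define V where "V k \<longleftrightarrow> (AE x in \<mu>. x \<in> D i \<longrightarrow> \<phi> k x = 0)" for k
    have Di: "eigensystem \<mu> K (D i) {k \<in> I. \<not> V k} \<phi> (\<lambda>k. lam k i)"
      using common unfolding common_eigenfunctions_def V_def by blast
    \<comment> \<open>Orthogonality on \<open>D i\<close> is given only between functions that do not vanish there.\<close>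
    have "ip \<mu> (\<lambda>x. indicator (D i) x * e k x) (\<lambda>x. indicator (D i) x * e l x) = 0"
    proof (cases "k \<in> I \<and> l \<in> I \<and> \<not> V k \<and> \<not> V l")
      case True
      then have "L2_inner \<mu> (D i) (\<phi> k) (\<phi> l) = 0"
        using Di False unfolding eigensystem_def orthogonal_on_def by blast
      moreover have "indicator (D i) x * e k x = complex_of_real (1 / s k) * (indicator (D i) x * \<phi> k x)" if "k \<in> I" for k x
        unfolding e_in[OF that] f_def DD_def by (auto simp: indicator_def)
      ultimately show ?thesis
        using True by (simp only: ip_scale_left ip_scale_right L2_inner_eq_ip mult_zero_right)
    next
      case not: False
      have z: "AE x in \<mu>. indicator (D i) x * e k x = 0" if "k \<notin> I \<or> V k" for k
        using that
      proof
        assume "V k"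
        then show ?thesis unfolding V_def
          by eventually_elim (auto simp: e_def f_def indicator_def)
      qed (simp add: e_out)
      have "AE x in \<mu>. (indicator (D i) x * e k x) * cnj (indicator (D i) x * e l x) = 0"
      proof (cases "k \<notin> I \<or> V k")
        case True
        from z[OF this] show ?thesis by eventually_elim simp
      next
        case False
        then have "l \<notin> I \<or> V l" using not by blast
        from z[OF this] show ?thesis by eventually_elim simp
      qed
      then show ?thesis unfolding ip_def by (rule integral_eq_zero_AE)
    qed
    then show ?thesis using False unfolding ip_indicator(1) by simp
  qed

  have lam_eq: "(if k \<in> I then lam k i else 0) = c k * q k i" for k i
  proof (cases "k \<in> I")
    case k: True
    show ?thesis
    proof (cases "AE x in \<mu>. x \<in> D i \<longrightarrow> \<phi> k x = 0")
      case True
      then have "lam k i = 0" using common k unfolding common_eigenfunctions_def by blast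
      moreover have "AE x in \<mu>. indicator (D i) x * e k x = 0"
        using True by eventually_elim (auto simp: e_def f_def indicator_def)
      then have "q k i = 0" unfolding q_def using sqnorm_eq_0_AE[OF sq_int_indicator[OF e_sq D(1)]] by blast
      ultimately show ?thesis by simp
    next
      case nz: False
      define g where "g x = indicator (D i) x * e k x" for x
      have gs: "sq_int \<mu> g" unfolding g_def by (rule sq_int_indicator[OF e_sq D(1)])
      have g_eq: "g x = complex_of_real (1 / s k) * (indicator (D i) x * \<phi> k x)" for x
        unfolding g_def e_in[OF k] f_def DD_def by (auto simp: indicator_def)
      have "\<not> (AE x in \<mu>. g x = 0)"
        using nz s[OF k] unfolding g_eq by (auto elim!: eventually_mono simp: indicator_def split: if_splits)
      then have q0: "q k i \<noteq> 0"
        unfolding q_def using sqnorm_eq_0_AE[OF gs] by (simp add: g_def[abs_def])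
      interpret Ei: kernel_expansion \<mu> "\<lambda>x y. indicator (D i) x * indicator (D i) y * G x y" c
        "\<lambda>n x. indicator (D i) x * e n x" N'
        by (rule E.restrict_expansion[OF D(1)])
      have "eigensystem \<mu> K (D i) {k\<in>I. \<not> (AE x\<in>D i in \<mu>. \<phi> k x = 0)} \<phi> (\<lambda>k. lam k i)"
        using common unfolding common_eigenfunctions_def by blast
      then have "AE x in \<mu>. x \<in> D i \<longrightarrow> integral_op \<mu> K (D i) (\<phi> k) x = complex_of_real (lam k i) * \<phi> k x"
        using k nz unfolding eigensystem_def eigenfunction_def by blast
      then have "AE x in \<mu>. Ei.op g x = complex_of_real (lam k i) * g x"
      proof eventually_elim
        case (elim x)
        have "Ei.op g x = (\<integral>y. indicator (D i) x * complex_of_real (1 / s k) * (K x y * (indicator (D i) y * \<phi> k y)) \<partial>\<mu>)"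
          unfolding Ei.op_def
          by (rule Bochner_Integration.integral_cong) (auto simp: g_eq G_def DD_def indicator_def)
        also have "\<dots> = indicator (D i) x * complex_of_real (1 / s k) * integral_op \<mu> K (D i) (\<phi> k) x"
          unfolding integral_op_eq by (rule integral_mult_right_zero)
        also have "\<dots> = complex_of_real (lam k i) * g x"
          using elim unfolding g_eq by (auto simp: indicator_def)
        finally show ?case .
      qed
      \<comment> \<open>The form at \<open>g\<close> is \<open>lam k i * q k i\<close> by the eigenvalue equation on the piece, and by the expansion
        only the term \<open>c k * q k i * q k i\<close> survives.\<close>
      from Ei.form_sums[OF gs gs sq_int_measurable[OF sq_int_scale[OF gs]] this]
      have "(\<lambda>n. complex_of_real (c n) * ip \<mu> g (\<lambda>x. indicator (D i) x * e n x) * ip \<mu> (\<lambda>x. indicator (D i) x * e n x) g)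
        sums (complex_of_real (lam k i) * complex_of_real (q k i))"
        unfolding ip_scale_left ip_self q_def g_def[abs_def] .
      moreover have "complex_of_real (c n) * ip \<mu> g (\<lambda>x. indicator (D i) x * e n x) * ip \<mu> (\<lambda>x. indicator (D i) x * e n x) g
        = (if n = k then complex_of_real (c k * q k i * q k i) else 0)" for n
        unfolding g_def[abs_def] ip_indicator(1) on_D by simp
      ultimately have "(\<lambda>n. if n = k then complex_of_real (c k * q k i * q k i) else 0) sums (complex_of_real (lam k i) * complex_of_real (q k i))"
        by simp
      moreover have "(\<lambda>n. if n = k then complex_of_real (c k * q k i * q k i) else 0) sums complex_of_real (c k * q k i * q k i)"
        by (rule sums_single)
      ultimately have "complex_of_real (lam k i * q k i) = complex_of_real (c k * q k i * q k i)"
        unfolding of_real_mult using sums_unique2 by metis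
      then have "lam k i * q k i = c k * q k i * q k i" by (simp only: of_real_eq_iff)
      then show ?thesis using q0 k by simp
    qed
  qed (simp add: c_def)

  have q_sum: "(\<Sum>i\<in>UNIV. q k i) \<le> 1" for k
  proof -
    have "(\<Sum>i\<in>UNIV. q k i) = (\<integral>x. (\<Sum>i\<in>UNIV. (cmod (indicator (D i) x * e k x))\<^sup>2) \<partial>\<mu>)"
      unfolding q_def sqnorm_def using sq_int_indicator[OF e_sq D(1)]
      by (subst Bochner_Integration.integral_sum) (auto simp: sq_int_def)
    also have "\<dots> \<le> sqnorm \<mu> (e k)"
      unfolding sqnorm_def
    proof (rule integral_mono)
      show "integrable \<mu> (\<lambda>x. \<Sum>i\<in>UNIV. (cmod (indicator (D i) x * e k x))\<^sup>2)"
        using sq_int_indicator[OF e_sq D(1)] by (auto simp: sq_int_def)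
      show "integrable \<mu> (\<lambda>x. (cmod (e k x))\<^sup>2)" using e_sq by (simp add: sq_int_def)
      fix x
      show "(\<Sum>i\<in>UNIV. (cmod (indicator (D i) x * e k x))\<^sup>2) \<le> (cmod (e k x))\<^sup>2"
      proof (cases "\<exists>i. x \<in> D i")
        case True
        then obtain i where i: "x \<in> D i" by blast
        then have "x \<in> D j \<longleftrightarrow> j = i" for j using D(2) unfolding disjoint_family_on_def by blast
        then have "(\<Sum>j\<in>UNIV. (cmod (indicator (D j) x * e k x))\<^sup>2) = (\<Sum>j\<in>UNIV. if j = i then (cmod (e k x))\<^sup>2 else 0)"
          by (intro sum.cong) (auto simp: indicator_def)
        then show ?thesis by simp
      qed simp
    qed
    also have "\<dots> \<le> 1" by (rule e_norm)
    finally show ?thesis .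
  qed

  have K_sums: "(\<lambda>k. complex_of_real (c k) * e k x * cnj (e k y)) sums K x y"
    if "x \<in> space \<mu> \<inter> DD - N'" "y \<in> space \<mu> \<inter> DD - N'" for x y
    using G_sums[of x y] that by (simp add: G_def)
  show thesis
  proof (rule that[of e c N' q])
    show "\<forall>x\<in>space \<mu> \<inter> (\<Union>i. D i) - N'. \<forall>y\<in>space \<mu> \<inter> (\<Union>i. D i) - N'.
         (\<lambda>k. complex_of_real (c k) * e k x * cnj (e k y)) sums K x y"
      using K_sums unfolding DD_def by blast
  qed (use e_sq e_norm E.a_nonneg c_le csum N'(1) on_D q_sum lam_eq in \<open>simp_all add: q_def\<close>)
qed

section \<open>The law of the counts\<close>

lemma det_kernel_not_inj:
  fixes x :: "nat \<Rightarrow> 'a" and K :: "'a \<Rightarrow> 'a \<Rightarrow> complex"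
  assumes "\<not> inj_on x {..<n}"
  shows "Determinant.det (Matrix.mat n n (\<lambda>(i, j). K (x i) (x j))) = 0"
proof -
  obtain i j where ij: "i < n" "j < n" "i \<noteq> j" "x i = x j" using assms by (auto simp: inj_on_def)
  have "row (Matrix.mat n n (\<lambda>(i, j). K (x i) (x j))) i = row (Matrix.mat n n (\<lambda>(i, j). K (x i) (x j))) j"
    using ij by (intro eq_vecI) auto
  from Determinant.det_identical_rows[OF mat_carrier ij(3,1,2) this] show ?thesis .
qed

text \<open>The expected number of points is the integral of the first intensity \<open>K x x\<close>, that is, the
  trace.\<close>

lemma expected_total_mass_finite:
  fixes X :: "'w \<Rightarrow> 'a::polish_space measure"
  assumes sf: "sigma_finite_measure \<mu>" and sets: "sets \<mu> = sets borel"
    and ji: "joint_intensities M X \<mu> \<rho>"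
    and det: "\<And>x. x \<in> (\<Pi>\<^sub>E i\<in>{..<1::nat}. UNIV) \<Longrightarrow> complex_of_real (\<rho> 1 x) = Determinant.det (Matrix.mat 1 1 (\<lambda>(i, j). K (x i) (x j)))"
    and exp: "kernel_expansion \<mu> K a u N"
    and pp: "point_process M X"
  shows "AE \<omega> in M. emeasure (X \<omega>) UNIV < \<infinity>"
proof -
  interpret kernel_expansion \<mu> K a u N by (rule exp)
  interpret product_sigma_finite "\<lambda>_::nat. \<mu>"
    using sf by (simp add: product_sigma_finite_def)
  have sp: "space \<mu> = UNIV" using sets_eq_imp_space_eq[OF sets] by simp
  note [measurable] = sq_int_measurable[OF u_sq_int]
  define d where "d y = (\<Sum>n. a n * (cmod (u n y))\<^sup>2)" for y
  have dm [measurable]: "d \<in> borel_measurable \<mu>" unfolding d_def by measurable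
  have dK: "AE y in \<mu>. Re (K y y) = d y"
    using AE_N by eventually_elim (use diag_sums in \<open>auto simp: d_def sums_iff\<close>)
  have I1: "{..<1::nat} = {0}" by auto
  have "AE x in Pi\<^sub>M {..<1::nat} (\<lambda>_. \<mu>). Re (K (x 0) (x 0)) = d (x 0)"
    by (rule AE_PiM_sigma_finite_component[OF sf _ _ dK]) auto
  moreover have "AE x in Pi\<^sub>M {..<1::nat} (\<lambda>_. \<mu>). x \<in> (\<Pi>\<^sub>E i\<in>{..<1::nat}. UNIV)"
    using AE_space by eventually_elim (simp add: space_PiM sp)
  ultimately have ae: "AE x in Pi\<^sub>M {..<1::nat} (\<lambda>_. \<mu>). x \<in> (\<Pi>\<^sub>E i\<in>{..<1::nat}. UNIV) \<and> \<rho> 1 x = d (x 0)"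
  proof eventually_elim
    case (elim x)
    have "complex_of_real (\<rho> 1 x) = K (x 0) (x 0)"
      unfolding det[OF elim(2)] by (subst det_single) simp_all
    then show ?case using elim by (metis Re_complex_of_real)
  qed
  have "(\<integral>\<^sup>+\<omega>. (\<Prod>i\<in>{..<1::nat}. emeasure (X \<omega>) UNIV) \<partial>M) = (\<integral>\<^sup>+x\<in>(\<Pi>\<^sub>E i\<in>{..<1::nat}. UNIV). ennreal (\<rho> 1 x) \<partial>Pi\<^sub>M {..<1::nat} (\<lambda>_. \<mu>))"
    using ji unfolding joint_intensities_def
    by (elim allE[of _ "1::nat"] impE conjE allE[of _ "\<lambda>_. UNIV"]) (auto simp: disjoint_family_on_def)
  also have "\<dots> = (\<integral>\<^sup>+x. ennreal (d (x 0)) \<partial>Pi\<^sub>M {..<1::nat} (\<lambda>_. \<mu>))"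
    by (rule nn_integral_cong_AE, use ae in eventually_elim) simp
  also have "\<dots> = (\<integral>\<^sup>+y. ennreal (d y) \<partial>\<mu>)"
    unfolding I1 by (rule product_nn_integral_singleton) measurable
  also have "\<dots> = (\<integral>\<^sup>+y. ennreal (Re (K y y)) \<partial>\<mu>)"
    by (rule nn_integral_cong_AE, use dK in eventually_elim) simp
  also have "\<dots> < \<infinity>"
    unfolding diag_nn_integral using summable_trace a_nonneg by (subst suminf_ennreal2) auto
  finally have "(\<integral>\<^sup>+\<omega>. emeasure (X \<omega>) UNIV \<partial>M) \<noteq> \<infinity>" by simp
  moreover have "(\<lambda>\<omega>. emeasure (X \<omega>) UNIV) \<in> borel_measurable M"
    using pp unfolding point_process_def by simp
  ultimately have "AE \<omega> in M. emeasure (X \<omega>) UNIV \<noteq> \<infinity>"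
    by (intro nn_integral_PInf_AE)
  then show ?thesis by eventually_elim (simp add: less_top)
qed

theorem proposition9:
  fixes \<mu> :: "'a::polish_space measure"
    and M :: "'w measure"
    and X :: "'w \<Rightarrow> 'a measure"
    and K :: "'a \<Rightarrow> 'a \<Rightarrow> complex"
    and J :: "nat set" and \<kappa> :: "nat \<Rightarrow> real" and \<psi> :: "nat \<Rightarrow> 'a \<Rightarrow> complex"
    and D :: "'r::finite \<Rightarrow> 'a set"
    and I :: "nat set" and \<phi> :: "nat \<Rightarrow> 'a \<Rightarrow> complex" and lam :: "nat \<Rightarrow> 'r \<Rightarrow> real"
  assumes "locally_compact_space (euclidean :: 'a topology)"
    and "radon_measure \<mu>"
    and "prob_space M"
    and "determinantal_process M X \<mu> K"
    and "nonneg_selfadjoint_kernel \<mu> K"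
    and "trace_class_kernel \<mu> K"
    and "\<forall>k\<in>J. eigenfunction \<mu> K UNIV (\<psi> k) (\<kappa> k) \<and> 0 \<le> \<kappa> k \<and> \<kappa> k \<le> 1"
    and "orthonormal_on \<mu> UNIV J \<psi>"
    and "\<exists>N\<in>null_sets \<mu>. \<forall>x\<in>- N. \<forall>y\<in>- N.
           ((\<lambda>k. complex_of_real (\<kappa> k) * \<psi> k x * cnj (\<psi> k y)) has_sum K x y) J"
    and "\<forall>i. D i \<in> sets borel"
    and "disjoint_family D"
    and "simultaneously_observable \<mu> K D"
    and "common_eigenfunctions \<mu> K D I \<phi> lam"
  shows "(\<forall>k\<in>I. (\<Sum>i\<in>UNIV. lam k i) \<le> 1) \<and>
    (AE \<omega> in M. \<forall>i. emeasure (X \<omega>) (D i) < \<infinity>) \<and>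
    (\<exists>(P :: (nat \<Rightarrow> real^'r) measure) (\<xi> :: nat \<Rightarrow> (nat \<Rightarrow> real^'r) \<Rightarrow> real^'r).
       prob_space P \<and>
       prob_space.indep_vars P (\<lambda>_. borel) \<xi> I \<and>
       (\<forall>k\<in>I. \<forall>i. measure P {\<omega>\<in>space P. \<xi> k \<omega> = axis i 1} = lam k i) \<and>
       (\<forall>k\<in>I. measure P {\<omega>\<in>space P. \<xi> k \<omega> = 0} = 1 - (\<Sum>i\<in>UNIV. lam k i)) \<and>
       (AE \<omega> in P. (\<lambda>k. \<xi> k \<omega>) summable_on I) \<and>
       distr M borel (\<lambda>\<omega>. \<chi> i. measure (X \<omega>) (D i)) =
       distr P borel (\<lambda>\<omega>. \<Sum>\<^sub>\<infinity>k\<in>I. \<xi> k \<omega>))"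
proof -
  have sets: "sets \<mu> = sets borel"
    using assms(2) unfolding radon_measure_def by (rule conjunct1)
  have sp: "space \<mu> = UNIV" using sets_eq_imp_space_eq[OF sets] by simp
  have sf: "sigma_finite_measure \<mu>" by (rule radon_sigma_finite[OF assms(1,2)])
  obtain N where N: "N \<in> null_sets \<mu>" "\<forall>x\<in>- N. \<forall>y\<in>- N.
      ((\<lambda>k. complex_of_real (\<kappa> k) * \<psi> k x * cnj (\<psi> k y)) has_sum K x y) J"
    using assms(9) by blast
  have Dm: "D i \<in> sets borel" and Dm': "D i \<in> sets \<mu>" for i using assms(10) sets by auto
  obtain c e q N' where spectral: "\<forall>k. sq_int \<mu> (e k) \<and> sqnorm \<mu> (e k) \<le> 1" "\<forall>k. 0 \<le> c k \<and> c k \<le> 1"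
      "summable c" and N': "N' \<in> null_sets \<mu>"
      and K_sums: "\<forall>x\<in>space \<mu> \<inter> (\<Union>i. D i) - N'. \<forall>y\<in>space \<mu> \<inter> (\<Union>i. D i) - N'.
       (\<lambda>k. complex_of_real (c k) * e k x * cnj (e k y)) sums K x y"
      and orth: "\<forall>i k l. (\<integral>x. indicator (D i) x * (e k x * cnj (e l x)) \<partial>\<mu>) = (if k = l then complex_of_real (q k i) else 0)"
      and q: "\<forall>k i. 0 \<le> q k i" "\<forall>k. (\<Sum>i\<in>UNIV. q k i) \<le> 1"
      and lam: "\<forall>k i. (if k \<in> I then lam k i else 0) = c k * q k i"
    by (rule piecewise_spectral_data[OF assms(6,5,7,8) N Dm' assms(11) assms(13)])
  have ce: "\<And>k. sq_int \<mu> (e k)" "\<And>k. sqnorm \<mu> (e k) \<le> 1" "\<And>k. 0 \<le> c k" "\<And>k. c k \<le> 1" "summable c"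
    using spectral by simp_all
  \<comment> \<open>All natural numbers will index balls; those outside \<open>I\<close> never fall into a cell.\<close>
  define l where "l k i = (if k \<in> I then lam k i else 0)" for k i
  have l_eq: "l k i = c k * q k i" for k i unfolding l_def by (rule lam[rule_format])
  have l_sum: "(\<Sum>i\<in>UNIV. l k i) \<le> c k" for k
    unfolding l_eq sum_distrib_left[symmetric] using spec[OF q(2), of k] ce(3)[of k] by (rule mult_left_le)
  interpret balls: independent_balls l
  proof
    show "0 \<le> l k i" for k i unfolding l_eq using ce(3) q(1) by simp
    show "(\<Sum>i\<in>UNIV. l k i) \<le> 1" for k using l_sum ce(4) by (rule order_trans)
    show "summable (\<lambda>k. \<Sum>i\<in>UNIV. l k i)"
      by (rule summable_comparison_test'[OF ce(5)])
         (use l_sum ce(3) q(1) in \<open>simp add: l_eq sum_nonneg\<close>)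
  qed
  have pp: "point_process M X" and sim: "simple_process M X"
    using assms(4) unfolding determinantal_process_def by blast+
  obtain \<rho> where ji: "joint_intensities M X \<mu> \<rho>"
    and det: "\<And>k x. k \<ge> 1 \<Longrightarrow> x \<in> (\<Pi>\<^sub>E i\<in>{..<k}. UNIV) \<Longrightarrow>
           complex_of_real (\<rho> k x) = Determinant.det (Matrix.mat k k (\<lambda>(i, j). K (x i) (x j)))"
    using assms(4) unfolding determinantal_process_def by blast
  have fin: "AE \<omega> in M. emeasure (X \<omega>) UNIV < \<infinity>"
    by (rule expected_total_mass_finite[OF sf sets ji _ kernel_expansionI[OF assms(6,5,7,8) N] pp])
       (rule det, simp_all)
  have fin_D: "AE \<omega> in M. \<forall>i. emeasure (X \<omega>) (D i) < \<infinity>"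
    using fin AE_space
  proof eventually_elim
    case (elim \<omega>)
    have "sets (X \<omega>) = sets borel"
      using pp elim(2) unfolding point_process_def radon_measure_def by simp
    then have "emeasure (X \<omega>) (D i) \<le> emeasure (X \<omega>) UNIV" for i
      by (intro emeasure_mono) auto
    then show ?case using elim(1) le_less_trans by blast
  qed
  define Nx where "Nx \<omega> i = count_in (X \<omega>) (D i)" for \<omega> i
  have em[measurable]: "(\<lambda>\<omega>. emeasure (X \<omega>) (D i)) \<in> borel_measurable M" for i
    using pp Dm unfolding point_process_def by blast
  have mm[measurable]: "(\<lambda>\<omega>. measure (X \<omega>) (D i)) \<in> borel_measurable M" for i
    unfolding measure_def by measurable
  have Nxm: "Nx \<in> measurable M (count_space UNIV)"
  proof (rule measurable_count_space_fun)
    show "(\<lambda>\<omega>. Nx \<omega> i) \<in> measurable M (count_space UNIV)" for i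
      unfolding Nx_def count_in_def by measurable
  qed
  have moments: "(\<integral>\<^sup>+\<omega>. of_nat (falling_moment (Nx \<omega>) n f) \<partial>M) = (\<integral>\<^sup>+\<omega>. of_nat (falling_moment (balls.cell_count \<omega>) n f) \<partial>balls.joint_law)" for n f
  proof (cases "n = 0")
    case True
    interpret M: prob_space M by (rule assms(3))
    interpret B: prob_space balls.joint_law by (rule balls.prob_space_balls)
    show ?thesis using True by (simp add: falling_moment_def M.emeasure_space_1 B.emeasure_space_1)
  next
    case False
    then have n: "1 \<le> n" by simp
    have spP: "space (Pi\<^sub>M {..<n} (\<lambda>_. \<mu>)) = (\<Pi>\<^sub>E i\<in>{..<n}. UNIV)" by (simp add: space_PiM sp)
    have \<rho>: "\<rho> n \<in> borel_measurable (Pi\<^sub>M {..<n} (\<lambda>_. \<mu>))" "\<And>x. x \<in> (\<Pi>\<^sub>E i\<in>{..<n}. UNIV) \<Longrightarrow> 0 \<le> \<rho> n x"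
      using ji n unfolding joint_intensities_def by blast+
    have van: "\<rho> n x = 0" if "x \<in> extensional {..<n}" "\<not> inj_on x {..<n}" for x
    proof -
      have "x \<in> (\<Pi>\<^sub>E i\<in>{..<n}. UNIV)" using that(1) by (simp add: PiE_def)
      from det[OF n this] show ?thesis unfolding det_kernel_not_inj[OF that(2)] by simp
    qed
    have "(\<lambda>m. ennreal (\<Sum>k | k \<in> {..<n} \<rightarrow>\<^sub>E {..<m} \<and> inj_on k {..<n}. \<Prod>j<n. c (k j) * q (k j) (f j))) \<longlonglongrightarrow>
      (\<integral>\<^sup>+x\<in>(\<Pi>\<^sub>E j\<in>{..<n}. D (f j)). ennreal (\<rho> n x) \<partial>Pi\<^sub>M {..<n} (\<lambda>_. \<mu>))"
    proof (rule nn_integral_det_limit[where K=K and e=e and N=N', OF sf ce(1,2) Dm' ce(3,5) orth[rule_format] N' _ \<rho>(1)])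
      show "(\<lambda>k. complex_of_real (c k) * e k x * cnj (e k y)) sums K x y"
        if "x \<in> D (f i) - N'" "y \<in> D (f j) - N'" for x y i j
        by (rule K_sums[rule_format]) (use that sp in auto)
    qed (use \<rho>(2) det[OF n] spP in auto)
    then have "(\<lambda>m. ennreal (\<Sum>k | k \<in> {..<n} \<rightarrow>\<^sub>E {..<m} \<and> inj_on k {..<n}. \<Prod>j<n. l (k j) (f j))) \<longlonglongrightarrow>
      (\<integral>\<^sup>+\<omega>. of_nat (falling_moment (Nx \<omega>) n f) \<partial>M)"
      unfolding l_eq Nx_def[abs_def]
      by (subst falling_moment_joint_intensity[OF pp sim fin ji sets Dm assms(11) n van]) auto
    then show ?thesis
      using balls.falling_moment_cell_count[where n=n and f=f] by (rule LIMSEQ_unique)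
  qed
  have law: "distr M (count_space UNIV) Nx = distr balls.joint_law (count_space UNIV) balls.cell_count"
    by (rule distr_eqI_falling_moments[OF assms(3) balls.prob_space_balls Nxm balls.cell_count_measurable moments balls.exponential_moment_cell_count])
  define vec where "vec N = (\<chi> i. real (N i))" for N :: "'r \<Rightarrow> nat"
  have vecm: "vec \<in> measurable (count_space UNIV) borel" by simp
  have cnt: "AE \<omega> in M. (\<chi> i. measure (X \<omega>) (D i)) = vec (Nx \<omega>)"
    using fin_D AE_space
  proof eventually_elim
    case (elim \<omega>)
    have "measure (X \<omega>) (D i) = real (Nx \<omega> i)" for i
    proof -
      have "emeasure (X \<omega>) (D i) \<in> range of_nat \<union> {\<infinity>}"
        using pp elim(2) Dm unfolding point_process_def by blast
      then obtain n where "emeasure (X \<omega>) (D i) = of_nat n" using spec[OF elim(1), of i] by auto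
      then show ?thesis by (simp add: Nx_def count_in_def measure_def)
    qed
    then show ?case by (simp add: vec_def)
  qed
  have countm: "(\<lambda>\<omega>. \<chi> i. measure (X \<omega>) (D i)) \<in> borel_measurable M"
    by (subst borel_measurable_euclidean_space) (auto simp: Basis_vec_def inner_axis)
  have summ: "AE \<omega> in balls.joint_law. \<omega> summable_on I \<and> (\<Sum>\<^sub>\<infinity>k\<in>I. \<omega> k) = vec (balls.cell_count \<omega>)"
    unfolding vec_def by (rule balls.AE_sum_of_balls) (simp add: l_def)
  have "distr M borel (\<lambda>\<omega>. \<chi> i. measure (X \<omega>) (D i)) = distr M borel (vec \<circ> Nx)"
    by (rule distr_cong_AE) (use cnt countm measurable_comp[OF Nxm vecm] in auto)
  also have "\<dots> = distr (distr M (count_space UNIV) Nx) borel vec"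
    by (rule distr_distr[symmetric, OF vecm Nxm])
  also have "\<dots> = distr balls.joint_law borel (vec \<circ> balls.cell_count)"
    unfolding law by (rule distr_distr[OF vecm balls.cell_count_measurable])
  also have "\<dots> = distr balls.joint_law borel (\<lambda>\<omega>. \<Sum>\<^sub>\<infinity>k\<in>I. \<omega> k)"
    by (rule distr_cong_AE)
       (use summ measurable_comp[OF balls.cell_count_measurable vecm] in
         \<open>auto elim: eventually_mono intro: borel_measurable_infsum_coordinates balls.coordinate_measurable\<close>)
  finally have dist: "distr M borel (\<lambda>\<omega>. \<chi> i. measure (X \<omega>) (D i)) = distr balls.joint_law borel (\<lambda>\<omega>. \<Sum>\<^sub>\<infinity>k\<in>I. \<omega> k)" .
  have ll: "lam k i = l k i" if "k \<in> I" for k i using that by (simp add: l_def)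
  show ?thesis
  proof (intro conjI fin_D exI[of _ balls.joint_law] exI[of _ "\<lambda>k \<omega>. \<omega> k"] balls.prob_space_balls dist)
    show "\<forall>k\<in>I. (\<Sum>i\<in>UNIV. lam k i) \<le> 1" using balls.lam_le by (simp add: ll)
    show "prob_space.indep_vars balls.joint_law (\<lambda>_. borel) (\<lambda>k \<omega>. \<omega> k) I"
      by (rule prob_space.indep_vars_subset[OF balls.prob_space_balls balls.balls_indep]) simp
    show "\<forall>k\<in>I. \<forall>i. measure balls.joint_law {\<omega> \<in> space balls.joint_law. \<omega> k = axis i 1} = lam k i"
      using balls.measure_balls_axis by (simp add: ll)
    show "\<forall>k\<in>I. measure balls.joint_law {\<omega> \<in> space balls.joint_law. \<omega> k = 0} = 1 - (\<Sum>i\<in>UNIV. lam k i)"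
      using balls.measure_balls_0 by (simp add: ll)
    show "AE \<omega> in balls.joint_law. (\<lambda>k. \<omega> k) summable_on I"
      using summ by eventually_elim simp
  qed
qed

end
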